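(* Let $p>0$, let $m\in\mathbb{Z}$ with $m\neq 0$, and let $\alpha,\beta>0$ satisfy $\alpha\beta=\pi^2$. Then \begin{align*} &\alpha^{-m}\left\{\frac{1}{2}\zeta_{p}(2m+1)+\sum_{j=1}^{\infty}\frac{p^2+\lambda_j^2}{p\left(p+\frac{1}{\pi}\right)+\lambda_j^2}\cdot\frac{\lambda_{j}^{-2m-1}}{\sigma\left(\frac{\lambda_j \alpha}{\pi} \right)e^{2\alpha \lambda_j}-1}\right\}\\ &=(-\beta)^{-m}\left\{\frac{1}{2}\zeta_{p}(2m+1)+\sum_{j=1}^{\infty}\frac{p^2+\lambda_j^2}{p\left(p+\frac{1}{\pi}\right)+\lambda_j^2}\cdot\frac{\lambda_{j}^{-2m-1}}{\sigma\left(\frac{\lambda_j \beta}{\pi} \right)e^{2\beta \lambda_j}-1}\right\}\\ &\quad -2^{2m}\sum_{j=0}^{m+1}\frac{(-1)^jB_{2j}^{(p)}B_{2m-2j+2}^{(p)}}{(2j)!(2m-2j+2)!}\alpha^{m-j+1}\beta^j, \end{align*} where the last finite sum is empty (equal to $0$) if $m+1<0$.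
   Context: For $p>0$, $\lambda_1<\lambda_2<\cdots$ are the positive roots of $p\sin(\pi\lambda)+\lambda\cos(\pi\lambda)=0$. The Koshliakov zeta function is $\zeta_p(s)=\sum_{j=1}^{\infty}\frac{p^2+\lambda_j^2}{p(p+\frac1\pi)+\lambda_j^2}\,\lambda_j^{-s}$ for $\mathrm{Re}(s)>1$; it has an analytic continuation to $\mathbb{C}$ except for a simple pole at $s=1$ with residue $1$, and $\zeta_p(s)$ denotes this continuation. $\sigma(z)=\frac{p+z}{p-z}$. By convention $\frac{1}{\sigma(z)e^{w}-1}$ means $\frac{p-z}{(p+z)e^{w}-(p-z)}$, so it equals $0$ at $z=p$. $\sigma_p(z)=\sum_{j=1}^{\infty}\frac{p^2+\lambda_j^2}{p(p+\frac1\pi)+\lambda_j^2}e^{-\lambda_j z}$ for $\mathrm{Re}(z)>0$. The generalized Bernoulli numbers are $B_0^{(p)}=\frac{1}{1+\frac{1}{\pi p}}$ and, for $k\in\mathbb{N}$, $k\ge1$, $B_{2k}^{(p)}=(-1)^{k+1}4k\int_0^\infty x^{2k-1}\sigma_p(2\pi x)\,dx$. *)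

theory Defs
  imports "HOL-Analysis.Analysis"
begin

text \<open>The root \<open>\<lambda>\<^sub>j\<close> is \<open>koshliakov_root p j\<close> for \<open>j \<ge> 1\<close>. The value \<open>0\<close> at index \<open>0\<close> only starts the
  recursion, so the series below run over \<open>Suc j\<close>. Since the roots of
  \<open>p sin (\<pi> x) + x cos (\<pi> x)\<close> are isolated and unbounded, each \<open>LEAST\<close> is attained.\<close>

primrec koshliakov_root :: "real \<Rightarrow> nat \<Rightarrow> real" where
  "koshliakov_root p 0 = 0"
| "koshliakov_root p (Suc j) =
     (LEAST x. koshliakov_root p j < x \<and> p * sin (pi * x) + x * cos (pi * x) = 0)"

definition koshliakov_weight :: "real \<Rightarrow> nat \<Rightarrow> real" where
  "koshliakov_weight p j =
     (p\<^sup>2 + (koshliakov_root p j)\<^sup>2) / (p * (p + 1 / pi) + (koshliakov_root p j)\<^sup>2)"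

definition koshliakov_zeta_series :: "real \<Rightarrow> complex \<Rightarrow> complex" where
  "koshliakov_zeta_series p s =
     (\<Sum>j. of_real (koshliakov_weight p (Suc j)) * of_real (koshliakov_root p (Suc j)) powr (- s))"

text \<open>The analytic continuation. By the identity theorem it is unique on \<open>- {1}\<close>; its value at the
  pole \<open>1\<close> is unspecified.\<close>

definition koshliakov_zeta :: "real \<Rightarrow> complex \<Rightarrow> complex" where
  "koshliakov_zeta p =
     (SOME f. f holomorphic_on - {1} \<and> (\<forall>s. Re s > 1 \<longrightarrow> f s = koshliakov_zeta_series p s))"

definition koshliakov_sigma_series :: "real \<Rightarrow> complex \<Rightarrow> complex" where
  "koshliakov_sigma_series p z =
     (\<Sum>j. of_real (koshliakov_weight p (Suc j)) * exp (- of_real (koshliakov_root p (Suc j)) * z))"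

text \<open>\<open>koshliakov_bernoulli p k\<close> is \<open>B\<^sub>2\<^sub>k\<close>, i.e. the argument is half the usual index. It is complex
  only because \<open>\<sigma>\<^sub>p\<close> is.\<close>

definition koshliakov_bernoulli :: "real \<Rightarrow> nat \<Rightarrow> complex" where
  "koshliakov_bernoulli p k =
     (if k = 0 then of_real (1 / (1 + 1 / (pi * p)))
      else (- 1) ^ (k + 1) * 4 * of_nat k *
        (LBINT x:{0<..}. of_real (x ^ (2 * k - 1)) * koshliakov_sigma_series p (of_real (2 * pi * x))))"

text \<open>\<open>1 / (\<sigma>(z) e\<^sup>w - 1)\<close> with \<open>\<sigma>(z) = (p + z) / (p - z)\<close>, with fractions cleared so that the value at
  the pole \<open>z = p\<close> of \<open>\<sigma>\<close> is \<open>0\<close>; the literal expression would give \<open>-1\<close> there, as \<open>x / 0 = 0\<close>.\<close>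

definition inverse_sigma_exp_minus_one :: "real \<Rightarrow> real \<Rightarrow> real \<Rightarrow> real" where
  "inverse_sigma_exp_minus_one p z w = (p - z) / ((p + z) * exp w - (p - z))"

end

theory Submission
  imports Defs "HOL-Complex_Analysis.Complex_Analysis" "HOL-Real_Asymp.Real_Asymp"
begin

text \<open>
  The weights are the residues at \<open>\<plusminus> \<lambda>\<^sub>j\<close> of the function
  \<open>\<pi> (p cos \<pi>z - z sin \<pi>z) / (p sin \<pi>z + z cos \<pi>z)\<close>, whose values on the imaginary axis are given by
  \<open>\<phi>(y) = 1 / (\<sigma>(y) e\<^bsup>2\<pi>y\<^esup> - 1)\<close>. Its partial fraction expansion says
  \<open>\<Sum>\<^sub>j W\<^sub>j / (\<lambda>\<^sub>j\<^sup>2 + y\<^sup>2) = \<pi> / (2 y) (1 + 2 \<phi>(y))\<close> for \<open>Re y > 0\<close>, where \<open>\<lambda>\<^sub>0 = 0\<close>.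
  Inserting it turns both sides of the formula into double series whose terms contain
  \<open>1 / (X + Y)\<close> with \<open>X = a\<^sup>2 \<lambda>\<^sub>j\<^sup>2\<close>, \<open>Y = \<lambda>\<^sub>k\<^sup>2\<close> and \<open>a = \<alpha> / \<pi>\<close>.

  For \<open>m > 0\<close> the double series converge absolutely, and
  \<open>X\<^bsup>-m\<^esup> - (- Y)\<^bsup>-m\<^esup>\<close> is divisible by \<open>X + Y\<close>, so that their combination splits into products of zeta
  values at even integers, that is, of Bernoulli numbers.

  For \<open>m = - n < 0\<close> one integrates instead against the signed measure \<open>\<Sum>\<^sub>j W\<^sub>j \<delta>(\<lambda>\<^sub>j) - dx\<close>; the Lebesgue part
  produces \<open>\<zeta>\<^sub>p(1 - 2 n) = 2 (-1)\<^sup>n \<integral> y\<^bsup>2n-1\<^esup> \<phi>(y) dy\<close>. Here \<open>X\<^sup>n\<close> has to be replaced by a rational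
  function \<open>f\<close> of the same parity that decays and tends to \<open>X\<^sup>n\<close>. The quotient \<open>(f(X) - f(- Y)) / (X + Y)\<close>
  is a finite sum of products, whose integrals are values of \<open>\<phi>\<close> far from the origin and hence
  exponentially small. Only the mass at the origin contributes, and only for \<open>n = 1\<close>.
\<close>

section \<open>Roots of the characteristic equation\<close>

text \<open>For m < 0 the unmodified double series diverge, since X^n / (X + Y) is not summable over
  pairs of roots. Subtracting Lebesgue measure in both variables helps because 1 / (x^2 + z^2)
  integrates over the half line to exactly pi / (2 z), the leading term of the partial fraction
  expansion, so that only phi remains. The growth of X^n still forbids exchanging the integrations,
  whence the regularisation. Its poles must avoid the real axis, as f is evaluated at X and at -Y.
  They are purely imaginary, with modulus proportional to a parameter u: a square root z of -\<tau>
  then has real part sqrt(|\<tau>| / 2), and phi(z) beats the residues, which grow like u^(n+1).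
  Zeta at negative odd integers is reached through the Mellin representation (2 / pi) sin(pi s / 2)
  int y^(1-s) q(y) dy on 1 < Re s < 2, where q is the expansion without its term at the origin. This
  q is bounded near 0, and away from 0 it is explicit up to phi; both facts together continue the
  integral to the left.\<close>

declare koshliakov_root.simps(2) [simp del]

locale koshliakov =
  fixes p :: real
  assumes p_pos: "p > 0"
begin

abbreviation root :: "nat \<Rightarrow> real" where "root \<equiv> koshliakov_root p"
abbreviation wt :: "nat \<Rightarrow> real" where "wt \<equiv> koshliakov_weight p"

text \<open>Up to the sign (-1)^j the function equals p at j + 1/2 and -(j + 1) at j + 1, so it
  changes sign in between.\<close>

lemma root_exists:
  "\<exists>x. real j + 1/2 < x \<and> x < real j + 1 \<and> p * sin (pi * x) + x * cos (pi * x) = 0"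
proof -
  define g where "g x = (-1) ^ j * (p * sin (pi * x) + x * cos (pi * x))" for x :: real
  have e1: "pi * (real j + 1/2) = pi / 2 + real j * pi" and e2: "pi * (real j + 1) = pi + real j * pi"
    by (auto simp: algebra_simps)
  have g1: "g (real j + 1/2) = p"
    unfolding g_def e1 by (simp add: sin_add cos_add flip: power_mult_distrib)
  have g2: "g (real j + 1) = - (real j + 1)"
    unfolding g_def e2 by (simp add: sin_add cos_add algebra_simps flip: power_mult_distrib)
  have "\<exists>x. real j + 1/2 \<le> x \<and> x \<le> real j + 1 \<and> g x = 0"
    by (rule IVT2') (use g1 g2 p_pos in \<open>auto simp: g_def intro!: continuous_intros\<close>)
  then obtain x where x: "real j + 1/2 \<le> x" "x \<le> real j + 1" "g x = 0" by blast
  moreover have "x \<noteq> real j + 1/2" "x \<noteq> real j + 1" using x(3) g1 g2 p_pos by auto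
  ultimately show ?thesis by (intro exI[of _ x]) (auto simp: g_def)
qed

text \<open>Two zeros x < y would give p sin(pi (y - x)) = (x - y) cos(pi x) cos(pi y). Both cosines
  have the same sign on the interval, so the right side is negative, whereas 0 < pi (y - x) < pi
  makes the left side positive.\<close>

lemma root_unique:
  assumes "real j + 1/2 < x" "x < real j + 1" "p * sin (pi * x) + x * cos (pi * x) = 0"
    and "real j + 1/2 < y" "y < real j + 1" "p * sin (pi * y) + y * cos (pi * y) = 0"
  shows "x = y"
proof -
  have le: False if A: "real j + 1/2 < x" "x < y" "y < real j + 1"
    "p * sin (pi * x) + x * cos (pi * x) = 0" "p * sin (pi * y) + y * cos (pi * y) = 0" for x y
  proof -
    have neg: "(-1) ^ j * cos (pi * t) < 0" if "real j + 1/2 < t" "t < real j + 1" for t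
    proof -
      have "cos (pi * (t - real j) - pi) > 0"
      proof (rule cos_gt_zero_pi)
        have "pi * (1/2) < pi * (t - real j)" "pi * (t - real j) < pi * 1"
          using that by (auto simp del: mult_1_right intro!: mult_strict_left_mono)
        then show "- (pi / 2) < pi * (t - real j) - pi" "pi * (t - real j) - pi < pi / 2"
          using pi_gt_zero by linarith+
      qed
      then have "cos (pi * (t - real j)) < 0" by (simp add: cos_diff)
      moreover have "cos (pi * (t - real j)) = (-1) ^ j * cos (pi * t)"
        by (simp add: right_diff_distrib cos_diff mult.commute[of pi "real j"])
      ultimately show ?thesis by simp
    qed
    have pr: "cos (pi * x) * cos (pi * y) > 0"
    proof -
      have "((-1) ^ j * cos (pi * x)) * ((-1) ^ j * cos (pi * y)) > 0"
        using neg A by (intro mult_neg_neg) auto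
      then show ?thesis by (simp add: mult_ac flip: power_mult_distrib)
    qed
    have "p * sin (pi * (y - x)) = p * sin (pi * y) * cos (pi * x) - cos (pi * y) * (p * sin (pi * x))"
      by (simp add: right_diff_distrib sin_diff algebra_simps)
    also have "\<dots> = (- y * cos (pi * y)) * cos (pi * x) - cos (pi * y) * (- x * cos (pi * x))"
      using A(4,5) by (metis add_eq_0_iff2 minus_mult_left)
    also have "\<dots> = (x - y) * (cos (pi * x) * cos (pi * y))" by (simp add: algebra_simps)
    also have "\<dots> < 0" using pr A by (intro mult_neg_pos) auto
    finally have "sin (pi * (y - x)) < 0" using p_pos by (simp add: mult_less_0_iff)
    moreover have "sin (pi * (y - x)) > 0"
    proof (rule sin_gt_zero)
      show "0 < pi * (y - x)" using A by simp
      have "pi * (y - x) < pi * 1" using A by (intro mult_strict_left_mono) auto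
      then show "pi * (y - x) < pi" by simp
    qed
    ultimately show False by linarith
  qed
  show ?thesis using le[of x y] le[of y x] assms by (cases x y rule: linorder_cases) auto
qed

text \<open>With t the fractional part of x the equation becomes p sin(pi t) + x cos(pi t) = 0. For
  t <= 1/2 both summands are nonnegative, so sine and cosine would have to vanish together.\<close>

lemma root_interval:
  assumes "x > 0" "p * sin (pi * x) + x * cos (pi * x) = 0"
  shows "\<exists>j. real j + 1/2 < x \<and> x < real j + 1"
proof -
  define j where "j = nat \<lfloor>x\<rfloor>"
  define t where "t = x - real j"
  have t: "0 \<le> t" "t < 1" using assms unfolding t_def j_def by linarith+
  have xj: "x = t + real j" by (simp add: t_def)
  have xt: "pi * x = pi * t + real j * pi" by (simp add: xj algebra_simps)
  have "p * sin (pi * x) + x * cos (pi * x) = (-1) ^ j * (p * sin (pi * t) + x * cos (pi * t))"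
    unfolding xt by (simp add: sin_add cos_add algebra_simps)
  then have 0: "p * sin (pi * t) + x * cos (pi * t) = 0" using assms by simp
  have "t > 1/2"
  proof (rule ccontr)
    assume "\<not> t > 1/2"
    then have t2: "pi * t \<le> pi / 2" by simp
    have s: "sin (pi * t) \<ge> 0" by (rule sin_ge_zero) (use t t2 pi_gt_zero in \<open>simp, linarith\<close>)
    have "pi * t \<ge> 0" using t by simp
    then have t3: "- (pi / 2) \<le> pi * t" using pi_gt_zero by linarith
    have c: "cos (pi * t) \<ge> 0" by (rule cos_ge_zero) (use t2 t3 in simp_all)
    have "p * sin (pi * t) \<ge> 0" "x * cos (pi * t) \<ge> 0" using s c p_pos assms by auto
    then have "p * sin (pi * t) = 0" "x * cos (pi * t) = 0" using 0 by linarith+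
    then have "sin (pi * t) = 0" "cos (pi * t) = 0" using assms p_pos by auto
    then show False using sin_cos_squared_add[of "pi * t"] by simp
  qed
  then show ?thesis using t xj by (intro exI[of _ j]) auto
qed

text \<open>Ties the recursion by \<open>LEAST\<close> to the intervals (j + 1/2, j + 1). The
  induction is strong because a competing zero in an earlier interval must be identified with an
  earlier root before it can be excluded.\<close>

lemma root_Suc:
  "real j + 1/2 < root (Suc j) \<and> root (Suc j) < real j + 1 \<and>
   p * sin (pi * root (Suc j)) + root (Suc j) * cos (pi * root (Suc j)) = 0"
proof (induction j rule: less_induct)
  case (less j)
  obtain r where r: "real j + 1/2 < r" "r < real j + 1" "p * sin (pi * r) + r * cos (pi * r) = 0"
    using root_exists by blast
  have prev: "root j < real j + 1/2" "root j \<ge> 0"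
    using less.IH[of "j - 1"] by (cases j; simp)+
  have "root (Suc j) = r"
    unfolding koshliakov_root.simps
  proof (rule Least_equality)
    show "root j < r \<and> p * sin (pi * r) + r * cos (pi * r) = 0" using prev r by auto
    fix y assume y: "root j < y \<and> p * sin (pi * y) + y * cos (pi * y) = 0"
    then obtain k where k: "real k + 1/2 < y" "y < real k + 1"
      using root_interval[of y] prev by auto
    have "k \<ge> j"
    proof (rule ccontr)
      assume "\<not> k \<ge> j"
      then have kj: "k < j" by simp
      then have yk: "y = root (Suc k)" using root_unique[of k y "root (Suc k)"] less.IH[of k] k y by auto
      show False
      proof (cases "Suc k = j")
        case True then show ?thesis using yk y by auto
      next
        case False
        then obtain i where i: "j = Suc i" "k < i" using kj by (cases j) auto
        have "root (Suc i) > real i + 1/2" using less.IH[of i] i by auto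
        moreover have "real k + 1 \<le> real i" using i by linarith
        ultimately show False using k y i by auto
      qed
    qed
    then consider "k = j" | "real k \<ge> real j + 1" by (metis Suc_leI le_neq_implies_less of_nat_Suc of_nat_le_iff add.commute)
    then show "r \<le> y"
    proof cases
      case 1 then show ?thesis using root_unique[of j r y] r k y by auto
    next
      case 2 then show ?thesis using r k by auto
    qed
  qed
  then show ?case using r by simp
qed

lemma root_gt: "root (Suc j) > real j + 1/2" and root_less: "root (Suc j) < real j + 1"
  and root_eq: "p * sin (pi * root (Suc j)) + root (Suc j) * cos (pi * root (Suc j)) = 0"
  using root_Suc by auto

lemma root_pos [simp]: "root (Suc j) > 0"
  using root_gt[of j] by linarith

lemma root_Suc_neq_0 [simp]: "root (Suc j) \<noteq> 0"
  using root_pos[of j] by linarith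

lemma positive_root:
  assumes "x > 0" "p * sin (pi * x) + x * cos (pi * x) = 0"
  obtains j where "x = root (Suc j)"
  using root_interval[OF assms] root_unique root_Suc assms by metis

lemma inj_root_Suc: "inj (\<lambda>j. root (Suc j))"
proof (rule injI)
  fix i j assume "root (Suc i) = root (Suc j)"
  then have "real i + 1/2 < real j + 1" "real j + 1/2 < real i + 1"
    using root_Suc[of i] root_Suc[of j] by linarith+
  then show "i = j" by linarith
qed

lemma weight_pos: "wt j > 0" and weight_le_1: "wt j \<le> 1"
proof -
  have e: "p * (p + 1 / pi) = p\<^sup>2 + p / pi" by (simp add: algebra_simps power2_eq_square)
  have 1: "p / pi > 0" using p_pos by simp
  have "p\<^sup>2 > 0" using p_pos by simp
  moreover have "(root j)\<^sup>2 \<ge> 0" by simp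
  ultimately have 2: "p\<^sup>2 + (root j)\<^sup>2 > 0" by linarith
  with 1 have 3: "p\<^sup>2 + p / pi + (root j)\<^sup>2 > 0" by linarith
  show "wt j > 0" "wt j \<le> 1" unfolding koshliakov_weight_def e
    using 1 2 3 by (auto intro!: divide_pos_pos divide_le_eq_1_pos[THEN iffD2])
qed

end

section \<open>Partial fractions\<close>

context koshliakov begin

text \<open>The quotient \<open>cnum / cden\<close> plays the role of the cotangent: it tends to
  cot(pi z) as p grows.\<close>

definition cden :: "complex \<Rightarrow> complex" where
  "cden z = of_real p * sin (of_real pi * z) + z * cos (of_real pi * z)"

definition cnum :: "complex \<Rightarrow> complex" where
  "cnum z = of_real p * cos (of_real pi * z) - z * sin (of_real pi * z)"

definition phi :: "complex \<Rightarrow> complex" where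
  "phi y = (of_real p - y) / ((of_real p + y) * exp (2 * of_real pi * y) - (of_real p - y))"

text \<open>The squares of the two moduli differ by 4 p Re y. Hence |sigma(y)| >= 1 in the closed
  right half plane away from y = p, which is behind the nonvanishing results and the bound on
  \<open>phi\<close>.\<close>

lemma cmod_sub_less_add: "Re y > 0 \<Longrightarrow> cmod (of_real p - y) < cmod (of_real p + y)"
  and cmod_sub_le_add: "Re y \<ge> 0 \<Longrightarrow> cmod (of_real p - y) \<le> cmod (of_real p + y)"
proof -
  have "(cmod (of_real p + y))\<^sup>2 - (cmod (of_real p - y))\<^sup>2 = 4 * p * Re y"
    unfolding cmod_power2 by (simp add: power2_eq_square algebra_simps)
  moreover have "4 * p * Re y > 0" if "Re y > 0" using that p_pos by simp
  moreover have "4 * p * Re y \<ge> 0" if "Re y \<ge> 0" using that p_pos by simp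
  ultimately have "Re y > 0 \<Longrightarrow> (cmod (of_real p - y))\<^sup>2 < (cmod (of_real p + y))\<^sup>2"
    "Re y \<ge> 0 \<Longrightarrow> (cmod (of_real p - y))\<^sup>2 \<le> (cmod (of_real p + y))\<^sup>2" by linarith+
  then show "Re y > 0 \<Longrightarrow> cmod (of_real p - y) < cmod (of_real p + y)"
    "Re y \<ge> 0 \<Longrightarrow> cmod (of_real p - y) \<le> cmod (of_real p + y)"
    by (metis power2_less_imp_less norm_ge_zero, metis power2_le_imp_le norm_ge_zero)
qed

text \<open>Up to constants, \<open>cden\<close> and \<open>cnum\<close> are the difference and the
  sum of the same two exponential terms, so one comparison of moduli serves both.\<close>

lemma cden_exp: "2 * \<i> * cden z =
    (of_real p + \<i> * z) * exp (\<i> * (of_real pi * z)) - (of_real p - \<i> * z) * exp (- (\<i> * (of_real pi * z)))"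
  unfolding cden_def sin_exp_eq cos_exp_eq by (simp add: field_simps)

lemma cnum_exp: "2 * cnum z =
    (of_real p + \<i> * z) * exp (\<i> * (of_real pi * z)) + (of_real p - \<i> * z) * exp (- (\<i> * (of_real pi * z)))"
  unfolding cnum_def sin_exp_eq cos_exp_eq by (simp add: field_simps)

lemma cden_minus: "cden (- z) = - cden z" and cnum_minus: "cnum (- z) = cnum z"
  by (simp_all add: cden_def cnum_def)

text \<open>In the upper half plane the term with exp(-i pi z) is strictly larger, so neither the
  sum nor the difference of the two terms is zero. The lower half plane follows by parity.\<close>

lemma cden_cnum_nonzero:
  assumes "Im z \<noteq> 0" shows "cden z \<noteq> 0 \<and> cnum z \<noteq> 0"
proof -
  have main: "cden z \<noteq> 0 \<and> cnum z \<noteq> 0" if "Im z > 0" for z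
  proof -
    let ?A = "(of_real p + \<i> * z) * exp (\<i> * (of_real pi * z))"
    let ?B = "(of_real p - \<i> * z) * exp (- (\<i> * (of_real pi * z)))"
    have "cmod ?A = cmod (of_real p + \<i> * z) * exp (- (pi * Im z))"
      by (simp add: norm_mult)
    also have "\<dots> \<le> cmod (of_real p - \<i> * z) * exp (- (pi * Im z))"
      using cmod_sub_less_add[of "- (\<i> * z)"] that by (intro mult_right_mono) auto
    also have "\<dots> < cmod (of_real p - \<i> * z) * exp (pi * Im z)"
      using cmod_sub_less_add[of "- (\<i> * z)"] that
      by (intro mult_strict_left_mono) (auto simp del: zero_less_norm_iff intro: le_less_trans[OF norm_ge_zero])
    also have "\<dots> = cmod ?B" by (simp add: norm_mult)
    finally have "cmod ?A \<noteq> cmod ?B" by simp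
    then have "?A - ?B \<noteq> 0" "?A + ?B \<noteq> 0" by (auto simp: add_eq_0_iff)
    then show ?thesis using cden_exp[of z] cnum_exp[of z] by auto
  qed
  show ?thesis using main[of z] main[of "- z"] cden_minus[of z] cnum_minus[of z] assms by (cases "Im z > 0") auto
qed

lemma cden_of_real: "cden (of_real x) = of_real (p * sin (pi * x) + x * cos (pi * x))"
  by (simp add: cden_def flip: sin_of_real cos_of_real)

lemma cnum_of_real: "cnum (of_real x) = of_real (p * cos (pi * x) - x * sin (pi * x))"
  by (simp add: cnum_def flip: sin_of_real cos_of_real)

lemma cden_zeros:
  "cden z = 0 \<longleftrightarrow> z = 0 \<or> (\<exists>j. z = of_real (root (Suc j)) \<or> z = - of_real (root (Suc j)))"
proof
  assume z: "cden z = 0"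
  then obtain x where x: "z = of_real x" using cden_cnum_nonzero by (metis complex_is_Real_iff Reals_cases)
  have pos: "\<exists>j. t = root (Suc j)" if "t > 0" "cden (of_real t) = 0" for t
    using that positive_root[of t] unfolding cden_of_real of_real_eq_0_iff by metis
  consider "x = 0" | "x > 0" | "- x > 0" by linarith
  then show "z = 0 \<or> (\<exists>j. z = of_real (root (Suc j)) \<or> z = - of_real (root (Suc j)))"
  proof cases
    case 2 then show ?thesis using pos[of x] z x by auto
  next
    case 3
    then have "\<exists>j. - x = root (Suc j)" using pos[of "-x"] z x cden_minus[of z] by auto
    then show ?thesis unfolding x by (metis minus_equation_iff of_real_minus)
  qed (simp add: x)
next
  have "cden (of_real (root (Suc j))) = 0" for j
    unfolding cden_of_real root_eq by simp
  then show "z = 0 \<or> (\<exists>j. z = of_real (root (Suc j)) \<or> z = - of_real (root (Suc j))) \<Longrightarrow> cden z = 0"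
    by (auto simp: cden_minus) (simp add: cden_def)
qed

definition cden' :: "complex \<Rightarrow> complex" where
  "cden' z = (of_real p * of_real pi + 1) * cos (of_real pi * z) - z * of_real pi * sin (of_real pi * z)"

lemma has_field_derivative_cden [derivative_intros]:
  "(f has_field_derivative f') (at z within A) \<Longrightarrow>
    ((\<lambda>z. cden (f z)) has_field_derivative (cden' (f z) * f')) (at z within A)"
proof -
  have "(cden has_field_derivative cden' z) (at z)" for z
    unfolding cden_def [abs_def] cden'_def by (auto intro!: derivative_eq_intros simp: algebra_simps)
  then show "(f has_field_derivative f') (at z within A) \<Longrightarrow>
    ((\<lambda>z. cden (f z)) has_field_derivative (cden' (f z) * f')) (at z within A)"
    by (rule DERIV_chain2)
qed

lemma holomorphic_cden [holomorphic_intros]: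
    "f holomorphic_on A \<Longrightarrow> (\<lambda>z. cden (f z)) holomorphic_on A"
  and holomorphic_cnum [holomorphic_intros]:
    "f holomorphic_on A \<Longrightarrow> (\<lambda>z. cnum (f z)) holomorphic_on A"
  unfolding cden_def cnum_def by (intro holomorphic_intros; assumption)+

lemma cden'_minus: "cden' (- z) = cden' z"
  by (simp add: cden'_def)

text \<open>The root equation gives sin(pi r) = -(r / p) cos(pi r). Eliminating the sine turns
  numerator and derivative into multiples of p^2 + r^2 and of p (p + 1/pi) + r^2 with the common
  factor cos(pi r); this is the origin of the weight.\<close>

lemma cden'_root_nonzero: "cden' (of_real (root (Suc j))) \<noteq> 0"
  and cnum_div_cden'_root:
    "cnum (of_real (root (Suc j))) / cden' (of_real (root (Suc j))) = of_real (wt (Suc j) / pi)"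
proof -
  define r where "r = root (Suc j)"
  define c s where "c = cos (pi * r)" and "s = sin (pi * r)"
  have s: "s = - (r * c / p)" using root_eq[of j] p_pos unfolding r_def c_def s_def by (simp add: field_simps)
  have c: "c \<noteq> 0"
    using s sin_cos_squared_add[of "pi * r"] unfolding s_def c_def by auto
  have d: "cden' (of_real r) = of_real ((p * pi + 1) * c - r * pi * s)"
    unfolding c_def s_def by (simp add: cden'_def flip: sin_of_real cos_of_real)
  have n: "cnum (of_real r) = of_real (p * c - r * s)"
    unfolding c_def s_def cnum_of_real ..
  have e1: "p * ((p * pi + 1) * c - r * pi * s) = c * pi * (p * (p + 1/pi) + r\<^sup>2)"
    using p_pos by (simp add: s field_simps power2_eq_square)
  have e2: "p * (p * c - r * s) = c * (p\<^sup>2 + r\<^sup>2)"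
    using p_pos by (simp add: s field_simps power2_eq_square)
  have pos: "p * (p + 1/pi) + r\<^sup>2 > 0" using p_pos by (intro add_pos_nonneg mult_pos_pos) auto
  have nz: "(p * pi + 1) * c - r * pi * s \<noteq> 0" using e1 c pos by auto
  show "cden' (of_real (root (Suc j))) \<noteq> 0"
    using d nz unfolding r_def by (simp only: of_real_eq_0_iff not_False_eq_True)
  have "(p * c - r * s) / ((p * pi + 1) * c - r * pi * s) = (p * (p * c - r * s)) / (p * ((p * pi + 1) * c - r * pi * s))"
    by (rule mult_divide_mult_cancel_left[symmetric]) (use p_pos in simp)
  also have "\<dots> = wt (Suc j) / pi"
    unfolding e1 e2 koshliakov_weight_def r_def[symmetric] using c pos by (simp add: mult.commute)
  finally show "cnum (of_real (root (Suc j))) / cden' (of_real (root (Suc j))) = of_real (wt (Suc j) / pi)"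
    unfolding d n r_def[symmetric] by (metis of_real_divide)
qed

lemma phi_den_nonzero:
  assumes "Re y > 0" shows "(of_real p + y) * exp (2 * of_real pi * y) - (of_real p - y) \<noteq> 0"
proof
  assume "(of_real p + y) * exp (2 * of_real pi * y) - (of_real p - y) = 0"
  then have "of_real p - y = (of_real p + y) * exp (2 * of_real pi * y)" by simp
  then have "cmod (of_real p - y) = cmod ((of_real p + y) * exp (2 * of_real pi * y))" by simp
  then have "cmod (of_real p - y) = cmod (of_real p + y) * exp (2 * pi * Re y)"
    by (simp add: norm_mult)
  also have "\<dots> \<ge> cmod (of_real p + y) * 1"
    using assms by (intro mult_left_mono) auto
  finally show False using cmod_sub_less_add[OF assms] by simp
qed

lemma cmod_phi_le:
  assumes "Re y > 0" shows "cmod (phi y) \<le> 1 / (exp (2 * pi * Re y) - 1)"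
proof -
  let ?a = "cmod (of_real p + y)" and ?b = "cmod (of_real p - y)" and ?e = "exp (2 * pi * Re y)"
  have e: "?e > 1" using assms by simp
  have b: "?b < ?a" by (rule cmod_sub_less_add[OF assms])
  have "?a * ?e - ?b \<le> cmod ((of_real p + y) * exp (2 * of_real pi * y) - (of_real p - y))"
    by (rule order.trans[OF _ norm_triangle_ineq2]) (simp add: norm_mult)
  moreover have "?b * (?e - 1) \<le> ?a * ?e - ?b" using mult_right_mono[of ?b ?a ?e] b by (simp add: algebra_simps)
  ultimately have le: "?b * (?e - 1) \<le> cmod ((of_real p + y) * exp (2 * of_real pi * y) - (of_real p - y))"
    by linarith
  show ?thesis unfolding phi_def norm_divide
    using le e phi_den_nonzero[OF assms] by (simp add: divide_simps)
qed

text \<open>The analogue of cot(i w) = -i (1 + 2 / (exp(2 w) - 1)), with w = pi y.\<close>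

lemma cnum_div_cden_imaginary:
  assumes "Re y > 0"
  shows "cnum (\<i> * y) / cden (\<i> * y) = - \<i> * (1 + 2 * phi y)"
proof -
  define E where "E = exp (of_real pi * y)"
  have E: "E \<noteq> 0" "exp (2 * of_real pi * y) = E * E" "exp (- (of_real pi * y)) = inverse E"
    using exp_add[of "of_real pi * y" "of_real pi * y"] by (simp_all add: E_def exp_minus mult.assoc flip: mult_2)
  let ?D = "(of_real p + y) * (E * E) - (of_real p - y)"
  have D: "?D \<noteq> 0" using phi_den_nonzero[OF assms] E by simp
  have ex: "\<i> * (of_real pi * (\<i> * y)) = - (of_real pi * y)" and iy: "\<i> * (\<i> * y) = - y"
    by (simp_all add: mult.left_commute[of "of_real pi" \<i>])
  have n: "2 * cnum (\<i> * y) = (of_real p - y) * inverse E + (of_real p + y) * E"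
    unfolding cnum_exp ex iy E(3)[symmetric] by (simp add: E_def)
  have d: "2 * \<i> * cden (\<i> * y) = (of_real p - y) * inverse E - (of_real p + y) * E"
    unfolding cden_exp ex iy E(3)[symmetric] by (simp add: E_def)
  have nE: "2 * cnum (\<i> * y) * E = (of_real p - y) + (of_real p + y) * (E * E)"
    unfolding n using E by (simp add: field_simps)
  have dE: "2 * cden (\<i> * y) * E = \<i> * ?D"
  proof -
    have "2 * \<i> * cden (\<i> * y) * E = - ?D"
      unfolding d using E by (simp add: field_simps)
    then have "\<i> * (2 * \<i> * cden (\<i> * y) * E) = \<i> * - ?D" by (rule arg_cong)
    moreover have "\<i> * (2 * \<i> * cden (\<i> * y) * E) = - (2 * cden (\<i> * y) * E)"
      by (simp add: mult.left_commute[of 2 \<i>] mult.assoc)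
    ultimately show ?thesis by (metis minus_minus mult_minus_right)
  qed
  have "cnum (\<i> * y) / cden (\<i> * y) = (2 * cnum (\<i> * y) * E) / (2 * cden (\<i> * y) * E)"
    using E by simp
  also have "\<dots> = ((of_real p - y) + (of_real p + y) * (E * E)) / (\<i> * ?D)" by (simp only: nE dE)
  also have "\<dots> = - \<i> * (1 + 2 * phi y)"
  proof -
    have "1 + 2 * phi y = (?D + 2 * (of_real p - y)) / ?D"
      unfolding phi_def E add_divide_distrib using D by simp
    then have "- \<i> * (1 + 2 * phi y) = - \<i> * (((of_real p - y) + (of_real p + y) * (E * E)) / ?D)"
      by (simp add: algebra_simps)
    also have "- \<i> * (((of_real p - y) + (of_real p + y) * (E * E)) / ?D) =
      ((of_real p - y) + (of_real p + y) * (E * E)) / (\<i> * ?D)"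
      unfolding divide_inverse by (simp add: mult_ac)
    finally show ?thesis ..
  qed
  finally show ?thesis .
qed

text \<open>At distance e from the real axis one exponential term is at most q = exp(-2 pi e) times
  the other, so sum and difference have ratio at most (1 + q) / (1 - q).\<close>

lemma cnum_cden_bound_away:
  assumes "e > 0" "\<bar>Im z\<bar> \<ge> e"
  shows "cmod (cnum z) \<le> (1 + exp (- 2 * pi * e)) / (1 - exp (- 2 * pi * e)) * cmod (cden z)"
proof -
  define q where "q = exp (- 2 * pi * e)"
  have q: "q < 1" "q > 0" using assms by (auto simp: q_def)
  have main: "cmod (cnum z) \<le> (1 + q) / (1 - q) * cmod (cden z)" if "Im z \<ge> e" for z
  proof -
    define A where "A = (of_real p + \<i> * z) * exp (\<i> * (of_real pi * z))"
    define B where "B = (of_real p - \<i> * z) * exp (- (\<i> * (of_real pi * z)))"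
    have "exp (- (pi * Im z)) = exp (- 2 * pi * Im z) * exp (pi * Im z)"
      by (simp flip: exp_add)
    also have "\<dots> \<le> q * exp (pi * Im z)"
      unfolding q_def using that by (intro mult_right_mono) auto
    finally have "exp (- (pi * Im z)) \<le> q * exp (pi * Im z)" .
    then have "cmod (of_real p + \<i> * z) * exp (- (pi * Im z)) \<le> cmod (of_real p - \<i> * z) * (q * exp (pi * Im z))"
      using cmod_sub_le_add[of "- (\<i> * z)"] that assms(1) by (intro mult_mono) auto
    then have AB: "cmod A \<le> q * cmod B"
      unfolding A_def B_def by (simp add: norm_mult mult_ac)
    have 1: "2 * cmod (cnum z) \<le> cmod A + cmod B"
      using cnum_exp[of z] norm_triangle_ineq[of A B] unfolding A_def[symmetric] B_def[symmetric]
      by (metis norm_mult norm_numeral)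
    have "2 * \<i> * cden z = A - B" using cden_exp[of z] unfolding A_def[symmetric] B_def[symmetric] .
    then have "2 * cmod (cden z) = cmod (A - B)" by (metis norm_mult norm_numeral norm_ii mult.right_neutral)
    then have 2: "cmod B - cmod A \<le> 2 * cmod (cden z)"
      by (metis norm_triangle_ineq2 norm_minus_commute)
    have "cmod (cnum z) * (1 - q) \<le> ((1 + q) * cmod B) / 2 * (1 - q)"
      using 1 AB q by (intro mult_right_mono) (auto simp: algebra_simps)
    also have "\<dots> = (1 + q) * (((1 - q) * cmod B) / 2)" by simp
    also have "\<dots> \<le> (1 + q) * cmod (cden z)"
      using 2 AB q by (intro mult_left_mono) (auto simp: algebra_simps)
    finally show ?thesis using q by (simp add: field_simps)
  qed
  show ?thesis unfolding q_def[symmetric]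
    using main[of z] main[of "- z"] assms(2) by (cases "Im z \<ge> 0") (auto simp: cden_minus cnum_minus)
qed

text \<open>Integer radii avoid the poles, since each positive root lies in some (j + 1/2, j + 1)
  and tends to its left end as j grows. Far from the real axis the preceding bound applies; close to
  it the circle is near +-N, where the sine is small and the cosine has modulus near 1, so that z
  cos(pi z) dominates \<open>cden\<close>.\<close>

lemma cnum_cden_bound_circle:
  "\<exists>M N0. \<forall>N\<ge>N0. \<forall>z. cmod z = real N \<longrightarrow> cmod (cnum z) \<le> M * cmod (cden z)"
proof -
  have "((\<lambda>d. cmod (cos (of_real pi * d))) \<longlongrightarrow> cmod (cos (of_real pi * 0))) (at (0::complex))"
    by (intro tendsto_intros)
  moreover have "((\<lambda>d. cmod (sin (of_real pi * d))) \<longlongrightarrow> cmod (sin (of_real pi * 0))) (at (0::complex))"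
    by (intro tendsto_intros)
  ultimately have "eventually (\<lambda>d. cmod (cos (of_real pi * d)) > 1/2 \<and> cmod (cos (of_real pi * d)) < 2
      \<and> cmod (sin (of_real pi * d)) < 1) (at (0::complex))"
    by (intro eventually_conj order_tendstoD) auto
  then obtain r where r: "r > 0" and
    "\<And>d. d \<noteq> 0 \<Longrightarrow> dist d 0 < r \<Longrightarrow> cmod (cos (of_real pi * d)) > 1/2 \<and> cmod (cos (of_real pi * d)) < 2
      \<and> cmod (sin (of_real pi * d)) < 1"
    unfolding eventually_at by (metis UNIV_I)
  then have near: "cmod (cos (of_real pi * d)) > 1/2 \<and> cmod (cos (of_real pi * d)) < 2
      \<and> cmod (sin (of_real pi * d)) < 1" if "cmod d < r" for d
    using that by (cases "d = 0") auto
  \<comment> \<open>The bound e <= 1 yields N - Re z <= (Im z)^2 <= |Im z| < e. Real and imaginary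
    part of z - N are then both below e, and 2 e < r.\<close>
  define e where "e = min (r / 4) 1"
  have e: "e > 0" "e \<le> 1" "2 * e < r" using r by (auto simp: e_def)
  define N0 where "N0 = nat \<lceil>4 * p + 1\<rceil>"
  \<comment> \<open>Near the real axis N >= 4 p + 1 gives |cden z| >= N / 2 - p >= N / 4 and |cnum
    z| <= 2 p + N <= 2 N, whence the 8.\<close>
  define M where "M = max ((1 + exp (- 2 * pi * e)) / (1 - exp (- 2 * pi * e))) 8"
  have "cmod (cnum z) \<le> M * cmod (cden z)" if N: "N \<ge> N0" and z: "cmod z = real N" for N z
  proof (cases "\<bar>Im z\<bar> \<ge> e")
    case True
    have "cmod (cnum z) \<le> (1 + exp (- 2 * pi * e)) / (1 - exp (- 2 * pi * e)) * cmod (cden z)"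
      by (rule cnum_cden_bound_away) (use e True in auto)
    also have "\<dots> \<le> M * cmod (cden z)" unfolding M_def by (intro mult_right_mono) auto
    finally show ?thesis .
  next
    case False
    have Np: "real N \<ge> 4 * p + 1" using N unfolding N0_def by linarith
    have main: "cmod (cnum z) \<le> 8 * cmod (cden z)" if z: "cmod z = real N" "\<bar>Im z\<bar> < e" "Re z \<ge> 0" for z
    proof -
      define d where "d = z - of_nat N"
      have "(real N - Re z) * (real N + Re z) = (Im z)\<^sup>2"
        using cmod_power2[of z] z(1) by (simp add: power2_eq_square algebra_simps)
      moreover have "real N - Re z \<ge> 0" using complex_Re_le_cmod[of z] z by simp
      moreover have "(real N - Re z) * 1 \<le> (real N - Re z) * (real N + Re z)"
        using Np p_pos z(3) calculation(2) by (intro mult_left_mono) auto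
      moreover have "\<bar>Im z\<bar> * \<bar>Im z\<bar> \<le> \<bar>Im z\<bar> * 1" using z(2) e by (intro mult_left_mono) auto
      then have "(Im z)\<^sup>2 \<le> \<bar>Im z\<bar>" by (simp add: power2_eq_square)
      ultimately have "\<bar>Re d\<bar> < e" using z(2) by (simp add: d_def)
      then have "cmod d < r" using cmod_le[of d] z(2) e by (simp add: d_def)
      note nr = near[OF this]
      have zd: "of_real pi * z = of_real pi * d + of_real (real N * pi)" by (simp add: d_def algebra_simps)
      have c: "cmod (cos (of_real pi * z)) = cmod (cos (of_real pi * d))"
        and s: "cmod (sin (of_real pi * z)) = cmod (sin (of_real pi * d))"
        unfolding zd cos_add sin_add cos_of_real sin_of_real by (simp_all add: norm_mult norm_power)
      have "cmod (cden z) \<ge> cmod (z * cos (of_real pi * z)) - cmod (of_real p * sin (of_real pi * z))"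
        unfolding cden_def by (metis add.commute norm_diff_ineq)
      moreover have "cmod (z * cos (of_real pi * z)) \<ge> real N * (1/2)"
        unfolding norm_mult c z(1) using nr by (intro mult_left_mono) auto
      moreover have "cmod (of_real p * sin (of_real pi * z)) \<le> p * 1"
        unfolding norm_mult s using nr p_pos by (simp add: mult_left_le)
      ultimately have den: "cmod (cden z) \<ge> real N / 4" using Np by linarith
      have "cmod (cnum z) \<le> cmod (of_real p * cos (of_real pi * z)) + cmod (z * sin (of_real pi * z))"
        unfolding cnum_def by (rule norm_triangle_ineq4)
      moreover have "cmod (of_real p * cos (of_real pi * z)) \<le> p * 2"
        unfolding norm_mult c using nr p_pos by (simp add: less_imp_le)
      moreover have "cmod (z * sin (of_real pi * z)) \<le> real N * 1"
        unfolding norm_mult s z(1) using nr by (intro mult_left_mono) auto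
      ultimately have "cmod (cnum z) \<le> 2 * real N" using Np p_pos by linarith
      then show ?thesis using den by linarith
    qed
    have "cmod (cnum z) \<le> 8 * cmod (cden z)"
      using main[of z] main[of "- z"] False z by (cases "Re z \<ge> 0") (auto simp: cden_minus cnum_minus)
    also have "\<dots> \<le> M * cmod (cden z)" unfolding M_def by (intro mult_right_mono) auto
    finally show ?thesis .
  qed
  then show ?thesis by blast
qed

text \<open>The term \<open>j = 0\<close> accounts for the pole at the origin, half of which belongs to the positive half line.\<close>

definition mass :: "nat \<Rightarrow> real" where
  "mass j = (if j = 0 then wt 0 / 2 else wt j)"

lemma mass_pos: "mass j > 0"
  using weight_pos by (simp add: mass_def)

lemma weight_0: "wt 0 = p * pi / (p * pi + 1)"
proof -
  have "p * (p + 1 / pi) = p * (p * pi + 1) / pi" by (simp add: field_simps)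
  moreover have "p * pi + 1 > 0" using p_pos by (simp add: add_pos_pos)
  ultimately show ?thesis using p_pos by (simp add: koshliakov_weight_def power2_eq_square)
qed

text \<open>Residue theorem for the circle of radius N, which encloses 0, the first N roots with
  their negatives, and +-i y. The integrand is odd, so opposite poles have equal residues. The pole
  at 0 has no partner and therefore enters with half its weight.\<close>

lemma partial_fraction_residues:
  fixes y :: complex
  assumes y: "Re y > 0" "cmod y < real N"
  defines "f \<equiv> (\<lambda>z. cnum z / (cden z * (z\<^sup>2 + y\<^sup>2)))"
  shows "contour_integral (circlepath 0 (real N)) f =
    2 * pi * \<i> * (2 / pi * (\<Sum>j\<le>N. of_real (mass j) / ((of_real (root j))\<^sup>2 + y\<^sup>2)) - (1 + 2 * phi y) / y)"
proof -
  define S where "S = ball (0::complex) (real N + 1/2)"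
  define R1 R2 where "R1 = (\<lambda>j. complex_of_real (root (Suc j))) ` {..<N}"
    and "R2 = (\<lambda>j. - complex_of_real (root (Suc j))) ` {..<N}"
  define Y where "Y = {\<i> * y, - (\<i> * y)}"
  define pts where "pts = insert 0 (R1 \<union> R2 \<union> Y)"
  let ?G = "\<lambda>z. cden z * (z\<^sup>2 + y\<^sup>2)"
  have y0: "y \<noteq> 0" using y by auto
  have N: "real N > 0" using y(2) norm_ge_zero[of y] by linarith
  have sq: "z\<^sup>2 + y\<^sup>2 = (z - \<i> * y) * (z + \<i> * y)" for z
    by (simp add: power2_eq_square algebra_simps)
  have fin: "finite pts" by (simp add: pts_def R1_def R2_def Y_def)
  have inside: "cmod z < real N" if "z \<in> pts" for z
  proof -
    have "root (Suc j) < real N" if "j < N" for j using root_less[of j] that by linarith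
    then show ?thesis using that y N
      by (auto simp: pts_def R1_def R2_def Y_def norm_mult abs_of_pos)
  qed
  have zeros: "?G z \<noteq> 0" if "z \<in> S - pts" for z
  proof
    assume "?G z = 0"
    moreover have "z\<^sup>2 + y\<^sup>2 \<noteq> 0" using that unfolding sq pts_def Y_def by (auto simp: eq_neg_iff_add_eq_0)
    ultimately have "cden z = 0" by simp
    moreover have "z \<noteq> 0" using that by (auto simp: pts_def)
    ultimately obtain j where j: "z = of_real (root (Suc j)) \<or> z = - of_real (root (Suc j))"
      unfolding cden_zeros by blast
    then have "root (Suc j) < real N + 1/2" using that by (auto simp: S_def abs_of_pos)
    then have "j < N" using root_gt[of j] by linarith
    then show False using j that by (auto simp: pts_def R1_def R2_def)
  qed
  have holo: "f holomorphic_on S - pts"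
    unfolding f_def using zeros by (intro holomorphic_intros) auto
  have "contour_integral (circlepath 0 (real N)) f =
      2 * pi * \<i> * (\<Sum>w\<in>pts. winding_number (circlepath 0 (real N)) w * residue f w)"
  proof (rule Residue_theorem)
    show "path_image (circlepath 0 (real N)) \<subseteq> S - pts"
      by (auto simp: S_def path_image_circlepath_nonneg sphere_def dest: inside)
    show "\<forall>z. z \<notin> S \<longrightarrow> winding_number (circlepath 0 (real N)) z = 0"
      by (auto simp: S_def intro!: winding_number_zero_outside[where s="cball 0 (real N)"])
  qed (use holo fin in \<open>auto simp: S_def\<close>)
  also have "(\<Sum>w\<in>pts. winding_number (circlepath 0 (real N)) w * residue f w) = (\<Sum>w\<in>pts. residue f w)"
    using inside by (intro sum.cong) (auto simp: winding_number_circlepath)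
  also have "\<dots> = 2 / pi * (\<Sum>j\<le>N. of_real (mass j) / ((of_real (root j))\<^sup>2 + y\<^sup>2)) - (1 + 2 * phi y) / y"
  proof -
    have res: "residue f w = cnum w / G'"
      if "(?G has_field_derivative G') (at w)" "cnum w \<noteq> 0" "?G w = 0" "G' \<noteq> 0" for w G'
      unfolding f_def by (rule residue_simple_pole_deriv[where s=UNIV]) (use that in \<open>auto intro!: holomorphic_intros\<close>)
    have DG: "(?G has_field_derivative (cden' w * (w\<^sup>2 + y\<^sup>2) + cden w * (2 * w))) (at w)" for w
      by (auto intro!: derivative_eq_intros)
    have ny: "(complex_of_real (root j))\<^sup>2 + y\<^sup>2 \<noteq> 0" for j
    proof
      assume "(complex_of_real (root j))\<^sup>2 + y\<^sup>2 = 0"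
      then have "complex_of_real (root j) - \<i> * y = 0 \<or> complex_of_real (root j) + \<i> * y = 0" unfolding sq by simp
      then have "Im (complex_of_real (root j) - \<i> * y) = 0 \<or> Im (complex_of_real (root j) + \<i> * y) = 0" by (metis zero_complex.sel(2))
      then show False using y by auto
    qed
    define T where "T j = of_real (mass j) / ((of_real (root j))\<^sup>2 + y\<^sup>2)" for j
    have r0: "residue f 0 = 2 / pi * (of_real (mass 0) / ((of_real (root 0))\<^sup>2 + y\<^sup>2))"
    proof -
      have nz: "complex_of_real p * of_real pi + 1 \<noteq> 0"
      proof -
        have "p * pi + 1 \<noteq> 0" using p_pos by (intro add_pos_pos less_imp_neq[symmetric]) auto
        then have "complex_of_real (p * pi + 1) \<noteq> 0" by (simp only: of_real_eq_0_iff not_False_eq_True)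
        then show ?thesis by simp
      qed
      have "residue f 0 = cnum 0 / (cden' 0 * (0\<^sup>2 + y\<^sup>2) + cden 0 * (2 * 0))"
        by (rule res[OF DG]) (use p_pos y0 nz in \<open>auto simp: cden_def cnum_def cden'_def\<close>)
      also have "\<dots> = (of_real p * of_real pi / (of_real p * of_real pi + 1)) / (of_real pi * y\<^sup>2)"
        by (simp add: cden_def cnum_def cden'_def)
      also have "of_real p * of_real pi / (of_real p * of_real pi + 1) = 2 * complex_of_real (mass 0)"
      proof -
        have "2 * complex_of_real (mass 0) = of_real (wt 0)" by (simp add: mass_def)
        then show ?thesis by (simp add: weight_0)
      qed
      also have "\<dots> / (of_real pi * y\<^sup>2) = 2 / pi * (of_real (mass 0) / ((of_real (root 0))\<^sup>2 + y\<^sup>2))"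
        by simp
      finally show ?thesis .
    qed
    have r12: "residue f (of_real (root (Suc j))) = 1 / pi * T (Suc j)"
      "residue f (- of_real (root (Suc j))) = 1 / pi * T (Suc j)" for j
    proof -
      define r where "r = complex_of_real (root (Suc j))"
      have z: "cden r = 0" using cden_zeros unfolding r_def by blast
      have cd: "cnum r / cden' r = of_real (mass (Suc j)) / of_real pi"
        using cnum_div_cden'_root[of j] by (simp add: r_def mass_def)
      then have n: "cnum r \<noteq> 0" using mass_pos[of "Suc j"] by auto
      have q: "cnum r / (cden' r * (r\<^sup>2 + y\<^sup>2)) = 1 / pi * T (Suc j)"
      proof -
        have "cnum r / (cden' r * (r\<^sup>2 + y\<^sup>2)) = cnum r / cden' r / (r\<^sup>2 + y\<^sup>2)" by simp
        also have "\<dots> = 1 / pi * T (Suc j)" unfolding cd by (simp add: T_def r_def)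
        finally show ?thesis .
      qed
      have "residue f r = cnum r / (cden' r * (r\<^sup>2 + y\<^sup>2) + cden r * (2 * r))"
        by (rule res[OF DG]) (use n z ny[of "Suc j"] cden'_root_nonzero in \<open>auto simp: r_def\<close>)
      then show "residue f (of_real (root (Suc j))) = 1 / pi * T (Suc j)"
        using q z by (simp add: r_def)
      have "residue f (- r) = cnum (- r) / (cden' (- r) * ((- r)\<^sup>2 + y\<^sup>2) + cden (- r) * (2 * (- r)))"
        by (rule res[OF DG]) (use n z ny[of "Suc j"] cden'_root_nonzero in \<open>auto simp: cden_minus cnum_minus cden'_minus r_def\<close>)
      then show "residue f (- of_real (root (Suc j))) = 1 / pi * T (Suc j)"
        using q z by (simp add: cden_minus cnum_minus cden'_minus r_def)
    qed
    have im: "Im (\<i> * y) \<noteq> 0" using y by simp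
    have ri: "residue f (\<i> * y) = - (1 + 2 * phi y) / (2 * y)" "residue f (- (\<i> * y)) = - (1 + 2 * phi y) / (2 * y)"
    proof -
      note nz = cden_cnum_nonzero[OF im]
      have q: "- \<i> * X / (2 * (\<i> * y)) = - X / (2 * y)" for X
      proof -
        have "- \<i> * X / (2 * (\<i> * y)) = (\<i> * (- X)) / (\<i> * (2 * y))"
          by (simp only: mult_minus_left mult_minus_right mult.left_commute[of 2 \<i>])
        also have "\<dots> = - X / (2 * y)" by (rule mult_divide_mult_cancel_left) simp
        finally show ?thesis .
      qed
      have iy2: "(\<i> * y)\<^sup>2 + y\<^sup>2 = 0" by (simp add: power_mult_distrib)
      have "residue f (\<i> * y) = cnum (\<i> * y) / (cden' (\<i> * y) * ((\<i> * y)\<^sup>2 + y\<^sup>2) + cden (\<i> * y) * (2 * (\<i> * y)))"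
        by (rule res[OF DG]) (use nz y0 iy2 in auto)
      also have "\<dots> = cnum (\<i> * y) / cden (\<i> * y) / (2 * (\<i> * y))" unfolding iy2 by simp
      also have "\<dots> = - (1 + 2 * phi y) / (2 * y)" unfolding cnum_div_cden_imaginary[OF y(1)] by (rule q)
      finally show "residue f (\<i> * y) = - (1 + 2 * phi y) / (2 * y)" .
      have "residue f (- (\<i> * y)) = cnum (- (\<i> * y)) / (cden' (- (\<i> * y)) * ((- (\<i> * y))\<^sup>2 + y\<^sup>2) + cden (- (\<i> * y)) * (2 * (- (\<i> * y))))"
        by (rule res[OF DG]) (use nz y0 iy2 in \<open>auto simp: cden_minus cnum_minus\<close>)
      also have "\<dots> = cnum (\<i> * y) / cden (\<i> * y) / (2 * (\<i> * y))" using iy2 by (simp add: cden_minus cnum_minus)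
      also have "\<dots> = - (1 + 2 * phi y) / (2 * y)" unfolding cnum_div_cden_imaginary[OF y(1)] by (rule q)
      finally show "residue f (- (\<i> * y)) = - (1 + 2 * phi y) / (2 * y)" .
    qed
    have realpart: "Im z = 0" if "z \<in> R1 \<or> z \<in> R2" for z using that by (auto simp: R1_def R2_def)
    have R1pos: "Re z > 0" if "z \<in> R1" for z using that by (auto simp: R1_def)
    have R2neg: "Re z < 0" if "z \<in> R2" for z using that by (auto simp: R2_def)
    have Yim: "Im z \<noteq> 0" if "z \<in> Y" for z using that y(1) by (auto simp: Y_def)
    have "0 \<notin> R1" "0 \<notin> R2" "0 \<notin> Y" using R1pos[of 0] R2neg[of 0] Yim[of 0] by auto
    then have dj: "0 \<notin> R1 \<union> R2 \<union> Y" "(R1 \<union> R2) \<inter> Y = {}" "R1 \<inter> R2 = {}"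
      using realpart Yim by (blast, blast) (use R1pos R2neg order.asym in \<open>blast\<close>)
    have "(\<Sum>w\<in>pts. residue f w) = residue f 0 + ((\<Sum>w\<in>R1. residue f w) + (\<Sum>w\<in>R2. residue f w) + (\<Sum>w\<in>Y. residue f w))"
    proof -
      have "finite R1" "finite R2" "finite Y" by (auto simp: R1_def R2_def Y_def)
      then show ?thesis
        unfolding pts_def using dj by (simp add: sum.union_disjoint)
    qed
    also have "(\<Sum>w\<in>Y. residue f w) = - (1 + 2 * phi y) / y"
    proof -
      have "\<i> * y \<noteq> - (\<i> * y)" using y0 by (simp add: eq_neg_iff_add_eq_0)
      then have "(\<Sum>w\<in>Y. residue f w) = residue f (\<i> * y) + residue f (- (\<i> * y))"
        unfolding Y_def by simp
      moreover have "X / (2 * y) + X / (2 * y) = X / y" for X using y0 by (simp add: field_simps)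
      ultimately show ?thesis unfolding ri by metis
    qed
    also have "(\<Sum>w\<in>R1. residue f w) = (\<Sum>j<N. 1 / pi * T (Suc j))"
      unfolding R1_def using inj_root_Suc by (subst sum.reindex) (auto simp: r12 inj_on_def)
    also have "(\<Sum>w\<in>R2. residue f w) = (\<Sum>j<N. 1 / pi * T (Suc j))"
      unfolding R2_def using inj_root_Suc by (subst sum.reindex) (auto simp: r12 inj_on_def)
    finally have tot: "(\<Sum>w\<in>pts. residue f w) = 2 / pi * T 0 + ((\<Sum>j<N. 1 / pi * T (Suc j)) + (\<Sum>j<N. 1 / pi * T (Suc j)) + - (1 + 2 * phi y) / y)"
      unfolding r0 T_def[symmetric] .
    have "(\<Sum>j\<le>N. T j) = T 0 + (\<Sum>j<N. T (Suc j))" by (rule sum.atMost_shift)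
    then show ?thesis
      unfolding tot T_def[symmetric] sum_distrib_left[symmetric]
      by (simp add: distrib_left minus_divide_left[symmetric] del: minus_add_distrib)
  qed
  finally show ?thesis .
qed

text \<open>On the circles \<open>cnum / cden\<close> is bounded and 1 / (z^2 + y^2) is of order 1 /
  N^2, while the length is 2 pi N. The contour integrals thus tend to 0, and the sum of the residues
  must vanish in the limit.\<close>

theorem partial_fractions:
  assumes y: "Re y > 0"
  shows "(\<lambda>j. of_real (mass j) / ((of_real (root j))\<^sup>2 + y\<^sup>2)) sums (of_real pi / (2 * y) * (1 + 2 * phi y))"
proof -
  define D where "D N = 2 / pi * (\<Sum>j\<le>N. of_real (mass j) / ((of_real (root j))\<^sup>2 + y\<^sup>2)) - (1 + 2 * phi y) / y" for N
  obtain M :: real and N0 :: nat where M: "\<And>N z. N \<ge> N0 \<Longrightarrow> cmod z = real N \<Longrightarrow> cmod (cnum z) \<le> M * cmod (cden z)"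
    using cnum_cden_bound_circle by blast
  define M' where "M' = max M 0"
  have bound: "cmod (D N) \<le> M' * (real N / ((real N)\<^sup>2 - (cmod y)\<^sup>2))" if N: "N \<ge> N0" "cmod y < real N" for N
  proof -
    let ?f = "\<lambda>z. cnum z / (cden z * (z\<^sup>2 + y\<^sup>2))"
    let ?K = "(real N)\<^sup>2 - (cmod y)\<^sup>2"
    have K: "?K > 0" using N by (simp add: power_strict_mono)
    have Npos: "real N > 0" using N(2) norm_ge_zero[of y] by linarith
    have G: "cmod (z\<^sup>2 + y\<^sup>2) \<ge> ?K" if "cmod z = real N" for z
      using norm_diff_ineq[of "z\<^sup>2" "y\<^sup>2"] that by (simp add: norm_power)
    have "cmod (contour_integral (circlepath 0 (real N)) ?f) \<le> M' / ?K * (2 * pi * real N)"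
    proof (rule has_contour_integral_bound_circlepath)
      \<comment> \<open>A root strictly between j + 1/2 and j + 1 is no integer, so the contour
        meets no zero of \<open>cden\<close>; zeros of z^2 + y^2 have modulus |y| < N.\<close>
      have nz: "cden z * (z\<^sup>2 + y\<^sup>2) \<noteq> 0" if "cmod z = real N" for z
      proof -
        have "cden z \<noteq> 0"
        proof
          assume "cden z = 0"
          moreover have "z \<noteq> 0" using that Npos by auto
          ultimately obtain j where "z = of_real (root (Suc j)) \<or> z = - of_real (root (Suc j))" unfolding cden_zeros by blast
          then have "root (Suc j) = real N" using that root_pos[of j] by (auto simp del: root_pos)
          then have "real j + 1/2 < real N" "real N < real j + 1" using root_gt[of j] root_less[of j] by auto
          then have "j < N" "N < j + 1" by linarith+
          then show False by linarith
        qed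
        moreover have "z\<^sup>2 + y\<^sup>2 \<noteq> 0" using G[OF that] K by (metis norm_zero not_less)
        ultimately show ?thesis by simp
      qed
      have "?f contour_integrable_on circlepath 0 (real N)"
        by (intro contour_integrable_continuous_circlepath holomorphic_on_imp_continuous_on holomorphic_intros)
           (use nz Npos in \<open>auto simp: sphere_def\<close>)
      then show "(?f has_contour_integral contour_integral (circlepath 0 (real N)) ?f) (circlepath 0 (real N))"
        by (rule has_contour_integral_integral)
      show "0 \<le> M' / ?K" using K by (intro divide_nonneg_pos) (auto simp: M'_def)
      show "real N > 0" by (rule Npos)
      fix z assume "cmod (z - 0) = real N"
      then have z: "cmod z = real N" by simp
      have "cmod (cnum z) \<le> M' * cmod (cden z)"
        by (rule order.trans[OF M[OF N(1) z]]) (auto simp: M'_def intro: mult_right_mono)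
      moreover have "cmod (cden z) > 0" using nz[OF z] by auto
      ultimately have "cmod (cnum z) / cmod (cden z) \<le> M'" by (simp add: pos_divide_le_eq)
      then have "cmod (cnum z) / cmod (cden z) / cmod (z\<^sup>2 + y\<^sup>2) \<le> M' / ?K"
        using G[OF z] K by (intro frac_le) (auto simp: M'_def)
      then show "cmod (?f z) \<le> M' / ?K" by (simp add: norm_divide norm_mult)
    qed
    then have "2 * pi * cmod (D N) \<le> 2 * pi * (M' * (real N / ?K))"
      unfolding partial_fraction_residues[OF y N(2)] D_def[symmetric] by (simp add: norm_mult mult_ac)
    then show ?thesis by (rule mult_left_le_imp_le) simp
  qed
  have "((\<lambda>N. M' * (real N / ((real N)\<^sup>2 - (cmod y)\<^sup>2))) \<longlongrightarrow> M' * 0) sequentially"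
    by (intro tendsto_mult tendsto_const) real_asymp
  then have lim: "((\<lambda>N. M' * (real N / ((real N)\<^sup>2 - (cmod y)\<^sup>2))) \<longlongrightarrow> 0) sequentially" by simp
  have "D \<longlonglongrightarrow> 0"
  proof (rule Lim_null_comparison[OF _ lim])
    show "\<forall>\<^sub>F N in sequentially. cmod (D N) \<le> M' * (real N / ((real N)\<^sup>2 - (cmod y)\<^sup>2))"
      using eventually_ge_at_top[of N0] eventually_gt_at_top[of "nat \<lceil>cmod y\<rceil>"]
      by eventually_elim (rule bound; linarith)
  qed
  then have "(\<lambda>N. of_real pi / 2 * (D N + (1 + 2 * phi y) / y)) \<longlonglongrightarrow> of_real pi / 2 * (0 + (1 + 2 * phi y) / y)"
    by (intro tendsto_intros)
  then have "(\<lambda>N. \<Sum>j\<le>N. of_real (mass j) / ((of_real (root j))\<^sup>2 + y\<^sup>2)) \<longlonglongrightarrow> of_real pi / (2 * y) * (1 + 2 * phi y)"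
    by (simp add: D_def)
  then show ?thesis unfolding sums_def_le .
qed

end

section \<open>Analytic continuation of the zeta function\<close>

lemma abs_Re_less: "w \<in> ball z r \<Longrightarrow> \<bar>Re w - Re z\<bar> < r"
  using abs_Re_le_cmod[of "w - z"] by (simp add: dist_norm norm_minus_commute)

text \<open>Supplies the accumulation point for the identity theorem whenever two holomorphic
  functions are compared on a real interval.\<close>

lemma islimpt_of_real_interval:
  assumes "a < x" "x < b"
  shows "complex_of_real x islimpt complex_of_real ` {a<..<b}"
  unfolding islimpt_approachable
proof (intro allI impI)
  fix e :: real assume e: "e > 0"
  define d where "d = min (e / 2) ((b - x) / 2)"
  have d: "d > 0" "d < e" "x + d < b" using e assms by (auto simp: d_def min_def field_simps)
  have "complex_of_real (x + d) \<in> complex_of_real ` {a<..<b}" using d assms by (intro imageI) auto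
  moreover have "dist (complex_of_real (x + d)) (of_real x) = d" using d by (simp add: dist_norm)
  ultimately show "\<exists>y\<in>complex_of_real ` {a<..<b}. y \<noteq> of_real x \<and> dist y (of_real x) < e"
    using d by (metis dist_self less_irrefl)
qed

text \<open>A local integrable majorant of f also controls the derivative in z by Cauchy's
  inequality, hence the difference quotients, and dominated convergence differentiates under the
  integral. The measure is arbitrary, so counting measure covers series as well.\<close>

lemma holomorphic_integral:
  fixes f :: "complex \<Rightarrow> 'a \<Rightarrow> complex"
  assumes S: "open S"
    and meas: "\<And>z. z \<in> S \<Longrightarrow> f z \<in> borel_measurable M"
    and holo: "\<And>t. t \<in> space M \<Longrightarrow> (\<lambda>z. f z t) holomorphic_on S"
    and dom: "\<And>z. z \<in> S \<Longrightarrow> \<exists>r>0. \<exists>g. integrable M g \<and> (\<forall>w\<in>ball z r \<inter> S. \<forall>t\<in>space M. cmod (f w t) \<le> g t)"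
  shows "(\<lambda>z. \<integral>t. f z t \<partial>M) holomorphic_on S"
proof -
  have "\<exists>D. ((\<lambda>z. \<integral>t. f z t \<partial>M) has_field_derivative D) (at z)" if z: "z \<in> S" for z
  proof -
    obtain r1 g where r1: "r1 > 0" and g: "integrable M g"
      and bd1: "\<And>w t. w \<in> ball z r1 \<inter> S \<Longrightarrow> t \<in> space M \<Longrightarrow> cmod (f w t) \<le> g t"
      using dom[OF z] by blast
    obtain r2 where r2: "r2 > 0" "ball z r2 \<subseteq> S" using S z by (meson openE)
    define r where "r = min r1 r2"
    have r: "r > 0" "ball z r \<subseteq> S" using r1 r2 by (auto simp: r_def)
    have bd: "cmod (f w t) \<le> g t" if "w \<in> ball z r" "t \<in> space M" for w t
      using bd1[of w t] that r(2) by (auto simp: r_def)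
    have int: "integrable M (f w)" if "w \<in> ball z r" for w
      by (rule Bochner_Integration.integrable_bound[OF g]) (use that bd r meas in \<open>force intro!: AE_I2\<close>)+
    have derivt: "((\<lambda>z. f z t) has_field_derivative deriv (\<lambda>z. f z t) w) (at w)"
      if "w \<in> ball z r" "t \<in> space M" for w t
      using holo[OF that(2)] S that r holomorphic_derivI by blast
    \<comment> \<open>A disc of radius r / 4 about a point of \<open>ball z (r / 2)\<close> stays
      inside \<open>ball z r\<close>, where the majorant is valid.\<close>
    have dbound: "cmod (deriv (\<lambda>z. f z t) w) \<le> g t / (r / 4)" if w: "w \<in> ball z (r / 2)" and t: "t \<in> space M" for w t
    proof -
      have sub: "cball w (r / 4) \<subseteq> ball z r"
      proof
        fix x assume "x \<in> cball w (r / 4)"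
        then have "dist z x < r / 2 + r / 4"
          using w dist_triangle[of z x w] by (auto simp: dist_commute)
        then show "x \<in> ball z r" using r by simp
      qed
      have "cmod ((deriv ^^ 1) (\<lambda>z. f z t) w) \<le> fact 1 * g t / (r / 4) ^ 1"
      proof (rule Cauchy_inequality)
        show "(\<lambda>z. f z t) holomorphic_on ball w (r / 4)"
          using holo[OF t] sub r(2) by (meson ball_subset_cball holomorphic_on_subset order.trans)
        show "continuous_on (cball w (r / 4)) (\<lambda>z. f z t)"
          using holo[OF t] sub r(2) by (meson holomorphic_on_imp_continuous_on continuous_on_subset order.trans)
        show "cmod (f x t) \<le> g t" if "cmod (w - x) = r / 4" for x
          using that sub t by (intro bd) (auto simp: dist_norm subset_iff)
      qed (use r in auto)
      then show ?thesis by simp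
    qed
    define D where "D t = deriv (\<lambda>z. f z t) z" for t
    have "((\<lambda>w. ((\<integral>t. f w t \<partial>M) - (\<integral>t. f z t \<partial>M)) / (w - z)) \<longlongrightarrow> (\<integral>t. D t \<partial>M)) (at z within ball z (r / 2))"
      unfolding tendsto_at_iff_sequentially
    proof (intro allI impI)
      fix X :: "nat \<Rightarrow> complex" assume X: "\<forall>i. X i \<in> ball z (r / 2) - {z}" "X \<longlonglongrightarrow> z"
      define q where "q i t = (f (X i) t - f z t) / (X i - z)" for i t
      have Xr: "X i \<in> ball z r" for i using X(1)[rule_format, of i] r by auto
      have zr: "z \<in> ball z r" using r by simp
      have lim: "(\<lambda>i. q i t) \<longlonglongrightarrow> D t" if t: "t \<in> space M" for t
      proof -
        have "((\<lambda>w. (f w t - f z t) / (w - z)) \<longlongrightarrow> D t) (at z)"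
          using derivt[OF zr t] unfolding D_def has_field_derivative_iff .
        then show ?thesis unfolding q_def using X unfolding tendsto_at_iff_sequentially comp_def by auto
      qed
      have qm: "q i \<in> borel_measurable M" for i
        unfolding q_def using int[OF Xr] int[OF zr] by (simp add: borel_measurable_divide borel_measurable_diff)
      have "(\<lambda>i. \<integral>t. q i t \<partial>M) \<longlonglongrightarrow> (\<integral>t. D t \<partial>M)"
      proof (rule integral_dominated_convergence)
        show "D \<in> borel_measurable M" by (rule borel_measurable_LIMSEQ_metric[OF qm lim])
        show "integrable M (\<lambda>t. g t / (r / 4))" using g by simp
        show "AE t in M. (\<lambda>i. q i t) \<longlonglongrightarrow> D t" using lim by (intro AE_I2)
        show "AE t in M. norm (q i t) \<le> g t / (r / 4)" for i
        proof (rule AE_I2)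
          fix t assume t: "t \<in> space M"
          \<comment> \<open>The mean value inequality on a convex ball gives every difference
            quotient the same majorant as the derivative.\<close>
          have "cmod (f (X i) t - f z t) \<le> g t / (r / 4) * cmod (X i - z)"
          proof (rule field_differentiable_bound[where S="ball z (r / 2)" and f'="deriv (\<lambda>z. f z t)"])
            fix w assume w: "w \<in> ball z (r / 2)"
            have "ball z (r / 2) \<subseteq> ball z r" by (rule subset_ball) (use r(1) in simp)
            then have "w \<in> ball z r" using w by blast
            show "((\<lambda>z. f z t) has_field_derivative deriv (\<lambda>z. f z t) w) (at w within ball z (r / 2))"
              by (rule has_field_derivative_at_within[OF derivt[OF \<open>w \<in> ball z r\<close> t]])
          next
            fix w assume w: "w \<in> ball z (r / 2)"
            show "cmod (deriv (\<lambda>z. f z t) w) \<le> g t / (r / 4)" by (rule dbound[OF w t])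
          next
            show "X i \<in> ball z (r / 2)" using X(1) by blast
            show "z \<in> ball z (r / 2)" using r(1) by simp
          qed (rule convex_ball)
          moreover have "X i \<noteq> z" using X(1) by auto
          ultimately show "norm (q i t) \<le> g t / (r / 4)"
            unfolding q_def norm_divide by (simp add: pos_divide_le_eq)
        qed
      qed (rule qm)
      moreover have "(\<integral>t. q i t \<partial>M) = ((\<integral>t. f (X i) t \<partial>M) - (\<integral>t. f z t \<partial>M)) / (X i - z)" for i
        unfolding q_def using int[OF Xr] int[OF zr] by simp
      ultimately show "((\<lambda>w. ((\<integral>t. f w t \<partial>M) - (\<integral>t. f z t \<partial>M)) / (w - z)) \<circ> X) \<longlonglongrightarrow> (\<integral>t. D t \<partial>M)"
        by (simp add: comp_def)
    qed
    then have "((\<lambda>z. \<integral>t. f z t \<partial>M) has_field_derivative (\<integral>t. D t \<partial>M)) (at z within ball z (r / 2))"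
      unfolding has_field_derivative_iff .
    then show ?thesis using r by (auto simp: at_within_open[of z "ball z (r / 2)"])
  qed
  then show ?thesis using S by (simp add: holomorphic_on_open)
qed

abbreviation half_line :: "real measure" where "half_line \<equiv> restrict_space lborel {0<..}"

text \<open>Passes from the gauge integral, where closed forms are evaluated, to the Bochner
  integral, where Fubini and dominated convergence are applied. Nonnegativity permits the detour
  through the nonnegative integral.\<close>

lemma has_bochner_integral_restrict_lborel:
  fixes f :: "real \<Rightarrow> real"
  assumes f: "f \<in> borel_measurable borel" and S: "S \<in> sets borel"
    and nonneg: "\<And>x. x \<in> S \<Longrightarrow> f x \<ge> 0" and I: "(f has_integral I) S"
  shows "has_bochner_integral (restrict_space lborel S) f I"
proof -
  have meas: "(\<lambda>x. indicator S x * f x) \<in> borel_measurable borel" using f S by measurable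
  have "I \<ge> 0" using has_integral_nonneg[OF I] nonneg by auto
  have "((\<lambda>x. indicator S x * f x) has_integral I) UNIV"
    by (rule has_integral_eq[OF _ has_integral_restrict_UNIV[of S f I, THEN iffD2, OF I]])
       (auto simp: indicator_def)
  then have "integral\<^sup>N lborel (\<lambda>x. indicator S x * f x) = I"
    using meas nonneg by (intro nn_integral_has_integral_lborel) (auto simp: indicator_def)
  then have "has_bochner_integral lborel (\<lambda>x. indicator S x * f x) I"
    using meas nonneg \<open>I \<ge> 0\<close> by (intro has_bochner_integral_nn_integral) (auto simp: indicator_def)
  then show ?thesis
    using S by (simp add: has_bochner_integral_iff integrable_restrict_space integral_restrict_space)
qed

text \<open>Substituting \<open>t = 1 / (1 + y\<^sup>2)\<close> turns the integral into \<open>Beta (s / 2) (1 - s / 2)\<close>.\<close>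

lemma has_bochner_integral_powr_rational:
  fixes s :: real
  assumes s: "0 < s" "s < 2"
  shows "has_bochner_integral half_line
           (\<lambda>y. y powr (1 - s) / (1 + y\<^sup>2)) (pi / (2 * sin (pi * s / 2)))"
proof -
  define b where "b = Beta (s / 2) (1 - s / 2)"
  define f where "f t = t powr (s / 2 - 1) * (1 - t) powr (1 - s / 2 - 1)" for t :: real
  define g where "g y = 1 / (1 + y\<^sup>2)" for y :: real
  define g' where "g' y = - (2 * y) / (1 + y\<^sup>2)\<^sup>2" for y :: real
  have pos: "1 + y\<^sup>2 > 0" for y :: real by (rule add_pos_nonneg) auto
  have b: "b = pi / sin (pi * s / 2)"
  proof -
    have "complex_of_real (Gamma (s / 2) * Gamma (1 - s / 2)) = of_real (pi / sin (pi * (s / 2)))"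
      using Gamma_reflection_complex[of "of_real (s / 2)"] Gamma_complex_of_real[of "s / 2"]
        Gamma_complex_of_real[of "1 - s / 2"] by (simp flip: sin_of_real)
    then show ?thesis unfolding b_def Beta_def of_real_eq_iff by simp
  qed
  have fI: "(f has_integral b) {0..1}"
    unfolding f_def b_def by (rule has_integral_Beta_real) (use s in auto)
  have fI': "(f has_integral b) {0<..<1}"
    using fI by (simp add: has_integral_Icc_iff_Ioo)
  have "f absolutely_integrable_on {0<..<1} \<and> integral {0<..<1} f = b"
    using fI' by (auto intro!: nonnegative_absolutely_integrable_1 simp: f_def integral_unique has_integral_integrable)
  also have "{0<..<1} = g ` {0<..}"
  proof (intro equalityI subsetI)
    fix t :: real assume t: "t \<in> {0<..<1}"
    then have "t = g (sqrt (1 / t - 1))" by (simp add: g_def field_simps)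
    moreover have "sqrt (1 / t - 1) > 0" using t by simp
    ultimately show "t \<in> g ` {0<..}" by blast
  next
    fix t assume "t \<in> g ` {0<..}"
    then obtain y where "y > 0" "t = g y" by auto
    then show "t \<in> {0<..<1}" using pos[of y] by (auto simp: g_def)
  qed
  finally have img: "f absolutely_integrable_on g ` {0<..} \<and> integral (g ` {0<..}) f = b" .
  have "(\<lambda>x. \<bar>g' x\<bar> * f (g x)) absolutely_integrable_on {0<..} \<and> integral {0<..} (\<lambda>x. \<bar>g' x\<bar> * f (g x)) = b
    \<longleftrightarrow> f absolutely_integrable_on g ` {0<..} \<and> integral (g ` {0<..}) f = b"
  proof (rule has_absolute_integral_change_of_variables_1')
    show "(g has_field_derivative g' x) (at x within {0<..})" for x
      unfolding g_def g'_def using pos[of x] by (auto intro!: derivative_eq_intros simp: power2_eq_square)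
    show "inj_on g {0<..}"
      by (rule inj_onI) (auto simp: g_def power2_eq_iff_nonneg)
  qed auto
  with img have "((\<lambda>x. \<bar>g' x\<bar> * f (g x)) has_integral b) {0<..}"
    by (metis integrable_integral set_lebesgue_integral_eq_integral(1))
  moreover have "\<bar>g' y\<bar> * f (g y) = 2 * (y powr (1 - s) / (1 + y\<^sup>2))" if "y > 0" for y
  proof -
    have 1: "1 - g y = y\<^sup>2 * g y" using pos[of y] by (simp add: g_def field_simps)
    have gp: "g y > 0" using pos[of y] by (simp add: g_def)
    have "f (g y) = (g y) powr (s / 2 - 1) * ((g y) powr (1 - s / 2 - 1) * (y\<^sup>2) powr (1 - s / 2 - 1))"
      unfolding f_def 1 using gp that by (simp add: powr_mult mult.commute)
    also have "\<dots> = ((g y) powr (s / 2 - 1) * (g y) powr (1 - s / 2 - 1)) * (y powr 2) powr (1 - s / 2 - 1)"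
      using that by simp
    also have "\<dots> = (g y) powr (-1) * y powr (- s)"
      by (simp add: powr_powr flip: powr_add)
    also have "\<dots> = y powr (- s) * (1 + y\<^sup>2)"
      using pos[of y] by (simp add: g_def powr_minus_divide)
    finally have "\<bar>g' y\<bar> * f (g y) = (2 * y / (1 + y\<^sup>2)\<^sup>2) * (y powr (- s) * (1 + y\<^sup>2))"
      using that by (simp add: g'_def)
    also have "\<dots> = 2 * (y * y powr (- s)) / (1 + y\<^sup>2)"
    proof -
      have "(2 * y / D\<^sup>2) * (E * D) = 2 * (y * E) / D" if "D \<noteq> 0" for D E
        using that by (simp add: power2_eq_square)
      then show ?thesis using pos[of y] by (metis less_irrefl)
    qed
    also have "y * y powr (- s) = y powr (1 - s)"
      using that powr_add[of y 1 "- s"] by simp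
    finally show ?thesis by simp
  qed
  ultimately have "((\<lambda>y. 2 * (y powr (1 - s) / (1 + y\<^sup>2))) has_integral b) {0<..}"
    by (subst has_integral_cong[of _ _ "\<lambda>x. \<bar>g' x\<bar> * f (g x)"]) auto
  then have "((\<lambda>y. 1 / 2 * (2 * (y powr (1 - s) / (1 + y\<^sup>2)))) has_integral 1 / 2 * b) {0<..}"
    by (rule has_integral_mult_right)
  then have "((\<lambda>y. y powr (1 - s) / (1 + y\<^sup>2)) has_integral pi / (2 * sin (pi * s / 2))) {0<..}"
    by (simp add: b)
  then show ?thesis
    by (intro has_bochner_integral_restrict_lborel) auto
qed

lemma integral_restrict_lborel_Un:
  fixes g :: "real \<Rightarrow> 'b::{banach, second_countable_topology}"
  assumes g: "integrable (restrict_space lborel (A \<union> B)) g"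
    and AB: "A \<in> sets borel" "B \<in> sets borel" "A \<inter> B = {}"
  shows "integrable (restrict_space lborel A) g" "integrable (restrict_space lborel B) g"
    "(\<integral>x. g x \<partial>restrict_space lborel (A \<union> B)) =
      (\<integral>x. g x \<partial>restrict_space lborel A) + (\<integral>x. g x \<partial>restrict_space lborel B)"
proof -
  have g': "set_integrable lborel (A \<union> B) g"
    using g AB by (simp add: integrable_restrict_space set_integrable_def)
  then have A: "set_integrable lborel A g" and B: "set_integrable lborel B g"
    using AB by (auto intro: set_integrable_subset)
  then show "integrable (restrict_space lborel A) g" "integrable (restrict_space lborel B) g"
    using AB by (simp_all add: integrable_restrict_space set_integrable_def)
  show "(\<integral>x. g x \<partial>restrict_space lborel (A \<union> B)) =
      (\<integral>x. g x \<partial>restrict_space lborel A) + (\<integral>x. g x \<partial>restrict_space lborel B)"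
    using set_integral_Un[OF AB(3) A B] AB
    by (simp add: integral_restrict_space set_lebesgue_integral_def)
qed

lemma has_bochner_integral_powr_rational_scaled:
  fixes s c :: real
  assumes s: "0 < s" "s < 2" and c: "c > 0"
  shows "has_bochner_integral half_line
           (\<lambda>y. y powr (1 - s) / (c\<^sup>2 + y\<^sup>2)) (c powr (- s) * (pi / (2 * sin (pi * s / 2))))"
proof -
  define K where "K = pi / (2 * sin (pi * s / 2))"
  define f where "f y = indicator {0<..} y *\<^sub>R (y powr (1 - s) / (c\<^sup>2 + y\<^sup>2))" for y :: real
  have "has_bochner_integral lborel (\<lambda>y. indicator {0<..} y *\<^sub>R (y powr (1 - s) / (1 + y\<^sup>2))) K"
    using has_bochner_integral_powr_rational[OF s]
    by (simp add: has_bochner_integral_iff integrable_restrict_space integral_restrict_space K_def)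
  then have "has_bochner_integral lborel (\<lambda>y. c powr (- 1 - s) * (indicator {0<..} y *\<^sub>R (y powr (1 - s) / (1 + y\<^sup>2)))) (c powr (- 1 - s) * K)"
    by (rule has_bochner_integral_mult_right)
  also have "(\<lambda>y. c powr (- 1 - s) * (indicator {0<..} y *\<^sub>R (y powr (1 - s) / (1 + y\<^sup>2)))) = (\<lambda>y. f (0 + c * y))"
  proof
    fix y :: real
    have "c powr (1 - s) = c powr (- 1 - s) * c\<^sup>2"
      using c powr_add[of c "- 1 - s" 2] by simp
    then have "c powr (- 1 - s) * (y powr (1 - s) / (1 + y\<^sup>2)) = (c * y) powr (1 - s) / (c\<^sup>2 + (c * y)\<^sup>2)" if "y > 0"
    proof -
      assume e: "c powr (1 - s) = c powr (- 1 - s) * c\<^sup>2"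
      have "c\<^sup>2 + (c * y)\<^sup>2 = c\<^sup>2 * (1 + y\<^sup>2)" by (simp add: power_mult_distrib algebra_simps)
      then show ?thesis using c that by (simp add: powr_mult e)
    qed
    then show "c powr (- 1 - s) * (indicator {0<..} y *\<^sub>R (y powr (1 - s) / (1 + y\<^sup>2))) = f (0 + c * y)"
      using c by (auto simp: f_def indicator_def zero_less_mult_iff)
  qed
  also have "c powr (- 1 - s) * K = (c powr (- s) * K) /\<^sub>R \<bar>c\<bar>"
  proof -
    have "- 1 - s = - s - 1" by simp
    then show ?thesis using c powr_diff[of c "- s" 1] by (simp only:) (simp add: divide_inverse mult_ac)
  qed
  finally have "has_bochner_integral lborel f (c powr (- s) * K)"
    using c by (subst lborel_has_bochner_integral_real_affine_iff[where c=c and t=0]) auto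
  then show ?thesis
    by (simp add: has_bochner_integral_iff integrable_restrict_space integral_restrict_space K_def f_def [abs_def])
qed

section \<open>The function \<open>q\<close> and its Mellin transform\<close>

context koshliakov begin

definition phir :: "real \<Rightarrow> real" where
  "phir y = inverse_sigma_exp_minus_one p y (2 * pi * y)"

lemma phi_of_real: "phi (of_real y) = of_real (phir y)"
  by (simp add: phi_def phir_def inverse_sigma_exp_minus_one_def flip: exp_of_real)

lemma abs_phir_le: "y > 0 \<Longrightarrow> \<bar>phir y\<bar> \<le> 1 / (exp (2 * pi * y) - 1)"
  using cmod_phi_le[of "of_real y"] by (simp add: phi_of_real)

lemma borel_measurable_phir [measurable]: "phir \<in> borel_measurable borel"
  unfolding phir_def [abs_def] inverse_sigma_exp_minus_one_def by measurable

lemma root_ge: "root (Suc j) \<ge> (real j + 1) / 2"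
  using root_gt[of j] by simp

lemma summable_root_powr:
  assumes "a > 1" shows "summable (\<lambda>j. root (Suc j) powr (- a))"
proof (rule summable_comparison_test)
  have "summable (\<lambda>j. real (Suc j) powr (- a))"
    using assms by (subst summable_Suc_iff[of "\<lambda>j. real j powr (- a)"]) (simp add: summable_real_powr_iff)
  then show "summable (\<lambda>j. 2 powr a * real (Suc j) powr (- a))" by (rule summable_mult)
  have "root (Suc j) powr (- a) \<le> 2 powr a * real (Suc j) powr (- a)" for j
  proof -
    have "root (Suc j) powr (- a) \<le> ((real j + 1) / 2) powr (- a)"
      using root_ge[of j] assms by (intro powr_mono2') auto
    also have "\<dots> = 2 powr a * real (Suc j) powr (- a)"
      by (simp add: powr_divide powr_minus field_simps)
    finally show ?thesis .
  qed
  then show "\<exists>N. \<forall>n\<ge>N. norm (root (Suc n) powr (- a)) \<le> 2 powr a * real (Suc n) powr (- a)" by auto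
qed

lemma summable_weight_powr:
  assumes "a > 1" shows "summable (\<lambda>j. wt (Suc j) * root (Suc j) powr (- a))"
  by (rule summable_comparison_test'[OF summable_root_powr[OF assms]])
     (use weight_le_1 weight_pos in \<open>auto simp: abs_mult abs_of_pos intro: mult_left_le_one_le less_imp_le\<close>)

lemma summable_weight_power:
  assumes "k > 1" shows "summable (\<lambda>j. wt (Suc j) / root (Suc j) ^ k)"
  using summable_weight_powr[of "real k"] assms
  by (simp add: powr_minus powr_realpow divide_inverse)

text \<open>The term of the expansion belonging to the origin is left out. This keeps
  \<open>q\<close> bounded at 0, so that y^(1-s) q(y) is integrable there for s < 2.\<close>

definition q :: "real \<Rightarrow> real" where
  "q y = (\<Sum>j. wt (Suc j) / ((root (Suc j))\<^sup>2 + y\<^sup>2))"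

lemma root_sq_pos: "(root (Suc j))\<^sup>2 + y\<^sup>2 > 0"
  by (intro add_pos_nonneg) auto

lemma q_term_bounds:
  "0 \<le> wt (Suc j) / ((root (Suc j))\<^sup>2 + y\<^sup>2)"
  "wt (Suc j) / ((root (Suc j))\<^sup>2 + y\<^sup>2) \<le> wt (Suc j) / (root (Suc j))\<^sup>2"
proof -
  show "0 \<le> wt (Suc j) / ((root (Suc j))\<^sup>2 + y\<^sup>2)"
    using weight_pos[of "Suc j"] root_sq_pos[of j y] by simp
  show "wt (Suc j) / ((root (Suc j))\<^sup>2 + y\<^sup>2) \<le> wt (Suc j) / (root (Suc j))\<^sup>2"
    using weight_pos[of "Suc j"] root_sq_pos[of j y]
    by (intro divide_left_mono mult_pos_pos) (auto intro: less_imp_le)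
qed

lemma summable_q: "summable (\<lambda>j. wt (Suc j) / ((root (Suc j))\<^sup>2 + y\<^sup>2))"
  by (rule summable_comparison_test'[where N=0, OF summable_weight_power[of 2]])
     (simp, simp only: real_norm_def abs_of_nonneg[OF q_term_bounds(1)] q_term_bounds(2))

lemma q_nonneg: "q y \<ge> 0" and q_le: "q y \<le> q 0"
  unfolding q_def using q_term_bounds[of _ y] summable_q[of y] summable_q[of 0]
  by (auto intro!: suminf_nonneg suminf_le)

lemma borel_measurable_q [measurable]: "q \<in> borel_measurable borel"
  unfolding q_def [abs_def] by measurable

lemma q_eq:
  assumes "y > 0" shows "q y = pi / (2 * y) * (1 + 2 * phir y) - wt 0 / (2 * y\<^sup>2)"
proof -
  have "(\<lambda>j. complex_of_real (mass j / ((root j)\<^sup>2 + y\<^sup>2))) sums complex_of_real (pi / (2 * y) * (1 + 2 * phir y))"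
    using partial_fractions[of "of_real y"] assms by (simp add: phi_of_real)
  then have "(\<lambda>j. mass j / ((root j)\<^sup>2 + y\<^sup>2)) sums (pi / (2 * y) * (1 + 2 * phir y))"
    unfolding sums_of_real_iff .
  then have "(\<lambda>j. mass (Suc j) / ((root (Suc j))\<^sup>2 + y\<^sup>2)) sums (pi / (2 * y) * (1 + 2 * phir y) - mass 0 / ((root 0)\<^sup>2 + y\<^sup>2))"
    by (subst sums_Suc_iff) simp
  then show ?thesis unfolding q_def by (simp add: mass_def sums_iff)
qed

text \<open>Every summand is a scaled beta integral with the same constant, and all terms are
  nonnegative, so the series may be integrated termwise. The restriction to 1 < s < 2 balances
  convergence at infinity, where \<open>q\<close> is of order 1 / y, against convergence at
  0.\<close>

lemma has_bochner_integral_powr_q: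
  assumes s: "1 < s" "s < 2"
  shows "has_bochner_integral half_line (\<lambda>y. y powr (1 - s) * q y)
    (pi / (2 * sin (pi * s / 2)) * (\<Sum>j. wt (Suc j) * root (Suc j) powr (- s)))"
proof -
  define K where "K = pi / (2 * sin (pi * s / 2))"
  define f where "f j y = wt (Suc j) * (y powr (1 - s) / ((root (Suc j))\<^sup>2 + y\<^sup>2))" for j and y :: real
  have 1: "has_bochner_integral half_line (f j) (wt (Suc j) * (root (Suc j) powr (- s) * K))" for j
    unfolding f_def K_def using s by (intro has_bochner_integral_mult_right has_bochner_integral_powr_rational_scaled) auto
  then have int: "integrable half_line (f j)"
    and val: "(\<integral>y. f j y \<partial>half_line) = wt (Suc j) * (root (Suc j) powr (- s) * K)" for j
    by (auto simp: has_bochner_integral_iff)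
  have norm: "norm (f j y) = f j y" for j y
    unfolding f_def using weight_pos[of "Suc j"] root_sq_pos[of j y] by simp
  have sm: "summable (\<lambda>j. wt (Suc j) * (root (Suc j) powr (- s) * K))"
    using summable_mult2[OF summable_weight_powr[OF s(1)], of K] by (simp add: mult_ac)
  have sq: "(\<lambda>j. f j y) sums (y powr (1 - s) * q y)" for y
    using sums_mult[OF summable_sums[OF summable_q[of y]], of "y powr (1 - s)"] unfolding f_def q_def
    by (simp add: mult_ac)
  have AE: "AE y in half_line. summable (\<lambda>j. norm (f j y))"
    unfolding norm using sq by (intro AE_I2) (auto simp: sums_iff)
  have sn: "summable (\<lambda>j. \<integral>y. norm (f j y) \<partial>half_line)"
    unfolding norm val by (rule sm)
  have "has_bochner_integral half_line (\<lambda>y. \<Sum>j. f j y) (\<Sum>j. wt (Suc j) * (root (Suc j) powr (- s) * K))"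
    using integrable_suminf[OF int AE sn] integral_suminf[OF int AE sn]
    by (simp add: has_bochner_integral_iff val)
  moreover have "(\<Sum>j. wt (Suc j) * (root (Suc j) powr (- s) * K)) = K * (\<Sum>j. wt (Suc j) * root (Suc j) powr (- s))"
    using suminf_mult[OF summable_weight_powr[OF s(1)], of K] by (simp add: mult_ac)
  ultimately show ?thesis using sq by (simp add: sums_iff K_def)
qed

end

lemma has_bochner_integral_Gamma:
  assumes "a > (-1::real)"
  shows "has_bochner_integral half_line (\<lambda>y. y powr a * exp (- y)) (Gamma (a + 1))"
proof -
  have "((\<lambda>t. t powr a * exp (- t)) has_integral Gamma (a + 1)) {0..}"
    using Gamma_integral_real[of "a + 1"] assms by (simp add: exp_minus divide_inverse)
  moreover have "{t \<in> {0..} - {0<..}. t powr a * exp (- t) \<noteq> 0} = {}"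
    "{t \<in> {0<..} - {0..}. t powr a * exp (- t) \<noteq> 0} = {}" by auto
  then have "((\<lambda>t. t powr a * exp (- t)) has_integral y) {0..} \<longleftrightarrow> ((\<lambda>t. t powr a * exp (- t)) has_integral y) {0<..}" for y
    by (intro has_integral_spike_set_eq) (simp_all only: negligible_empty)
  ultimately have "((\<lambda>t. t powr a * exp (- t)) has_integral Gamma (a + 1)) {0<..}" by blast
  from has_bochner_integral_restrict_lborel[OF _ _ _ this] show ?thesis by auto
qed

lemma integrable_powr_exp: "a > (-1::real) \<Longrightarrow> integrable half_line (\<lambda>y. y powr a * exp (- y))"
  using has_bochner_integral_Gamma by (auto simp: has_bochner_integral_iff)

lemma open_Re_strip: "open {s. Re s < c}" "open {s. Re s > c}"
  by (auto simp: open_halfspace_Re_lt open_halfspace_Re_gt)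

section \<open>Continuation of the Mellin integral\<close>

context koshliakov begin

text \<open>From y exp(y) <= (exp(y) - 1) (exp(y) + 1). A single bound covers the simple pole at 0
  and the exponential decay.\<close>

lemma abs_phir_le_exp:
  assumes "y > 0" shows "\<bar>phir y\<bar> \<le> exp (- y) / y"
proof -
  have "y * exp y \<le> (exp y - 1) * (exp y + 1)"
  proof (intro mult_mono)
    show "y \<le> exp y - 1" using exp_ge_add_one_self[of y] by linarith
  qed (use assms in auto)
  also have "\<dots> = exp (2 * y) - 1" by (simp add: algebra_simps flip: exp_add)
  also have "\<dots> \<le> exp (2 * pi * y) - 1" using assms pi_ge_two by simp
  finally have *: "y * exp y \<le> exp (2 * pi * y) - 1" .
  have "\<bar>phir y\<bar> \<le> 1 / (exp (2 * pi * y) - 1)" by (rule abs_phir_le[OF assms])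
  also have "\<dots> \<le> 1 / (y * exp y)" using * assms by (intro divide_left_mono mult_pos_pos) auto
  also have "\<dots> = exp (- y) / y" by (simp add: exp_minus field_simps)
  finally show ?thesis .
qed

lemma integrable_powr_phir:
  assumes "a > 0"
  shows "integrable half_line (\<lambda>y. y powr a * phir y)"
proof (rule Bochner_Integration.integrable_bound[OF integrable_powr_exp[of "a - 1"]])
  show "AE y in half_line. norm (y powr a * phir y) \<le> norm (y powr (a - 1) * exp (- y))"
  proof (rule AE_I2)
    fix y assume "y \<in> space (half_line)"
    then have y: "y > 0" by simp
    have "y powr a * \<bar>phir y\<bar> \<le> y powr a * (exp (- y) / y)"
      using abs_phir_le_exp[OF y] by (intro mult_left_mono) auto
    also have "\<dots> = y powr (a - 1) * exp (- y)" using y by (simp add: powr_diff)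
    finally show "norm (y powr a * phir y) \<le> norm (y powr (a - 1) * exp (- y))"
      by (simp add: abs_mult)
  qed
qed (use assms in \<open>auto intro!: measurable_restrict_space1\<close>)

text \<open>Two pure powers and an exponentially small part. On [1, infinity) the powers integrate
  in closed form to multiples of 1 / (s - 1) and 1 / s, the polar terms of the continuation.\<close>

lemma powr_q_split:
  assumes "y > 0"
  shows "y powr (1 - s) * q y = pi / 2 * y powr (- s) + pi * (y powr (- s) * phir y) - wt 0 / 2 * y powr (- 1 - s)"
proof -
  have "y powr (1 - s) = y * y powr (- s)"
    using assms powr_add[of y 1 "- s"] by simp
  moreover have "- 1 - s = - s - 1" by simp
  then have "y powr (- 1 - s) = y powr (- s) / y"
    using assms powr_diff[of y "- s" 1] by (simp only:) simp
  moreover have "y * e * (pi / (2 * y) * (1 + 2 * f) - c / (2 * y\<^sup>2)) = pi / 2 * e + pi * (e * f) - c / 2 * (e / y)" for e f c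
    using assms by (simp add: power2_eq_square field_simps)
  ultimately show ?thesis unfolding q_eq[OF assms] by metis
qed

text \<open>The power y^(1-s) is written as an exponential of ln y, which makes its holomorphy in s
  immediate. Convergence at 0 needs only Re s < 2, while \<open>zeta_phi_part\<close> converges for
  all s.\<close>

definition zeta_q_part :: "complex \<Rightarrow> complex" where
  "zeta_q_part s = (\<integral>y. exp ((1 - s) * of_real (ln y)) * of_real (q y) \<partial>restrict_space lborel {0<..<1})"

definition zeta_phi_part :: "complex \<Rightarrow> complex" where
  "zeta_phi_part s = (\<integral>y. exp (- s * of_real (ln y)) * of_real (phir y) \<partial>restrict_space lborel {1..})"

lemma norm_exp_ln: "y > 0 \<Longrightarrow> cmod (exp (s * of_real (ln y))) = y powr Re s"
  by (simp add: powr_def)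

lemma holomorphic_zeta_q_part: "zeta_q_part holomorphic_on {s. Re s < 2}"
  unfolding zeta_q_part_def [abs_def]
proof (rule holomorphic_integral)
  fix z assume "z \<in> {s. Re s < 2}"
  then have z: "Re z < 2" by simp
  \<comment> \<open>Half the distance to the line Re s = 2: exponents 1 - Re w with w in the ball
    then stay above r - 1 > -1.\<close>
  define r where "r = (2 - Re z) / 2"
  have r: "r > 0" using z by (simp add: r_def)
  have "((\<lambda>y. y powr (r - 1)) has_integral 1 powr (r - 1 + 1) / (r - 1 + 1)) {0<..<1::real}"
    using has_integral_powr_from_0[of "r - 1" 1] r by (simp add: has_integral_Icc_iff_Ioo)
  from has_bochner_integral_restrict_lborel[OF _ _ _ this]
  have "integrable (restrict_space lborel {0<..<1}) (\<lambda>y. y powr (r - 1))"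
    by (auto simp: has_bochner_integral_iff)
  then have g: "integrable (restrict_space lborel {0<..<1}) (\<lambda>y. y powr (r - 1) * q 0)" by simp
  have "cmod (exp ((1 - w) * of_real (ln y)) * of_real (q y)) \<le> y powr (r - 1) * q 0"
    if w: "w \<in> ball z r" and y: "0 < y" "y < 1" for w and y :: real
  proof -
    have "\<bar>Re w - Re z\<bar> < r" by (rule abs_Re_less[OF w])
    then have "Re w < Re z + r" by linarith
    then have "r - 1 \<le> 1 - Re w" by (simp add: r_def field_simps)
    then have "y powr (1 - Re w) \<le> y powr (r - 1)" using y by (intro powr_mono') auto
    then show ?thesis using y q_nonneg[of y] q_le[of y]
      by (simp add: norm_mult norm_exp_ln[of y "1 - w", simplified] mult_mono)
  qed
  then show "\<exists>r>0. \<exists>g. integrable (restrict_space lborel {0<..<1}) g \<and> (\<forall>w\<in>ball z r \<inter> {s. Re s < 2}.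
      \<forall>y\<in>space (restrict_space lborel {0<..<1}). cmod (exp ((1 - w) * of_real (ln y)) * of_real (q y)) \<le> g y)"
    using r g by (intro exI[of _ r] conjI exI[of _ "\<lambda>y. y powr (r - 1) * q 0"]) auto
qed (auto intro!: measurable_restrict_space1 holomorphic_intros open_Re_strip)

lemma holomorphic_zeta_phi_part: "zeta_phi_part holomorphic_on UNIV"
  unfolding zeta_phi_part_def [abs_def]
proof (rule holomorphic_integral)
  fix z :: complex
  define a where "a = \<bar>Re z\<bar> + 1"
  have "{0<..} = {0<..<1} \<union> {1::real..}" by auto
  then have "integrable (restrict_space lborel ({0<..<1} \<union> {1..})) (\<lambda>y. y powr a * exp (- y))"
    using integrable_powr_exp[of a] by (simp add: a_def)
  then have g: "integrable (restrict_space lborel {1..}) (\<lambda>y. y powr a * exp (- y))"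
    by (rule integral_restrict_lborel_Un) auto
  have "cmod (exp (- w * of_real (ln y)) * of_real (phir y)) \<le> y powr a * exp (- y)"
    if w: "w \<in> ball z 1" and y: "1 \<le> y" for w and y :: real
  proof -
    have "\<bar>Re w - Re z\<bar> < 1" by (rule abs_Re_less[OF w])
    then have "- Re w \<le> a" by (simp add: a_def)
    then have 1: "y powr (- Re w) \<le> y powr a" using y by (intro powr_mono) auto
    have "\<bar>phir y\<bar> \<le> exp (- y) / y" using y by (intro abs_phir_le_exp) auto
    also have "\<dots> \<le> exp (- y)" using y by (simp add: divide_le_eq)
    finally have 2: "\<bar>phir y\<bar> \<le> exp (- y)" .
    show ?thesis using 1 2 y norm_exp_ln[of y "- w"]
      by (simp add: norm_mult mult_mono)
  qed
  then show "\<exists>r>0. \<exists>g. integrable (restrict_space lborel {1..}) g \<and> (\<forall>w\<in>ball z r \<inter> UNIV.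
      \<forall>y\<in>space (restrict_space lborel {1..}). cmod (exp (- w * of_real (ln y)) * of_real (phir y)) \<le> g y)"
    using g by (intro exI[of _ 1] conjI exI[of _ "\<lambda>y. y powr a * exp (- y)"]) auto
qed (auto intro!: measurable_restrict_space1 holomorphic_intros)

definition zeta_series :: "complex \<Rightarrow> complex" where "zeta_series = koshliakov_zeta_series p"

lemma zeta_series_term: "complex_of_real (wt (Suc j)) * of_real (root (Suc j)) powr (- s) =
   of_real (wt (Suc j)) * exp (- s * of_real (ln (root (Suc j))))"
  using root_pos[of j] by (simp add: powr_def Ln_of_real)

lemma norm_zeta_series_term: "cmod (of_real (wt (Suc j)) * exp (- s * of_real (ln (root (Suc j))))) =
   wt (Suc j) * root (Suc j) powr (- Re s)"
  using weight_pos[of "Suc j"] norm_exp_ln[OF root_pos, of "- s" j] by (simp add: norm_mult)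

lemma holomorphic_zeta_series: "zeta_series holomorphic_on {s. Re s > 1}"
proof -
  define f :: "complex \<Rightarrow> nat \<Rightarrow> complex" where
    "f s j = of_real (wt (Suc j)) * exp (- s * of_real (ln (root (Suc j))))" for s j
  have "(\<lambda>s. \<integral>j. f s j \<partial>count_space UNIV) holomorphic_on {s. Re s > 1}"
  proof (rule holomorphic_integral)
    fix z assume "z \<in> {s. Re s > 1}"
    then have z: "Re z > 1" by simp
    define r where "r = (Re z - 1) / 2"
    have r: "r > 0" using z by (simp add: r_def)
    \<comment> \<open>Two exponents are needed because the first root lies in (1/2, 1). Roots at
      least 1 are majorised with the smallest real part a, smaller ones with the largest real part
      b.\<close>
    define a b where "a = 1 + r" and "b = Re z + r"
    have "summable (\<lambda>j. root (Suc j) powr (- a) + root (Suc j) powr (- b))"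
      using r z by (intro summable_add summable_root_powr) (auto simp: a_def b_def)
    then have g: "integrable (count_space UNIV) (\<lambda>j. root (Suc j) powr (- a) + root (Suc j) powr (- b))"
      by (simp add: integrable_count_space_nat_iff)
    have "cmod (f w j) \<le> root (Suc j) powr (- a) + root (Suc j) powr (- b)" if w: "w \<in> ball z r" for w j
    proof -
      have "\<bar>Re w - Re z\<bar> < r" by (rule abs_Re_less[OF w])
      then have "Re w < Re z + r" "Re z - r < Re w" by linarith+
      then have ab: "a \<le> Re w" "Re w \<le> b" by (auto simp: a_def b_def r_def field_simps)
      have "root (Suc j) powr (- Re w) \<le> root (Suc j) powr (- a) + root (Suc j) powr (- b)"
      proof (cases "root (Suc j) \<ge> 1")
        case True
        then have "root (Suc j) powr (- Re w) \<le> root (Suc j) powr (- a)" using ab by (intro powr_mono) auto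
        then show ?thesis using powr_ge_zero[of "root (Suc j)" "- b"] by linarith
      next
        case False
        then have "root (Suc j) powr (- Re w) \<le> root (Suc j) powr (- b)" using ab root_pos[of j]
          by (intro powr_mono') (auto simp: less_imp_le)
        then show ?thesis using powr_ge_zero[of "root (Suc j)" "- a"] by linarith
      qed
      moreover have "wt (Suc j) * root (Suc j) powr (- Re w) \<le> 1 * root (Suc j) powr (- Re w)"
        using weight_le_1 by (intro mult_right_mono) auto
      ultimately show ?thesis unfolding f_def norm_zeta_series_term by linarith
    qed
    then show "\<exists>r>0. \<exists>g. integrable (count_space UNIV) g \<and> (\<forall>w\<in>ball z r \<inter> {s. Re s > 1}.
        \<forall>j\<in>space (count_space UNIV). cmod (f w j) \<le> g j)"
      using r g by blast
  qed (auto simp: f_def intro!: holomorphic_intros open_Re_strip)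
  moreover have "(\<integral>j. f s j \<partial>count_space UNIV) = zeta_series s" if "s \<in> {s. Re s > 1}" for s
  proof -
    have "integrable (count_space UNIV) (f s)"
      unfolding integrable_count_space_nat_iff f_def norm_zeta_series_term
      using that by (intro summable_weight_powr) auto
    then have "(\<integral>j. f s j \<partial>count_space UNIV) = (\<Sum>j. f s j)" by (rule integral_count_space_nat)
    then show ?thesis by (simp add: zeta_series_def koshliakov_zeta_series_def zeta_series_term f_def)
  qed
  ultimately show ?thesis by (rule holomorphic_transform)
qed

lemma zeta_series_of_real:
  assumes "s > 1"
  shows "zeta_series (of_real s) = of_real (\<Sum>j. wt (Suc j) * root (Suc j) powr (- s))"
proof -
  have "zeta_series (of_real s) = (\<Sum>j. complex_of_real (wt (Suc j) * root (Suc j) powr (- s)))"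
    unfolding zeta_series_def koshliakov_zeta_series_def
    using root_pos by (simp add: powr_of_real less_imp_le flip: of_real_minus)
  also have "\<dots> = of_real (\<Sum>j. wt (Suc j) * root (Suc j) powr (- s))"
    by (rule suminf_of_real[OF summable_weight_powr[OF assms], symmetric])
  finally show ?thesis .
qed

text \<open>The Mellin integral cut at 1, with the pure powers on [1, infinity) replaced by their
  closed forms. The sine removes the pole at s = 0; the value 1 there is the limit of (2 / pi)
  sin(pi s / 2) / s.\<close>

definition zeta_left :: "complex \<Rightarrow> complex" where
  "zeta_left s = of_real (2 / pi) * sin (of_real pi * s / 2) * (zeta_q_part s + of_real (pi / 2) / (s - 1) + of_real pi * zeta_phi_part s)
     - of_real (wt 0 / 2) * (if s = 0 then 1 else of_real (2 / pi) * sin (of_real pi * s / 2) / s)"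

lemma holomorphic_zeta_left: "zeta_left holomorphic_on {s. Re s < 2} - {1}"
proof -
  have "(\<lambda>s. if s = 0 then 1 else of_real (2 / pi) * sin (of_real pi * s / 2) / s) holomorphic_on UNIV"
  proof (rule pole_theorem_open_0[where a=0 and g="\<lambda>s. of_real (2 / pi) * sin (of_real pi * s / 2)"])
    have "((\<lambda>s. of_real (2 / pi) * sin (of_real pi * s / 2)) has_field_derivative 1) (at (0::complex))"
      by (auto intro!: derivative_eq_intros)
    from DERIV_imp_deriv[OF this]
    show "(if (0::complex) = 0 then 1 else of_real (2 / pi) * sin (of_real pi * 0 / 2) / 0) =
      deriv (\<lambda>s::complex. of_real (2 / pi) * sin (of_real pi * s / 2)) 0" by simp
  qed (auto intro!: holomorphic_intros)
  then have "(\<lambda>s. if s = 0 then 1 else of_real (2 / pi) * sin (of_real pi * s / 2) / s) holomorphic_on {s. Re s < 2} - {1}"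
    by (rule holomorphic_on_subset) auto
  moreover have "zeta_q_part holomorphic_on {s. Re s < 2} - {1}" "zeta_phi_part holomorphic_on {s. Re s < 2} - {1}"
    using holomorphic_zeta_q_part holomorphic_zeta_phi_part by (auto intro: holomorphic_on_subset)
  ultimately show ?thesis
    unfolding zeta_left_def [abs_def] by (intro holomorphic_intros) auto
qed

lemma zeta_q_part_of_real: "zeta_q_part (of_real s) = of_real (\<integral>y. y powr (1 - s) * q y \<partial>restrict_space lborel {0<..<1})"
proof -
  have "zeta_q_part (of_real s) = (\<integral>y. complex_of_real (y powr (1 - s) * q y) \<partial>restrict_space lborel {0<..<1})"
    unfolding zeta_q_part_def
  proof (intro Bochner_Integration.integral_cong refl)
    fix y assume "y \<in> space (restrict_space lborel {0<..<1::real})"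
    then have "y > 0" by simp
    then show "exp ((1 - complex_of_real s) * of_real (ln y)) * of_real (q y) = complex_of_real (y powr (1 - s) * q y)"
      by (simp add: powr_def flip: exp_of_real)
  qed
  then show ?thesis by (simp only: integral_complex_of_real)
qed

lemma zeta_phi_part_of_real: "zeta_phi_part (of_real s) = of_real (\<integral>y. y powr (- s) * phir y \<partial>restrict_space lborel {1..})"
proof -
  have "zeta_phi_part (of_real s) = (\<integral>y. complex_of_real (y powr (- s) * phir y) \<partial>restrict_space lborel {1..})"
    unfolding zeta_phi_part_def
  proof (intro Bochner_Integration.integral_cong refl)
    fix y assume "y \<in> space (restrict_space lborel {1::real..})"
    then have "y > 0" by simp
    then show "exp (- complex_of_real s * of_real (ln y)) * of_real (phir y) = complex_of_real (y powr (- s) * phir y)"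
      by (simp add: powr_def flip: exp_of_real)
  qed
  then show ?thesis by (simp only: integral_complex_of_real)
qed

lemma integrable_powr_phir_from_1:
  "integrable (restrict_space lborel {1..}) (\<lambda>y. y powr a * phir y)"
proof -
  have "{0<..} = {0<..<1} \<union> {1::real..}" by auto
  then have "integrable (restrict_space lborel ({0<..<1} \<union> {1..})) (\<lambda>y. y powr (\<bar>a\<bar> + 1) * phir y)"
    using integrable_powr_phir[of "\<bar>a\<bar> + 1"] by simp
  then have "integrable (restrict_space lborel {1..}) (\<lambda>y. y powr (\<bar>a\<bar> + 1) * phir y)"
    by (rule integral_restrict_lborel_Un) auto
  then show ?thesis
  proof (rule Bochner_Integration.integrable_bound)
    show "AE y in restrict_space lborel {1..}. norm (y powr a * phir y) \<le> norm (y powr (\<bar>a\<bar> + 1) * phir y)"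
      by (intro AE_I2) (auto simp: abs_mult intro!: mult_right_mono powr_mono)
  qed (auto intro!: measurable_restrict_space1)
qed

lemma zeta_series_eq_zeta_left_real:
  assumes s: "1 < s" "s < 2"
  shows "zeta_series (of_real s) = zeta_left (of_real s)"
proof -
  define I where "I = (\<integral>y. y powr (1 - s) * q y \<partial>restrict_space lborel {0<..<1})"
  define J where "J = (\<integral>y. y powr (- s) * phir y \<partial>restrict_space lborel {1..})"
  define Z where "Z = (\<Sum>j. wt (Suc j) * root (Suc j) powr (- s))"
  have eq: "{0<..} = {0<..<1} \<union> {1::real..}" by auto
  have int: "integrable (restrict_space lborel ({0<..<1} \<union> {1..})) (\<lambda>y. y powr (1 - s) * q y)"
    using has_bochner_integral_powr_q[OF s] unfolding eq[symmetric] has_bochner_integral_iff by blast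
  have "pi / (2 * sin (pi * s / 2)) * Z = (\<integral>y. y powr (1 - s) * q y \<partial>restrict_space lborel ({0<..<1} \<union> {1..}))"
    using has_bochner_integral_powr_q[OF s] unfolding eq[symmetric] has_bochner_integral_iff Z_def by simp
  also have "\<dots> = I + (\<integral>y. y powr (1 - s) * q y \<partial>restrict_space lborel {1..})"
    unfolding I_def by (rule integral_restrict_lborel_Un(3)[OF int]) auto
  also have "(\<integral>y. y powr (1 - s) * q y \<partial>restrict_space lborel {1..}) =
    (\<integral>y. pi / 2 * y powr (- s) + pi * (y powr (- s) * phir y) - wt 0 / 2 * y powr (- 1 - s) \<partial>restrict_space lborel {1..})"
  proof (intro Bochner_Integration.integral_cong refl)
    fix y assume "y \<in> space (restrict_space lborel {1::real..})"
    then have y: "y > 0" by simp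
    show "y powr (1 - s) * q y = pi / 2 * y powr (- s) + pi * (y powr (- s) * phir y) - wt 0 / 2 * y powr (- 1 - s)"
      by (rule powr_q_split[OF y])
  qed
  also have "\<dots> = pi / 2 * (1 / (s - 1)) + pi * J - wt 0 / 2 * (1 / s)"
  proof -
    have pw: "has_bochner_integral (restrict_space lborel {1..}) (\<lambda>y. y powr e) (- 1 / (e + 1))" if "e < -1" for e :: real
      using has_integral_powr_to_inf[OF that, of 1] by (intro has_bochner_integral_restrict_lborel) auto
    have "has_bochner_integral (restrict_space lborel {1..})
      (\<lambda>y. pi / 2 * y powr (- s) + pi * (y powr (- s) * phir y) - wt 0 / 2 * y powr (- 1 - s))
      (pi / 2 * (- 1 / (- s + 1)) + pi * J - wt 0 / 2 * (- 1 / (- 1 - s + 1)))"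
      unfolding J_def using s
      by (intro has_bochner_integral_add has_bochner_integral_diff has_bochner_integral_mult_right pw
            has_bochner_integral_integrable integrable_powr_phir_from_1) auto
    moreover have "- 1 / (- s + 1) = 1 / (s - 1)" "- 1 / (- 1 - s + 1) = 1 / s"
      using s by (simp_all add: field_simps)
    ultimately show ?thesis by (simp only: has_bochner_integral_iff)
  qed
  finally have *: "pi / (2 * sin (pi * s / 2)) * Z = I + (pi / 2 * (1 / (s - 1)) + pi * J - wt 0 / 2 * (1 / s))" .
  have sin: "sin (pi * s / 2) > 0" using s by (intro sin_gt_zero) (auto simp: field_simps)
  have "Z = 2 / pi * sin (pi * s / 2) * (pi / (2 * sin (pi * s / 2)) * Z)" using sin by simp
  also have "\<dots> = 2 / pi * sin (pi * s / 2) * (I + pi / 2 / (s - 1) + pi * J) - wt 0 / 2 * (2 / pi * sin (pi * s / 2) / s)"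
    unfolding * by (simp add: algebra_simps)
  finally have "complex_of_real Z = of_real \<dots>" by (rule arg_cong)
  moreover have "complex_of_real s \<noteq> 0" using s by simp
  ultimately show ?thesis
    unfolding zeta_series_of_real[OF s(1)] zeta_left_def zeta_q_part_of_real zeta_phi_part_of_real I_def[symmetric] J_def[symmetric] Z_def[symmetric]
    by (simp flip: sin_of_real)
qed

lemma zeta_series_eq_zeta_left:
  assumes "1 < Re s" "Re s < 2"
  shows "zeta_series s = zeta_left s"
proof -
  let ?S = "{s. Re s > 1} \<inter> {s. Re s < 2}"
  have "zeta_series s - zeta_left s = 0"
  proof (rule analytic_continuation[of "\<lambda>s. zeta_series s - zeta_left s" ?S "complex_of_real ` {1<..<2}" "3/2"])
    show "(\<lambda>s. zeta_series s - zeta_left s) holomorphic_on ?S"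
      using holomorphic_zeta_series holomorphic_zeta_left by (intro holomorphic_intros) (auto elim!: holomorphic_on_subset)
    show "open ?S" by (intro open_Int open_Re_strip)
    show "connected ?S"
      by (intro convex_connected convex_Int convex_halfspace_Re_lt convex_halfspace_Re_gt)
    show "(3/2::complex) islimpt complex_of_real ` {1<..<2}"
      using islimpt_of_real_interval[of 1 "3/2" 2] by simp
  qed (use assms zeta_series_eq_zeta_left_real in auto)
  then show ?thesis by simp
qed

text \<open>The series and \<open>zeta_left\<close> agree on the strip and glue to a function that
  witnesses the choice in \<open>koshliakov_zeta\<close>. The punctured plane is connected, so
  whatever function was chosen coincides with the glued one.\<close>

lemma zeta_properties:
  shows zeta_eq_series: "Re s > 1 \<Longrightarrow> koshliakov_zeta p s = zeta_series s"
    and zeta_eq_zeta_left: "Re s < 2 \<Longrightarrow> s \<noteq> 1 \<Longrightarrow> koshliakov_zeta p s = zeta_left s"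
proof -
  define f where "f = (\<lambda>s. if s \<in> {s. Re s > 1} then zeta_series s else zeta_left s)"
  have "f holomorphic_on {s. Re s > 1} \<union> ({s. Re s < 2} - {1})"
    unfolding f_def using zeta_series_eq_zeta_left
    by (intro holomorphic_on_If_Un holomorphic_zeta_series holomorphic_zeta_left open_Re_strip open_delete) auto
  also have "{s. Re s > 1} \<union> ({s. Re s < 2} - {1}) = - {1}" by auto
  finally have f: "f holomorphic_on - {1}" .
  have fS: "f s = zeta_series s" if "Re s > 1" for s using that by (simp add: f_def)
  have "koshliakov_zeta p holomorphic_on - {1} \<and> (\<forall>s. Re s > 1 \<longrightarrow> koshliakov_zeta p s = koshliakov_zeta_series p s)"
    unfolding koshliakov_zeta_def by (rule someI[of _ f]) (use f fS in \<open>simp add: zeta_series_def\<close>)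
  then have zeta: "koshliakov_zeta p holomorphic_on - {1}"
    and series: "Re s > 1 \<Longrightarrow> koshliakov_zeta p s = zeta_series s" for s by (auto simp: zeta_series_def)
  show "Re s > 1 \<Longrightarrow> koshliakov_zeta p s = zeta_series s" by (rule series)
  show "koshliakov_zeta p s = zeta_left s" if s: "Re s < 2" "s \<noteq> 1" for s
  proof -
    have "koshliakov_zeta p s = f s"
    proof (rule analytic_continuation_open[of "{s. Re s > 1}" "- {1}" "koshliakov_zeta p" f])
      show "{s::complex. Re s > 1} \<noteq> {}" by (auto intro!: exI[of _ 2])
      show "connected (- {1::complex})" by (rule connected_punctured_universe) simp
    qed (use open_Re_strip zeta f series fS s in auto)
    then show ?thesis using zeta_series_eq_zeta_left[of s] s by (auto simp: f_def)
  qed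
qed

text \<open>For \<open>s = 1 - 2 n\<close> the functions \<open>y powr (- s)\<close> and \<open>y powr (- s - 1)\<close> are integrable at \<open>0\<close>,
  so the polar terms of the continuation cancel against the integral over \<open>(0, 1)\<close>.\<close>

lemma zeta_negative_odd:
  assumes n: "n > 0"
  shows "koshliakov_zeta p (of_int (1 - 2 * int n)) =
    of_real (2 * (- 1) ^ n * (\<integral>y. y ^ (2 * n - 1) * phir y \<partial>half_line))"
proof -
  define s where "s = 1 - 2 * real n"
  define I where "I = (\<integral>y. y powr (1 - s) * q y \<partial>restrict_space lborel {0<..<1})"
  define J where "J = (\<integral>y. y powr (- s) * phir y \<partial>restrict_space lborel {1..})"
  define L where "L = (\<integral>y. y powr (- s) * phir y \<partial>restrict_space lborel {0<..<1})"
  have s: "s < 0" using n by (simp add: s_def)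
  have eq: "{0<..} = {0<..<1} \<union> {1::real..}" by auto
  have int: "integrable (restrict_space lborel ({0<..<1} \<union> {1..})) (\<lambda>y. y powr (- s) * phir y)"
    using integrable_powr_phir[of "- s"] s unfolding eq by simp
  note split = integral_restrict_lborel_Un[OF int]
  have "I = (\<integral>y. pi / 2 * y powr (- s) + pi * (y powr (- s) * phir y) - wt 0 / 2 * y powr (- 1 - s) \<partial>restrict_space lborel {0<..<1})"
    unfolding I_def
  proof (intro Bochner_Integration.integral_cong refl)
    fix y assume "y \<in> space (restrict_space lborel {0<..<1::real})"
    then have y: "y > 0" by simp
    show "y powr (1 - s) * q y = pi / 2 * y powr (- s) + pi * (y powr (- s) * phir y) - wt 0 / 2 * y powr (- 1 - s)"
      by (rule powr_q_split[OF y])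
  qed
  also have "\<dots> = pi / 2 * (1 / (1 - s)) + pi * L - wt 0 / 2 * (- 1 / s)"
  proof -
    have pw: "has_bochner_integral (restrict_space lborel {0<..<1}) (\<lambda>y. y powr e) (1 / (e + 1))" if "e > -1" for e :: real
      using has_integral_powr_from_0[OF that, of 1]
      by (intro has_bochner_integral_restrict_lborel) (auto simp: has_integral_Icc_iff_Ioo)
    have "has_bochner_integral (restrict_space lborel {0<..<1})
      (\<lambda>y. pi / 2 * y powr (- s) + pi * (y powr (- s) * phir y) - wt 0 / 2 * y powr (- 1 - s))
      (pi / 2 * (1 / (- s + 1)) + pi * L - wt 0 / 2 * (1 / (- 1 - s + 1)))"
      unfolding L_def using s
      by (intro has_bochner_integral_add has_bochner_integral_diff has_bochner_integral_mult_right pw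
            has_bochner_integral_integrable split(1)) auto
    then show ?thesis by (simp add: has_bochner_integral_iff)
  qed
  finally have I: "I = pi / 2 * (1 / (1 - s)) + pi * L - wt 0 / 2 * (- 1 / s)" .
  have sin: "sin (pi * s / 2) = (- 1) ^ n"
  proof -
    have e: "pi * s / 2 = pi / 2 - real n * pi" by (simp add: s_def field_simps)
    show ?thesis unfolding e by (simp add: sin_diff)
  qed
  have "2 / pi * sin (pi * s / 2) * (I + pi / 2 / (s - 1) + pi * J) - wt 0 / 2 * (2 / pi * sin (pi * s / 2) / s)
      = 2 * sin (pi * s / 2) * (L + J)"
  proof -
    have "I + pi / 2 / (s - 1) + pi * J = pi * (L + J) + wt 0 / 2 / s"
    proof -
      have "pi / 2 * (1 / (1 - s)) = - (pi / 2 / (s - 1))"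
        using s by (simp add: divide_simps) (simp add: algebra_simps)
      then show ?thesis unfolding I by (simp add: algebra_simps)
    qed
    moreover have "2 / pi * S * (pi * U + V / s) - V * (2 / pi * S / s) = 2 * S * U" for S U V
      using s by (simp add: field_simps)
    ultimately show ?thesis by metis
  qed
  also have "L + J = (\<integral>y. y powr (- s) * phir y \<partial>half_line)"
    unfolding eq L_def J_def by (rule split(3)[symmetric]) auto
  also have "\<dots> = (\<integral>y. y ^ (2 * n - 1) * phir y \<partial>half_line)"
  proof (intro Bochner_Integration.integral_cong refl)
    fix y assume "y \<in> space (half_line)"
    then have y: "y > 0" by simp
    have e: "- s = real (2 * n - 1)" using n by (simp add: s_def of_nat_diff)
    show "y powr (- s) * phir y = y ^ (2 * n - 1) * phir y" unfolding e powr_realpow[OF y] ..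
  qed
  finally have main: "2 / pi * sin (pi * s / 2) * (I + pi / 2 / (s - 1) + pi * J) - wt 0 / 2 * (2 / pi * sin (pi * s / 2) / s)
    = 2 * (- 1) ^ n * (\<integral>y. y ^ (2 * n - 1) * phir y \<partial>half_line)" unfolding sin .
  have "(of_int (1 - 2 * int n) :: complex) = of_real s" by (simp add: s_def)
  moreover have "koshliakov_zeta p (of_real s) = zeta_left (of_real s)"
    using s by (intro zeta_eq_zeta_left) auto
  moreover have "zeta_left (of_real s) = of_real (2 / pi * sin (pi * s / 2) * (I + pi / 2 / (s - 1) + pi * J) - wt 0 / 2 * (2 / pi * sin (pi * s / 2) / s))"
    unfolding zeta_left_def zeta_q_part_of_real zeta_phi_part_of_real I_def[symmetric] J_def[symmetric] using s by (simp flip: sin_of_real)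
  ultimately show ?thesis unfolding main by simp
qed

end

section \<open>Negative exponents\<close>

text \<open>Induction on the set of poles. A new pole s is absorbed by splitting 1 / ((x - r) (x -
  s)); if the degree k equals the old number of poles, writing x = (x - s) + s lowers it
  first.\<close>

lemma partial_fraction_distinct:
  fixes A :: "complex set"
  assumes "finite A" "A \<noteq> {}" "k < card A"
  shows "\<exists>c. \<forall>x. x \<notin> A \<longrightarrow> x ^ k / (\<Prod>r\<in>A. (x - r)) = (\<Sum>r\<in>A. c r / (x - r))"
  using assms
proof (induction A arbitrary: k rule: finite_ne_induct)
  case (singleton r)
  then show ?case by (intro exI[of _ "\<lambda>_. 1"]) simp
next
  case (insert s A)
  have low: "\<exists>c. \<forall>x. x \<notin> insert s A \<longrightarrow> x ^ k / (\<Prod>r\<in>insert s A. (x - r)) = (\<Sum>r\<in>insert s A. c r / (x - r))"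
    if kA: "k < card A" for k
  proof -
    obtain c where c: "\<And>x. x \<notin> A \<Longrightarrow> x ^ k / (\<Prod>r\<in>A. (x - r)) = (\<Sum>r\<in>A. c r / (x - r))"
      using insert.IH[OF kA] by blast
    define d where "d r = (if r = s then - (\<Sum>t\<in>A. c t / (t - s)) else c r / (r - s))" for r
    have "x ^ k / (\<Prod>r\<in>insert s A. (x - r)) = (\<Sum>r\<in>insert s A. d r / (x - r))" if x: "x \<notin> insert s A" for x
    proof -
      have "x ^ k / (\<Prod>r\<in>insert s A. (x - r)) = (x ^ k / (\<Prod>r\<in>A. (x - r))) / (x - s)"
        using insert.hyps by (simp add: divide_divide_eq_left mult.commute)
      also have "\<dots> = (\<Sum>r\<in>A. c r / (x - r) / (x - s))"
        using c[of x] x by (simp add: sum_divide_distrib)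
      also have "\<dots> = (\<Sum>r\<in>A. c r / (r - s) / (x - r) - c r / (r - s) / (x - s))"
      proof (rule sum.cong[OF refl])
        fix r assume r: "r \<in> A"
        have nz: "x - r \<noteq> 0" "x - s \<noteq> 0" "r - s \<noteq> 0" using x r insert.hyps by auto
        have "1 / (x - r) / (x - s) = (1 / (r - s)) * (1 / (x - r) - 1 / (x - s))"
          using nz by (simp add: field_simps)
        then have "c r * (1 / (x - r) / (x - s)) = c r * ((1 / (r - s)) * (1 / (x - r) - 1 / (x - s)))" by simp
        then show "c r / (x - r) / (x - s) = c r / (r - s) / (x - r) - c r / (r - s) / (x - s)"
          by (simp add: right_diff_distrib)
      qed
      also have "\<dots> = (\<Sum>r\<in>A. d r / (x - r)) + d s / (x - s)"
      proof -
        have "(\<Sum>r\<in>A. c r / (r - s) / (x - r)) = (\<Sum>r\<in>A. d r / (x - r))"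
          using insert.hyps by (intro sum.cong refl) (auto simp: d_def)
        then show ?thesis by (simp add: sum_subtractf d_def sum_divide_distrib)
      qed
      finally show ?thesis using insert.hyps by (simp add: add.commute)
    qed
    then show ?thesis by blast
  qed
  show ?case
  proof (cases "k < card A")
    case True then show ?thesis by (rule low)
  next
    case False
    then have k: "k = card A" using insert by simp
    have "card A > 0" using insert.hyps by (simp add: card_gt_0_iff)
    then obtain k' where k': "k = Suc k'" "k' < card A" using k that[of "card A - 1"] by auto
    obtain c where c: "\<And>x. x \<notin> A \<Longrightarrow> x ^ k' / (\<Prod>r\<in>A. (x - r)) = (\<Sum>r\<in>A. c r / (x - r))"
      using insert.IH[OF k'(2)] by blast
    obtain d where d: "\<And>x. x \<notin> insert s A \<Longrightarrow> x ^ k' / (\<Prod>r\<in>insert s A. (x - r)) = (\<Sum>r\<in>insert s A. d r / (x - r))"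
      using low[OF k'(2)] by blast
    define e where "e r = (if r = s then 0 else c r) + s * d r" for r
    have "x ^ k / (\<Prod>r\<in>insert s A. (x - r)) = (\<Sum>r\<in>insert s A. e r / (x - r))" if x: "x \<notin> insert s A" for x
    proof -
      have nz: "x - s \<noteq> 0" using x by auto
      have "x ^ k / (\<Prod>r\<in>insert s A. (x - r)) = (x - s) * (x ^ k' / (\<Prod>r\<in>insert s A. (x - r))) + s * (x ^ k' / (\<Prod>r\<in>insert s A. (x - r)))"
        unfolding k' by (simp add: left_diff_distrib diff_divide_distrib)
      also have "(x - s) * (x ^ k' / (\<Prod>r\<in>insert s A. (x - r))) = x ^ k' / (\<Prod>r\<in>A. (x - r))"
        using insert.hyps nz by simp
      also have "\<dots> = (\<Sum>r\<in>A. c r / (x - r))" using c x by simp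
      also have "\<dots> = (\<Sum>r\<in>insert s A. (if r = s then 0 else c r) / (x - r))"
      proof -
        have "(\<Sum>r\<in>A. c r / (x - r)) = (\<Sum>r\<in>A. (if r = s then 0 else c r) / (x - r))"
          using insert.hyps by (intro sum.cong refl) auto
        then show ?thesis using insert.hyps by simp
      qed
      also have "s * (x ^ k' / (\<Prod>r\<in>insert s A. (x - r))) = (\<Sum>r\<in>insert s A. s * d r / (x - r))"
        using d[OF x] by (simp add: sum_distrib_left)
      finally show ?thesis unfolding e_def add_divide_distrib sum.distrib .
    qed
    then show ?thesis by blast
  qed
qed

lemma (in pair_sigma_finite) integrable_product:
  fixes f :: "'a \<Rightarrow> 'c::{banach, second_countable_topology, real_normed_field}"
  assumes f: "integrable M1 f" and g: "integrable M2 g"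
  shows "integrable (M1 \<Otimes>\<^sub>M M2) (\<lambda>(x, y). f x * g y)"
    "(\<integral>z. (case z of (x, y) \<Rightarrow> f x * g y) \<partial>(M1 \<Otimes>\<^sub>M M2)) = (\<integral>x. f x \<partial>M1) * (\<integral>y. g y \<partial>M2)"
proof -
  have m: "f \<in> borel_measurable M1" "g \<in> borel_measurable M2" using f g by auto
  show int: "integrable (M1 \<Otimes>\<^sub>M M2) (\<lambda>(x, y). f x * g y)"
  proof (rule Fubini_integrable)
    show "(\<lambda>(x, y). f x * g y) \<in> borel_measurable (M1 \<Otimes>\<^sub>M M2)" using m by measurable
    show "integrable M1 (\<lambda>x. \<integral>y. norm (case (x, y) of (x, y) \<Rightarrow> f x * g y) \<partial>M2)"
      using f by (simp add: norm_mult)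
    show "AE x in M1. integrable M2 (\<lambda>y. case (x, y) of (x, y) \<Rightarrow> f x * g y)"
      using g by simp
  qed
  show "(\<integral>z. (case z of (x, y) \<Rightarrow> f x * g y) \<partial>(M1 \<Otimes>\<^sub>M M2)) = (\<integral>x. f x \<partial>M1) * (\<integral>y. g y \<partial>M2)"
    using integral_fst'[OF int] by simp
qed

text \<open>If \<open>f X = (\<Sum>\<tau>\<in>T. d \<tau> / (X - \<tau>))\<close>, then \<open>(f X - f (- Y)) / (X + Y)\<close> is a finite sum of products
  of a function of \<open>X\<close> with a function of \<open>Y\<close>. This fails only at \<open>X = Y = 0\<close>, where the division
  by \<open>0\<close> yields \<open>0\<close> instead of the derivative \<open>\<delta>\<close> of \<open>f\<close>.\<close>

lemma exchange_kernel:
  fixes M1 :: "'a measure" and M2 :: "'b measure" and \<xi> :: "'a \<Rightarrow> real" and \<eta> :: "'b \<Rightarrow> real"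
    and f :: "real \<Rightarrow> real" and d :: "complex \<Rightarrow> complex"
  assumes M1: "sigma_finite_measure M1" and M2: "sigma_finite_measure M2"
    and m: "\<xi> \<in> borel_measurable M1" "\<eta> \<in> borel_measurable M2" "f \<in> borel_measurable borel"
    and i1: "integrable M1 (\<lambda>x. 1 / (1 + (\<xi> x)\<^sup>2))" and i2: "integrable M2 (\<lambda>y. 1 / (1 + (\<eta> y)\<^sup>2))"
    and T: "finite T" "\<And>\<tau>. \<tau> \<in> T \<Longrightarrow> Im \<tau> \<noteq> 0"
    and f: "\<And>X. of_real (f X) = (\<Sum>\<tau>\<in>T. d \<tau> / (of_real X - \<tau>))"
    and par: "\<And>X. f (- X) = e * f X" and b: "b > 0"
    and fb: "\<And>X. X \<ge> 0 \<Longrightarrow> \<bar>f X\<bar> \<le> C * (X / (1 + X\<^sup>2))"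
    and \<delta>: "(\<Sum>\<tau>\<in>T. d \<tau> / \<tau>\<^sup>2) = - of_real \<delta>"
  defines "k \<equiv> \<lambda>x y. 2 * b / ((\<xi> x)\<^sup>2 + b\<^sup>2 * (\<eta> y)\<^sup>2)"
  shows "integrable M1 (\<lambda>x. f ((\<xi> x)\<^sup>2) * (\<integral>y. k x y \<partial>M2))"
    and "integrable M2 (\<lambda>y. f (b\<^sup>2 * (\<eta> y)\<^sup>2) * (\<integral>x. k x y \<partial>M1))"
    and "complex_of_real ((\<integral>x. f ((\<xi> x)\<^sup>2) * (\<integral>y. k x y \<partial>M2) \<partial>M1) - e * (\<integral>y. f (b\<^sup>2 * (\<eta> y)\<^sup>2) * (\<integral>x. k x y \<partial>M1) \<partial>M2))
      = - of_real (2 * b) * (\<Sum>\<tau>\<in>T. d \<tau> * ((\<integral>x. 1 / (of_real ((\<xi> x)\<^sup>2) - \<tau>) \<partial>M1) * (\<integral>y. 1 / (- \<tau> - of_real (b\<^sup>2 * (\<eta> y)\<^sup>2)) \<partial>M2)))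
        - of_real (2 * b * \<delta>) * (\<integral>x. (of_bool (\<xi> x = 0) :: complex) \<partial>M1) * (\<integral>y. (of_bool (\<eta> y = 0) :: complex) \<partial>M2)"
proof -
  interpret M1: sigma_finite_measure M1 by fact
  interpret M2: sigma_finite_measure M2 by fact
  interpret pair_sigma_finite M1 M2 ..
  note [measurable] = m
  have pos: "1 + t\<^sup>2 > 0" for t :: real by (rule add_pos_nonneg) auto
  \<comment> \<open>The cost of replacing 1 + b^2 \<eta>^2 by 1 + \<eta>^2 in denominators.\<close>
  define B where "B = max 1 (1 / b\<^sup>2)"
  have B: "B \<ge> 1" "1 + Y / b\<^sup>2 \<le> B * (1 + Y)" if "Y \<ge> 0" for Y
  proof -
    show "B \<ge> 1" by (simp add: B_def)
    have "Y * (1 / b\<^sup>2) \<le> Y * B" using that by (intro mult_left_mono) (auto simp: B_def)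
    then show "1 + Y / b\<^sup>2 \<le> B * (1 + Y)" by (simp add: algebra_simps B_def)
  qed
  have C: "C \<ge> 0" using fb[of 1] by simp
  \<comment> \<open>Separates the variables: the zero of f at the origin compensates the singularity
    of the kernel at X = Y = 0, and its decay leaves a product of two integrable functions. The
    estimate comes from (X - 1)^2 >= 0 multiplied by X and by Y.\<close>
  have ker: "X / (1 + X\<^sup>2) / (X + Y) \<le> 2 / ((1 + X) * (1 + Y))" if XY: "X \<ge> 0" "Y \<ge> 0" for X Y :: real
  proof (cases "X + Y = 0")
    case True then show ?thesis using XY by simp
  next
    case False
    then have p: "X + Y > 0" using XY by linarith
    have "X * ((1 + X) * (1 + Y)) \<le> 2 * ((1 + X\<^sup>2) * (X + Y))"
    proof -
      have 1: "2 * X\<^sup>2 \<le> X + X ^ 3"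
      proof -
        have "0 \<le> X * (X - 1)\<^sup>2" using XY by simp
        then show ?thesis by (simp add: power2_eq_square power3_eq_cube algebra_simps)
      qed
      have 2: "2 * (X * Y) \<le> Y + X\<^sup>2 * Y"
      proof -
        have "0 \<le> Y * (X - 1)\<^sup>2" using XY by simp
        then show ?thesis by (simp add: power2_eq_square algebra_simps)
      qed
      have 3: "0 \<le> X ^ 3" "0 \<le> X\<^sup>2 * Y" "0 \<le> X * Y" "0 \<le> X\<^sup>2" using XY by auto
      have "X * ((1 + X) * (1 + Y)) = X + X * Y + X\<^sup>2 + X\<^sup>2 * Y"
        by (simp add: power2_eq_square algebra_simps)
      also have "\<dots> \<le> 2 * (X + Y + X ^ 3 + X\<^sup>2 * Y)"
      proof -
        \<comment> \<open>With the monomials abstracted to variables, the inequality is linear in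
          them.\<close>
        have "t + c + d + e \<le> 2 * (t + g + h + e)" if "2 * d \<le> t + h" "2 * c \<le> g + e" "0 \<le> h" "0 \<le> e" "0 \<le> t" "0 \<le> g"
          for c d e g h t :: real using that by argo
        from this[OF 1 2 3(1,2) XY] show ?thesis .
      qed
      also have "\<dots> = 2 * ((1 + X\<^sup>2) * (X + Y))"
        by (simp add: power2_eq_square power3_eq_cube algebra_simps)
      finally show ?thesis .
    qed
    then have "X / ((1 + X\<^sup>2) * (X + Y)) \<le> 2 / ((1 + X) * (1 + Y))"
      using p XY pos[of X] by (subst frac_le_eq) (auto simp: divide_le_0_iff mult.commute intro!: mult_pos_pos add_pos_nonneg)
    then show ?thesis by simp
  qed
  define G1 where "G1 x y = f ((\<xi> x)\<^sup>2) * k x y" for x y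
  define G2 where "G2 x y = f (b\<^sup>2 * (\<eta> y)\<^sup>2) * k x y" for x y
  have kf: "\<bar>f Z * (2 * b / (X + Y))\<bar> \<le> 2 * b * C * (2 / ((1 + X) * (1 + Y)))"
    if "X \<ge> 0" "Y \<ge> 0" "Z = X \<or> Z = Y" for X Y Z
  proof -
    have "Z \<ge> 0" using that by auto
    have "\<bar>f Z * (2 * b / (X + Y))\<bar> = 2 * b * (\<bar>f Z\<bar> / (X + Y))" using b that by (simp add: abs_mult)
    also have "\<dots> \<le> 2 * b * (C * (Z / (1 + Z\<^sup>2)) / (X + Y))"
      using fb[OF \<open>Z \<ge> 0\<close>] b that by (intro mult_left_mono divide_right_mono) auto
    also have "\<dots> = 2 * b * C * (Z / (1 + Z\<^sup>2) / (X + Y))" by simp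
    also have "\<dots> \<le> 2 * b * C * (2 / ((1 + X) * (1 + Y)))"
      using ker[of X Y] ker[of Y X] that b C by (intro mult_left_mono) (auto simp: add.commute mult.commute)
    finally show ?thesis .
  qed
  define H where "H x y = 4 * b * C * B * ((1 / (1 + (\<xi> x)\<^sup>2)) * (1 / (1 + (\<eta> y)\<^sup>2)))" for x y
  have scale: "1 / (1 + b\<^sup>2 * (\<eta> y)\<^sup>2) \<le> B * (1 / (1 + (\<eta> y)\<^sup>2))" for y
  proof -
    have "1 + (b\<^sup>2 * (\<eta> y)\<^sup>2) / b\<^sup>2 \<le> B * (1 + b\<^sup>2 * (\<eta> y)\<^sup>2)" by (rule B) simp
    then have le: "1 + (\<eta> y)\<^sup>2 \<le> B * (1 + b\<^sup>2 * (\<eta> y)\<^sup>2)" using b by simp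
    have p: "1 + b\<^sup>2 * (\<eta> y)\<^sup>2 > 0" by (rule add_pos_nonneg) auto
    show ?thesis using le p pos[of "\<eta> y"] by (simp add: field_simps)
  qed
  have Hb: "2 * b * C * (2 / ((1 + (\<xi> x)\<^sup>2) * (1 + b\<^sup>2 * (\<eta> y)\<^sup>2))) \<le> H x y" for x y
  proof -
    have "4 * b * C * (1 / (1 + (\<xi> x)\<^sup>2)) * (1 / (1 + b\<^sup>2 * (\<eta> y)\<^sup>2)) \<le> 4 * b * C * (1 / (1 + (\<xi> x)\<^sup>2)) * (B * (1 / (1 + (\<eta> y)\<^sup>2)))"
      using b C pos[of "\<xi> x"] scale[of y] by (intro mult_left_mono) auto
    then show ?thesis by (simp add: H_def mult_ac)
  qed
  have intH: "integrable (M1 \<Otimes>\<^sub>M M2) (\<lambda>(x, y). H x y)"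
    using integrable_mult_right[OF integrable_product(1)[OF i1 i2], of "4 * b * C * B"]
    unfolding H_def by (simp add: case_prod_unfold)
  have bnd: "\<bar>G1 x y\<bar> \<le> H x y" "\<bar>G2 x y\<bar> \<le> H x y" for x y
    unfolding G1_def G2_def k_def
    by (rule order.trans[OF kf Hb]; simp)+
  then have bnda: "\<bar>G1 x y\<bar> \<le> \<bar>H x y\<bar>" "\<bar>G2 x y\<bar> \<le> \<bar>H x y\<bar>" for x y
    using order.trans[OF _ abs_ge_self] by blast+
  have int1: "integrable (M1 \<Otimes>\<^sub>M M2) (\<lambda>(x, y). G1 x y)"
  proof (rule Bochner_Integration.integrable_bound[OF intH])
    show "AE z in M1 \<Otimes>\<^sub>M M2. norm (case z of (x, y) \<Rightarrow> G1 x y) \<le> norm (case z of (x, y) \<Rightarrow> H x y)"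
      using bnda(1) by (intro AE_I2) (auto split: prod.split)
  qed (unfold G1_def k_def, measurable)
  have int2: "integrable (M1 \<Otimes>\<^sub>M M2) (\<lambda>(x, y). G2 x y)"
  proof (rule Bochner_Integration.integrable_bound[OF intH])
    show "AE z in M1 \<Otimes>\<^sub>M M2. norm (case z of (x, y) \<Rightarrow> G2 x y) \<le> norm (case z of (x, y) \<Rightarrow> H x y)"
      using bnda(2) by (intro AE_I2) (auto split: prod.split)
  qed (unfold G2_def k_def, measurable)
  have f1: "(\<integral>y. G1 x y \<partial>M2) = f ((\<xi> x)\<^sup>2) * (\<integral>y. k x y \<partial>M2)" for x unfolding G1_def by simp
  have f2: "(\<integral>x. G2 x y \<partial>M1) = f (b\<^sup>2 * (\<eta> y)\<^sup>2) * (\<integral>x. k x y \<partial>M1)" for y unfolding G2_def by simp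
  show "integrable M1 (\<lambda>x. f ((\<xi> x)\<^sup>2) * (\<integral>y. k x y \<partial>M2))"
    using integrable_fst'[OF int1] by (simp add: f1)
  show "integrable M2 (\<lambda>y. f (b\<^sup>2 * (\<eta> y)\<^sup>2) * (\<integral>x. k x y \<partial>M1))"
    using integrable_snd[OF int2] by (simp add: f2)
  have "(\<integral>x. f ((\<xi> x)\<^sup>2) * (\<integral>y. k x y \<partial>M2) \<partial>M1) - e * (\<integral>y. f (b\<^sup>2 * (\<eta> y)\<^sup>2) * (\<integral>x. k x y \<partial>M1) \<partial>M2)
    = (\<integral>z. (case z of (x, y) \<Rightarrow> G1 x y) \<partial>(M1 \<Otimes>\<^sub>M M2)) - e * (\<integral>z. (case z of (x, y) \<Rightarrow> G2 x y) \<partial>(M1 \<Otimes>\<^sub>M M2))"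
    using integral_fst'[OF int1] integral_snd[OF int2] by (simp add: f1 f2)
  also have "\<dots> = (\<integral>z. (case z of (x, y) \<Rightarrow> G1 x y) - e * (case z of (x, y) \<Rightarrow> G2 x y) \<partial>(M1 \<Otimes>\<^sub>M M2))"
    using int1 int2 by simp
  finally have "complex_of_real ((\<integral>x. f ((\<xi> x)\<^sup>2) * (\<integral>y. k x y \<partial>M2) \<partial>M1) - e * (\<integral>y. f (b\<^sup>2 * (\<eta> y)\<^sup>2) * (\<integral>x. k x y \<partial>M1) \<partial>M2))
    = (\<integral>z. of_real ((case z of (x, y) \<Rightarrow> G1 x y) - e * (case z of (x, y) \<Rightarrow> G2 x y)) \<partial>(M1 \<Otimes>\<^sub>M M2))"
    unfolding integral_complex_of_real by simp
  also have "\<dots> = (\<integral>z. (\<Sum>\<tau>\<in>T. (- of_real (2 * b) * d \<tau>) * (case z of (x, y) \<Rightarrow> (1 / (of_real ((\<xi> x)\<^sup>2) - \<tau>)) * (1 / (- \<tau> - of_real (b\<^sup>2 * (\<eta> y)\<^sup>2)))))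
      - of_real (2 * b * \<delta>) * (case z of (x, y) \<Rightarrow> (of_bool (\<xi> x = 0) :: complex) * (of_bool (\<eta> y = 0) :: complex)) \<partial>(M1 \<Otimes>\<^sub>M M2))"
  proof (intro Bochner_Integration.integral_cong refl, clarify)
    fix x y
    define X Y where "X = (\<xi> x)\<^sup>2" and "Y = b\<^sup>2 * (\<eta> y)\<^sup>2"
    have XY: "X \<ge> 0" "Y \<ge> 0" by (auto simp: X_def Y_def)
    have nz: "complex_of_real X - \<tau> \<noteq> 0" "- \<tau> - complex_of_real Y \<noteq> 0" if "\<tau> \<in> T" for \<tau>
      using T(2)[OF that] by (auto simp: complex_eq_iff)
    have main: "complex_of_real (f X * (2 * b / (X + Y)) - e * (f Y * (2 * b / (X + Y)))) =
      (\<Sum>\<tau>\<in>T. (- of_real (2 * b) * d \<tau>) * ((1 / (of_real X - \<tau>)) * (1 / (- \<tau> - of_real Y)))) - of_real (2 * b * \<delta>) * ((of_bool (X = 0) :: complex) * (of_bool (Y = 0) :: complex))"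
    proof (cases "X = 0 \<and> Y = 0")
      case True
      have "(\<Sum>\<tau>\<in>T. (- of_real (2 * b) * d \<tau>) * ((1 / (of_real X - \<tau>)) * (1 / (- \<tau> - of_real Y)))) = - of_real (2 * b) * (\<Sum>\<tau>\<in>T. d \<tau> / \<tau>\<^sup>2)"
        using True by (simp add: sum_distrib_left power2_eq_square)
      then show ?thesis using True unfolding \<delta> by simp
    next
      case False
      then have s: "X + Y \<noteq> 0" using XY by auto
      have "complex_of_real (f X * (2 * b / (X + Y)) - e * (f Y * (2 * b / (X + Y)))) = (of_real (f X) - of_real (f (- Y))) * of_real (2 * b / (X + Y))"
        unfolding par by (simp only: of_real_diff[symmetric] of_real_mult[symmetric] left_diff_distrib mult.assoc)
      also have "\<dots> = (\<Sum>\<tau>\<in>T. (d \<tau> / (of_real X - \<tau>) - d \<tau> / (of_real (- Y) - \<tau>)) * of_real (2 * b / (X + Y)))"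
        unfolding f by (simp only: sum_subtractf[symmetric] sum_distrib_right)
      also have "\<dots> = (\<Sum>\<tau>\<in>T. (- of_real (2 * b) * d \<tau>) * ((1 / (of_real X - \<tau>)) * (1 / (- \<tau> - of_real Y))))"
      proof (rule sum.cong[OF refl])
        fix \<tau> assume \<tau>: "\<tau> \<in> T"
        \<comment> \<open>Since u - v = X + Y, the denominator of the kernel cancels in d / u - d /
          v.\<close>
        define u v where "u = complex_of_real X - \<tau>" and "v = - \<tau> - complex_of_real Y"
        have uv: "u \<noteq> 0" "v \<noteq> 0" using nz[OF \<tau>] by (auto simp: u_def v_def)
        have suv: "complex_of_real (X + Y) = u - v" by (simp add: u_def v_def)
        then have ne: "u - v \<noteq> 0" using s by (metis of_real_eq_0_iff)
        have e1: "of_real (- Y) - \<tau> = v" by (simp add: v_def)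
        have e2: "complex_of_real (2 * b / (X + Y)) = 2 * b / (u - v)" by (simp add: suv[symmetric])
        have "(d \<tau> / u - d \<tau> / v) * (2 * b / (u - v)) = (- of_real (2 * b) * d \<tau>) * ((1 / u) * (1 / v))"
        proof -
          have "d \<tau> / u - d \<tau> / v = - d \<tau> * (u - v) / (u * v)" using uv by (simp add: field_simps)
          then show ?thesis using ne by simp
        qed
        then show "(d \<tau> / (of_real X - \<tau>) - d \<tau> / (of_real (- Y) - \<tau>)) * of_real (2 * b / (X + Y)) =
          (- of_real (2 * b) * d \<tau>) * ((1 / (of_real X - \<tau>)) * (1 / (- \<tau> - of_real Y)))"
          unfolding e1 e2 u_def[symmetric] v_def[symmetric] .
      qed
      finally show ?thesis using False by simp
    qed
    have z: "of_bool (X = 0) = (of_bool (\<xi> x = 0) :: complex)" "of_bool (Y = 0) = (of_bool (\<eta> y = 0) :: complex)"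
      using b by (auto simp: X_def Y_def)
    show "complex_of_real (G1 x y - e * G2 x y) = (\<Sum>\<tau>\<in>T. (- of_real (2 * b) * d \<tau>) * ((1 / (of_real ((\<xi> x)\<^sup>2) - \<tau>)) * (1 / (- \<tau> - of_real (b\<^sup>2 * (\<eta> y)\<^sup>2)))))
      - of_real (2 * b * \<delta>) * ((of_bool (\<xi> x = 0) :: complex) * (of_bool (\<eta> y = 0) :: complex))"
      using main unfolding z unfolding G1_def G2_def k_def X_def Y_def .
  qed
  also have "\<dots> = - of_real (2 * b) * (\<Sum>\<tau>\<in>T. d \<tau> * ((\<integral>x. 1 / (of_real ((\<xi> x)\<^sup>2) - \<tau>) \<partial>M1) * (\<integral>y. 1 / (- \<tau> - of_real (b\<^sup>2 * (\<eta> y)\<^sup>2)) \<partial>M2)))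
        - of_real (2 * b * \<delta>) * (\<integral>x. (of_bool (\<xi> x = 0) :: complex) \<partial>M1) * (\<integral>y. (of_bool (\<eta> y = 0) :: complex) \<partial>M2)"
  proof -
    \<comment> \<open>A pole off the real axis keeps |t - \<tau>| comparable with 1 + t from below,
      uniformly in t >= 0.\<close>
    have bd: "norm (1 / (of_real t - \<tau>)) \<le> (1 + (1 + cmod \<tau>) / \<bar>Im \<tau>\<bar>) * (1 / (1 + t))"
      if t: "t \<ge> 0" and \<tau>: "Im \<tau> \<noteq> 0" for t \<tau>
    proof -
      let ?w = "of_real t - \<tau>"
      have w: "cmod ?w \<ge> \<bar>Im \<tau>\<bar>" using abs_Im_le_cmod[of ?w] by simp
      then have w0: "cmod ?w > 0" using \<tau> by linarith
      have "t = cmod (of_real t)" using t by simp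
      also have "\<dots> \<le> cmod ?w + cmod \<tau>" using norm_triangle_ineq[of ?w \<tau>] by simp
      finally have "1 + t \<le> cmod ?w + (1 + cmod \<tau>)" by simp
      also have "1 + cmod \<tau> = (1 + cmod \<tau>) / \<bar>Im \<tau>\<bar> * \<bar>Im \<tau>\<bar>" using \<tau> by simp
      also have "\<dots> \<le> (1 + cmod \<tau>) / \<bar>Im \<tau>\<bar> * cmod ?w" using w by (intro mult_left_mono) auto
      finally have "1 + t \<le> (1 + (1 + cmod \<tau>) / \<bar>Im \<tau>\<bar>) * cmod ?w" by (simp add: distrib_right)
      then show ?thesis using w0 t by (simp add: norm_divide divide_le_eq pos_le_divide_eq mult.commute)
    qed
    define u where "u \<tau> x = 1 / (complex_of_real ((\<xi> x)\<^sup>2) - \<tau>)" for \<tau> x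
    define v where "v \<tau> y = 1 / (- \<tau> - complex_of_real (b\<^sup>2 * (\<eta> y)\<^sup>2))" for \<tau> y
    have iu: "integrable M1 (u \<tau>)" if \<tau>: "\<tau> \<in> T" for \<tau>
    proof (rule Bochner_Integration.integrable_bound[OF integrable_mult_right[OF i1, of "1 + (1 + cmod \<tau>) / \<bar>Im \<tau>\<bar>"]])
      show "AE x in M1. norm (u \<tau> x) \<le> norm ((1 + (1 + cmod \<tau>) / \<bar>Im \<tau>\<bar>) * (1 / (1 + (\<xi> x)\<^sup>2)))"
        using bd[OF zero_le_power2 T(2)[OF \<tau>]] unfolding u_def real_norm_def by (intro AE_I2 order.trans[OF _ abs_ge_self])
    qed (unfold u_def, measurable)
    have iv: "integrable M2 (v \<tau>)" if \<tau>: "\<tau> \<in> T" for \<tau>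
    proof (rule Bochner_Integration.integrable_bound[OF integrable_mult_right[OF i2, of "(1 + (1 + cmod \<tau>) / \<bar>Im \<tau>\<bar>) * B"]])
      show "AE y in M2. norm (v \<tau> y) \<le> norm ((1 + (1 + cmod \<tau>) / \<bar>Im \<tau>\<bar>) * B * (1 / (1 + (\<eta> y)\<^sup>2)))"
      proof (rule AE_I2)
        fix y
        have Y: "b\<^sup>2 * (\<eta> y)\<^sup>2 \<ge> 0" by simp
        have "norm (v \<tau> y) = norm (1 / (complex_of_real (b\<^sup>2 * (\<eta> y)\<^sup>2) - (- \<tau>)))"
          unfolding v_def norm_divide by (metis norm_minus_cancel minus_diff_eq minus_diff_commute)
        also have "\<dots> \<le> (1 + (1 + cmod \<tau>) / \<bar>Im \<tau>\<bar>) * (1 / (1 + b\<^sup>2 * (\<eta> y)\<^sup>2))"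
          using bd[OF Y, of "- \<tau>"] T(2)[OF \<tau>] by simp
        also have "\<dots> \<le> (1 + (1 + cmod \<tau>) / \<bar>Im \<tau>\<bar>) * (B * (1 / (1 + (\<eta> y)\<^sup>2)))"
          using scale[of y] by (intro mult_left_mono) auto
        finally show "norm (v \<tau> y) \<le> norm ((1 + (1 + cmod \<tau>) / \<bar>Im \<tau>\<bar>) * B * (1 / (1 + (\<eta> y)\<^sup>2)))"
          unfolding real_norm_def mult.assoc by (rule order.trans[OF _ abs_ge_self])
      qed
    qed (unfold v_def, measurable)
    have iz1: "integrable M1 (\<lambda>x. of_bool (\<xi> x = 0) :: complex)"
      by (rule Bochner_Integration.integrable_bound[OF i1]) (auto intro!: AE_I2)
    have iz2: "integrable M2 (\<lambda>y. of_bool (\<eta> y = 0) :: complex)"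
      by (rule Bochner_Integration.integrable_bound[OF i2]) (auto intro!: AE_I2)
    note uv = integrable_product[OF iu iv] and zz = integrable_product[OF iz1 iz2]
    have "(\<integral>z. (\<Sum>\<tau>\<in>T. (- of_real (2 * b) * d \<tau>) * (case z of (x, y) \<Rightarrow> u \<tau> x * v \<tau> y))
      - of_real (2 * b * \<delta>) * (case z of (x, y) \<Rightarrow> (of_bool (\<xi> x = 0) :: complex) * (of_bool (\<eta> y = 0) :: complex)) \<partial>(M1 \<Otimes>\<^sub>M M2)) =
      (\<Sum>\<tau>\<in>T. (- of_real (2 * b) * d \<tau>) * ((\<integral>x. u \<tau> x \<partial>M1) * (\<integral>y. v \<tau> y \<partial>M2)))
      - of_real (2 * b * \<delta>) * ((\<integral>x. (of_bool (\<xi> x = 0) :: complex) \<partial>M1) * (\<integral>y. (of_bool (\<eta> y = 0) :: complex) \<partial>M2))"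
    proof (rule has_bochner_integral_integral_eq, intro has_bochner_integral_diff has_bochner_integral_sum has_bochner_integral_mult_right)
      show "has_bochner_integral (M1 \<Otimes>\<^sub>M M2) (\<lambda>z. case z of (x, y) \<Rightarrow> u \<tau> x * v \<tau> y)
        ((\<integral>x. u \<tau> x \<partial>M1) * (\<integral>y. v \<tau> y \<partial>M2))" if "\<tau> \<in> T" for \<tau>
        using uv[OF that that] by (simp add: has_bochner_integral_iff)
      show "has_bochner_integral (M1 \<Otimes>\<^sub>M M2) (\<lambda>z. case z of (x, y) \<Rightarrow> (of_bool (\<xi> x = 0) :: complex) * (of_bool (\<eta> y = 0) :: complex))
        ((\<integral>x. of_bool (\<xi> x = 0) \<partial>M1) * (\<integral>y. of_bool (\<eta> y = 0) \<partial>M2))"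
        using zz by (simp only: has_bochner_integral_iff)
    qed
    then show ?thesis
      unfolding u_def v_def sum_distrib_left by (simp add: mult.assoc)
  qed
  finally show "complex_of_real ((\<integral>x. f ((\<xi> x)\<^sup>2) * (\<integral>y. k x y \<partial>M2) \<partial>M1) - e * (\<integral>y. f (b\<^sup>2 * (\<eta> y)\<^sup>2) * (\<integral>x. k x y \<partial>M1) \<partial>M2))
      = - of_real (2 * b) * (\<Sum>\<tau>\<in>T. d \<tau> * ((\<integral>x. 1 / (of_real ((\<xi> x)\<^sup>2) - \<tau>) \<partial>M1) * (\<integral>y. 1 / (- \<tau> - of_real (b\<^sup>2 * (\<eta> y)\<^sup>2)) \<partial>M2)))
        - of_real (2 * b * \<delta>) * (\<integral>x. (of_bool (\<xi> x = 0) :: complex) \<partial>M1) * (\<integral>y. (of_bool (\<eta> y = 0) :: complex) \<partial>M2)" .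
qed

text \<open>The sum x^2 + z^2 factors as (x - i z) (x + i z), and both factors have modulus at least
  Re z. The constant is monotone in |z| and 1 / Re z, so it can be made locally uniform.\<close>

lemma one_plus_square_le:
  fixes x :: real and z :: complex
  assumes z: "Re z > 0"
  shows "1 + x\<^sup>2 \<le> ((1 + (cmod z)\<^sup>2) / (Re z)\<^sup>2 + 1) * cmod ((of_real x)\<^sup>2 + z\<^sup>2)"
proof -
  let ?w = "(complex_of_real x)\<^sup>2 + z\<^sup>2"
  have "?w = (of_real x - \<i> * z) * (of_real x + \<i> * z)" by (simp add: power2_eq_square algebra_simps)
  then have w: "cmod ?w = cmod (of_real x - \<i> * z) * cmod (of_real x + \<i> * z)" by (simp add: norm_mult)
  have "cmod (of_real x - \<i> * z) \<ge> Re z" "cmod (of_real x + \<i> * z) \<ge> Re z"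
    using abs_Im_le_cmod[of "of_real x - \<i> * z"] abs_Im_le_cmod[of "of_real x + \<i> * z"] z by auto
  then have "Re z * Re z \<le> cmod ?w" unfolding w using z by (intro mult_mono) auto
  then have 1: "(Re z)\<^sup>2 \<le> cmod ?w" by (simp add: power2_eq_square)
  have "x\<^sup>2 = cmod ((of_real x)\<^sup>2)" by (simp add: norm_power)
  also have "\<dots> = cmod (?w - z\<^sup>2)" by simp
  also have "\<dots> \<le> cmod ?w + (cmod z)\<^sup>2" using norm_triangle_ineq4[of ?w "z\<^sup>2"] by (simp add: norm_power)
  finally have "1 + x\<^sup>2 \<le> (1 + (cmod z)\<^sup>2) + cmod ?w" by simp
  also have "1 + (cmod z)\<^sup>2 = (1 + (cmod z)\<^sup>2) / (Re z)\<^sup>2 * (Re z)\<^sup>2" using z by simp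
  also have "\<dots> \<le> (1 + (cmod z)\<^sup>2) / (Re z)\<^sup>2 * cmod ?w" using 1 by (intro mult_left_mono) auto
  finally show ?thesis by (simp add: distrib_right)
qed

lemma cmod_inverse_le:
  fixes z :: complex
  assumes z: "Re z > 0"
  shows "cmod (1 / ((of_real x)\<^sup>2 + z\<^sup>2)) \<le> ((1 + (cmod z)\<^sup>2) / (Re z)\<^sup>2 + 1) * (1 / (1 + x\<^sup>2))"
proof -
  have p: "1 + x\<^sup>2 > 0" by (rule add_pos_nonneg) auto
  note le = one_plus_square_le[OF z, of x]
  then have "cmod ((of_real x)\<^sup>2 + z\<^sup>2) \<noteq> 0" using p by (metis mult_zero_right not_less)
  then have "cmod ((of_real x)\<^sup>2 + z\<^sup>2) > 0" by simp
  then show ?thesis unfolding norm_divide using le p by (simp add: divide_le_eq pos_le_divide_eq)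
qed

lemma has_bochner_integral_half_line_real:
  assumes "z > 0" shows "has_bochner_integral half_line (\<lambda>y. 1 / (y\<^sup>2 + z\<^sup>2)) (pi / (2 * z))"
proof -
  have "has_bochner_integral half_line (\<lambda>y. y powr (1 - 1) / (z\<^sup>2 + y\<^sup>2)) (z powr (- 1) * (pi / (2 * sin (pi * 1 / 2))))"
    using assms by (intro has_bochner_integral_powr_rational_scaled) auto
  also have "z powr (- 1) * (pi / (2 * sin (pi * 1 / 2))) = pi / (2 * z)"
  proof -
    have "z powr (- 1) = 1 / z" using assms by (simp add: powr_minus_divide)
    then show ?thesis by simp
  qed
  finally have *: "has_bochner_integral half_line (\<lambda>y. y powr (1 - 1) / (z\<^sup>2 + y\<^sup>2)) (pi / (2 * z))" .
  have e: "y powr (1 - 1) / (z\<^sup>2 + y\<^sup>2) = 1 / (y\<^sup>2 + z\<^sup>2)" if "y \<in> space half_line" for y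
    using that by (simp add: add.commute[of "z\<^sup>2"])
  show ?thesis by (rule has_bochner_integral_cong[THEN iffD1, OF refl e refl *])
qed

lemma integrable_half_line_kernel: "integrable half_line (\<lambda>y. 1 / (1 + y\<^sup>2))"
  using has_bochner_integral_half_line_real[of 1] by (simp add: has_bochner_integral_iff add.commute)

text \<open>The real case is the beta integral at s = 1. The left side is holomorphic in the right
  half plane, so the identity theorem extends the evaluation to complex z.\<close>

lemma has_bochner_integral_half_line:
  fixes z :: complex
  assumes z: "Re z > 0"
  shows "has_bochner_integral half_line (\<lambda>y. 1 / ((complex_of_real y)\<^sup>2 + z\<^sup>2)) (pi / (2 * z))"
proof -
  note i1 = integrable_half_line_kernel
  have int: "integrable half_line (\<lambda>y. 1 / ((complex_of_real y)\<^sup>2 + z\<^sup>2))" if "Re z > 0" for z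
  proof (rule Bochner_Integration.integrable_bound[OF integrable_mult_right[OF i1, of "(1 + (cmod z)\<^sup>2) / (Re z)\<^sup>2 + 1"]])
    show "(\<lambda>y. 1 / ((complex_of_real y)\<^sup>2 + z\<^sup>2)) \<in> borel_measurable half_line"
      by (intro measurable_restrict_space1) measurable
    show "AE y in half_line. norm (1 / ((complex_of_real y)\<^sup>2 + z\<^sup>2)) \<le> norm (((1 + (cmod z)\<^sup>2) / (Re z)\<^sup>2 + 1) * (1 / (1 + y\<^sup>2)))"
      unfolding real_norm_def by (intro AE_I2 order.trans[OF cmod_inverse_le[OF that] abs_ge_self])
  qed
  define F where "F z = (\<integral>y. 1 / ((complex_of_real y)\<^sup>2 + z\<^sup>2) \<partial>half_line)" for z
  let ?S = "{z. Re z > 0}"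
  have nz: "(complex_of_real y)\<^sup>2 + z\<^sup>2 \<noteq> 0" if "Re z > 0" for y z
    using one_plus_square_le[OF that, of y] by (metis add_pos_nonneg less_le_not_le mult_zero_right norm_zero zero_le_power2 zero_less_one)
  have holo: "F holomorphic_on ?S"
    unfolding F_def [abs_def]
  proof (rule holomorphic_integral)
    fix z assume "z \<in> ?S"
    then have z: "Re z > 0" by simp
    define r where "r = Re z / 2"
    define K where "K = (1 + (cmod z + r)\<^sup>2) / r\<^sup>2 + 1"
    have r: "r > 0" using z by (simp add: r_def)
    have "cmod (1 / ((of_real y)\<^sup>2 + w\<^sup>2)) \<le> K * (1 / (1 + y\<^sup>2))" if w: "w \<in> ball z r" for w and y :: real
    proof -
      have "\<bar>Re w - Re z\<bar> < r" by (rule abs_Re_less[OF w])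
      then have "Re w > Re z - r" by linarith
      then have 1: "Re w \<ge> r" by (simp add: r_def)
      have "cmod w \<le> cmod z + cmod (w - z)" by (metis add_diff_cancel_left' diff_add_cancel norm_triangle_ineq)
      also have "\<dots> \<le> cmod z + r" using w by (simp add: dist_norm norm_minus_commute)
      finally have "(1 + (cmod w)\<^sup>2) / (Re w)\<^sup>2 \<le> (1 + (cmod z + r)\<^sup>2) / r\<^sup>2"
        using 1 r by (intro frac_le add_mono power_mono) (auto intro: add_nonneg_nonneg)
      then have "((1 + (cmod w)\<^sup>2) / (Re w)\<^sup>2 + 1) * (1 / (1 + y\<^sup>2)) \<le> K * (1 / (1 + y\<^sup>2))"
        unfolding K_def by (intro mult_right_mono) auto
      then show ?thesis using cmod_inverse_le[of w y] 1 r by linarith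
    qed
    then show "\<exists>r>0. \<exists>g. integrable half_line g \<and> (\<forall>w\<in>ball z r \<inter> ?S. \<forall>y\<in>space half_line. cmod (1 / ((complex_of_real y)\<^sup>2 + w\<^sup>2)) \<le> g y)"
      using r i1 by (intro exI[of _ r] conjI exI[of _ "\<lambda>y. K * (1 / (1 + y\<^sup>2))"] integrable_mult_right) auto
  qed (use nz in \<open>auto intro!: measurable_restrict_space1 holomorphic_intros open_Re_strip\<close>)
  have "F z - of_real pi / (2 * z) = 0"
  proof (rule analytic_continuation[of "\<lambda>z. F z - of_real pi / (2 * z)" ?S "complex_of_real ` {0<..<2}" 1])
    show "(\<lambda>z. F z - of_real pi / (2 * z)) holomorphic_on ?S"
      using holo by (intro holomorphic_intros) auto
    show "connected ?S" by (intro convex_connected convex_halfspace_Re_gt)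
    show "(1::complex) islimpt complex_of_real ` {0<..<2}"
      using islimpt_of_real_interval[of 0 1 2] by simp
    show "F z - of_real pi / (2 * z) = 0" if zz: "z \<in> complex_of_real ` {0<..<2}" for z
    proof -
      obtain x where x: "z = of_real x" "x > 0" using zz by auto
      have "F z = (\<integral>y. complex_of_real (1 / (y\<^sup>2 + x\<^sup>2)) \<partial>half_line)" unfolding F_def x(1) by simp
      also have "\<dots> = of_real (pi / (2 * x))"
        unfolding integral_complex_of_real using has_bochner_integral_half_line_real[OF x(2)]
        by (simp only: has_bochner_integral_iff)
      finally show ?thesis using x by simp
    qed
    show "complex_of_real ` {0<..<2} \<subseteq> ?S" by auto
  qed (use z in \<open>simp_all add: open_Re_strip\<close>)
  then show ?thesis using int[OF z] by (simp add: has_bochner_integral_iff F_def)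
qed

section \<open>The roots as a discrete measure and the signed exchange formula\<close>

context koshliakov begin

text \<open>Sums over the roots become integrals, so that one exchange lemma serves sums and
  Lebesgue integrals alike. Index 0 is included; it places an atom at the origin.\<close>

definition roots_measure :: "nat measure" where
  "roots_measure = density (count_space UNIV) (\<lambda>j. ennreal (mass j))"

lemma measurable_roots_measure [measurable]: "f \<in> borel_measurable roots_measure"
  by (simp add: roots_measure_def)

lemma has_bochner_integral_roots:
  fixes h :: "nat \<Rightarrow> 'b::{banach, second_countable_topology}"
  assumes "summable (\<lambda>j. mass j * norm (h j))"
  shows "has_bochner_integral roots_measure h (\<Sum>j. mass j *\<^sub>R h j)"
proof -
  have "integrable (count_space UNIV) (\<lambda>j. mass j *\<^sub>R h j)"
    using assms by (simp add: integrable_count_space_nat_iff less_imp_le[OF mass_pos])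
  then show ?thesis
    using mass_pos unfolding has_bochner_integral_iff roots_measure_def
    by (subst integrable_density integral_density, auto intro: less_imp_le simp: integral_count_space_nat)+
qed

lemma integral_roots:
  fixes h :: "nat \<Rightarrow> 'b::{banach, second_countable_topology}"
  assumes "integrable roots_measure h"
  shows "summable (\<lambda>j. mass j * norm (h j))" "(\<integral>j. h j \<partial>roots_measure) = (\<Sum>j. mass j *\<^sub>R h j)"
proof -
  have "integrable (count_space UNIV) (\<lambda>j. mass j *\<^sub>R h j)"
    using assms mass_pos unfolding roots_measure_def
    by (subst (asm) integrable_density) (auto intro: less_imp_le)
  then show "summable (\<lambda>j. mass j * norm (h j))"
    by (simp add: integrable_count_space_nat_iff less_imp_le[OF mass_pos])
  then show "(\<integral>j. h j \<partial>roots_measure) = (\<Sum>j. mass j *\<^sub>R h j)"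
    using has_bochner_integral_roots by (auto simp: has_bochner_integral_iff)
qed

lemma sigma_finite_roots: "sigma_finite_measure roots_measure"
proof -
  interpret sigma_finite_measure "count_space (UNIV :: nat set)"
    by (rule sigma_finite_measure_count_space)
  show ?thesis unfolding roots_measure_def by (subst sigma_finite_iff_density_finite) auto
qed

lemma summable_roots: "summable (\<lambda>j. mass j * (1 / (1 + (root j)\<^sup>2)))"
  by (rule summable_Suc_iff[THEN iffD1]) (use summable_q[of 1] in \<open>simp add: mass_def add.commute\<close>)

lemma integrable_roots: "integrable roots_measure (\<lambda>j. 1 / (1 + (root j)\<^sup>2))"
  using has_bochner_integral_roots[of "\<lambda>j. 1 / (1 + (root j)\<^sup>2)"] summable_roots
  by (simp add: has_bochner_integral_iff)

lemma has_bochner_integral_roots_kernel: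
  fixes z :: complex
  assumes z: "Re z > 0"
  shows "has_bochner_integral roots_measure (\<lambda>j. 1 / ((complex_of_real (root j))\<^sup>2 + z\<^sup>2)) (pi / (2 * z) * (1 + 2 * phi z))"
proof -
  let ?K = "(1 + (cmod z)\<^sup>2) / (Re z)\<^sup>2 + 1"
  have "summable (\<lambda>j. mass j * norm (1 / ((complex_of_real (root j))\<^sup>2 + z\<^sup>2)))"
  proof (rule summable_comparison_test'[OF summable_mult[OF summable_roots, of ?K], where N=0])
    fix j
    have "mass j * norm (1 / ((complex_of_real (root j))\<^sup>2 + z\<^sup>2)) \<le> mass j * (?K * (1 / (1 + (root j)\<^sup>2)))"
      by (intro mult_left_mono cmod_inverse_le z less_imp_le mass_pos)
    then show "norm (mass j * norm (1 / ((complex_of_real (root j))\<^sup>2 + z\<^sup>2))) \<le> ?K * (mass j * (1 / (1 + (root j)\<^sup>2)))"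
      using mass_pos[of j] by (simp add: abs_mult mult_ac)
  qed
  from has_bochner_integral_roots[OF this] partial_fractions[OF z]
  show ?thesis by (simp add: sums_iff scaleR_conv_of_real)
qed

lemma has_bochner_integral_roots_kernel_real:
  assumes z: "z > 0"
  shows "has_bochner_integral roots_measure (\<lambda>j. 1 / ((root j)\<^sup>2 + z\<^sup>2)) (pi / (2 * z) * (1 + 2 * phir z))"
proof -
  have "has_bochner_integral roots_measure (\<lambda>j. complex_of_real (1 / ((root j)\<^sup>2 + z\<^sup>2))) (of_real (pi / (2 * z) * (1 + 2 * phir z)))"
    using has_bochner_integral_roots_kernel[of "of_real z"] z by (simp add: phi_of_real)
  from has_bochner_integral_bounded_linear[OF bounded_linear_Re this] show ?thesis by simp
qed

text \<open>The functional obtained by integrating against the signed measure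
  \<open>\<Sum>\<^sub>j mass j \<delta>\<^bsub>root j\<^esub> - dx\<close> on \<open>[0, \<infinity>)\<close>.\<close>

definition signed_integral :: "(real \<Rightarrow> 'b) \<Rightarrow> 'b::{banach, second_countable_topology}" where
  "signed_integral h = (\<integral>j. h (root j) \<partial>roots_measure) - (\<integral>y. h y \<partial>half_line)"

text \<open>The Lebesgue part removes exactly the 1 in 1 + 2 phi.\<close>

lemma signed_integral_kernel:
  fixes z :: complex
  assumes "Re z > 0"
  shows "signed_integral (\<lambda>x. 1 / ((complex_of_real x)\<^sup>2 + z\<^sup>2)) = pi / z * phi z"
proof -
  have "z \<noteq> 0" using assms by auto
  moreover have "signed_integral (\<lambda>x. 1 / ((complex_of_real x)\<^sup>2 + z\<^sup>2)) = pi / (2 * z) * (1 + 2 * phi z) - pi / (2 * z)"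
    using has_bochner_integral_roots_kernel[OF assms] has_bochner_integral_half_line[OF assms]
    unfolding signed_integral_def by (simp only: has_bochner_integral_iff)
  ultimately show ?thesis by (simp add: field_simps)
qed

text \<open>Bilinear combination of \<open>exchange_kernel\<close> for the four pairs formed from
  the roots measure and Lebesgue measure. In the inner variable the difference of the two measures
  turns the kernel into a value of \<open>phir\<close>.\<close>

lemma exchange_signed:
  fixes f :: "real \<Rightarrow> real" and d :: "complex \<Rightarrow> complex"
  assumes m: "f \<in> borel_measurable borel"
    and T: "finite T" "\<And>\<tau>. \<tau> \<in> T \<Longrightarrow> Im \<tau> \<noteq> 0"
    and f: "\<And>X. of_real (f X) = (\<Sum>\<tau>\<in>T. d \<tau> / (of_real X - \<tau>))"
    and par: "\<And>X. f (- X) = e * f X" and b: "b > 0"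
    and fb: "\<And>X. X \<ge> 0 \<Longrightarrow> \<bar>f X\<bar> \<le> C * (X / (1 + X\<^sup>2))"
    and \<delta>: "(\<Sum>\<tau>\<in>T. d \<tau> / \<tau>\<^sup>2) = - of_real \<delta>"
  shows "complex_of_real (signed_integral (\<lambda>x. f (x\<^sup>2) * (2 * pi / x * phir (x / b)))
           - e * signed_integral (\<lambda>y. f (b\<^sup>2 * y\<^sup>2) * (2 * pi / y * phir (b * y))))
    = - of_real (2 * b) * (\<Sum>\<tau>\<in>T. d \<tau> * (signed_integral (\<lambda>x. 1 / (of_real (x\<^sup>2) - \<tau>)) *
          signed_integral (\<lambda>y. 1 / (- \<tau> - of_real (b\<^sup>2 * y\<^sup>2))))) - of_real (2 * b * \<delta> * (mass 0)\<^sup>2)"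
proof -
  let ?P = roots_measure and ?L = half_line
  have root_cases: "root j = 0 \<or> root j > 0" for j by (cases j) auto
  \<comment> \<open>Needed at the atom: there 2 pi / x has only its default value, and the factor f
    makes both forms of the integrand zero.\<close>
  have f0: "f 0 = 0" using fb[of 0] by simp
  have sP: "sigma_finite_measure ?P" by (rule sigma_finite_roots)
  have sL: "sigma_finite_measure ?L"
    by (rule sigma_finite_measure_restrict_space) (auto simp: lborel.sigma_finite_measure_axioms)
  note iL = integrable_half_line_kernel
  have mL: "(\<lambda>y. y) \<in> borel_measurable ?L" by (auto intro!: measurable_restrict_space1)
  have mP: "root \<in> borel_measurable ?P" by measurable
  define JP where "JP x = (\<integral>j. 2 * b / (x\<^sup>2 + b\<^sup>2 * (root j)\<^sup>2) \<partial>?P)" for x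
  define JL where "JL x = (\<integral>y. 2 * b / (x\<^sup>2 + b\<^sup>2 * y\<^sup>2) \<partial>?L)" for x
  define KP where "KP y = (\<integral>j. 2 * b / ((root j)\<^sup>2 + b\<^sup>2 * y\<^sup>2) \<partial>?P)" for y
  define KL where "KL y = (\<integral>x. 2 * b / (x\<^sup>2 + b\<^sup>2 * y\<^sup>2) \<partial>?L)" for y
  have k1: "2 * b / (x\<^sup>2 + b\<^sup>2 * r\<^sup>2) = 2 / b * (1 / (r\<^sup>2 + (x / b)\<^sup>2))" for x r
  proof -
    have "x\<^sup>2 + b\<^sup>2 * r\<^sup>2 = b\<^sup>2 * (r\<^sup>2 + (x / b)\<^sup>2)" using b by (simp add: power_divide distrib_left)
    then show ?thesis using b by (simp add: power2_eq_square)
  qed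
  have k2: "2 * b / (r\<^sup>2 + b\<^sup>2 * y\<^sup>2) = 2 * b * (1 / (r\<^sup>2 + (b * y)\<^sup>2))" for y r
    by (simp add: power_mult_distrib)
  have J: "JP x - JL x = 2 * pi / x * phir (x / b)" if "x > 0" for x
  proof -
    have "x / b > 0" using that b by simp
    then have "JP x = 2 / b * (pi / (2 * (x / b)) * (1 + 2 * phir (x / b)))" "JL x = 2 / b * (pi / (2 * (x / b)))"
      using has_bochner_integral_roots_kernel_real[of "x / b"] has_bochner_integral_half_line_real[of "x / b"]
      unfolding JP_def JL_def k1 integral_mult_right_zero by (simp_all only: has_bochner_integral_iff)
    moreover have "2 / b * (pi / (2 * (x / b)) * (1 + 2 * t)) - 2 / b * (pi / (2 * (x / b))) = 2 * pi / x * t" for t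
      using that b by (simp add: field_simps)
    ultimately show ?thesis by simp
  qed
  have K: "KP y - KL y = 2 * pi / y * phir (b * y)" if "y > 0" for y
  proof -
    have "b * y > 0" using that b by simp
    then have "KP y = 2 * b * (pi / (2 * (b * y)) * (1 + 2 * phir (b * y)))" "KL y = 2 * b * (pi / (2 * (b * y)))"
      using has_bochner_integral_roots_kernel_real[of "b * y"] has_bochner_integral_half_line_real[of "b * y"]
      unfolding KP_def KL_def k2 integral_mult_right_zero by (simp_all only: has_bochner_integral_iff)
    moreover have "2 * b * (pi / (2 * (b * y)) * (1 + 2 * t)) - 2 * b * (pi / (2 * (b * y))) = 2 * pi / y * t" for t
      using that b by (simp add: field_simps)
    ultimately show ?thesis by simp
  qed
  note ex = exchange_kernel[where f=f and d=d and T=T and e=e and b=b and C=C and \<delta>=\<delta>, OF _ _ _ _ m _ _ T f par b fb \<delta>]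
  \<comment> \<open>P stands for the roots measure and L for Lebesgue measure; the first letter
    belongs to x, the second to y.\<close>
  note PP = ex[OF sP sP mP mP integrable_roots integrable_roots]
    and PL = ex[OF sP sL mP mL integrable_roots iL]
    and LP = ex[OF sL sP mL mP iL integrable_roots]
    and LL = ex[OF sL sL mL mL iL iL]
  define U where "U \<tau> x = 1 / (complex_of_real (x\<^sup>2) - \<tau>)" for \<tau> x
  define V where "V \<tau> y = 1 / (- \<tau> - complex_of_real (b\<^sup>2 * y\<^sup>2))" for \<tau> y
  note fold = JP_def[symmetric] JL_def[symmetric] KP_def[symmetric] KL_def[symmetric] U_def[symmetric] V_def[symmetric]
  have W1: "signed_integral (\<lambda>x. f (x\<^sup>2) * (2 * pi / x * phir (x / b))) =
    ((\<integral>j. f ((root j)\<^sup>2) * JP (root j) \<partial>?P) - (\<integral>j. f ((root j)\<^sup>2) * JL (root j) \<partial>?P))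
    - ((\<integral>x. f (x\<^sup>2) * JP x \<partial>?L) - (\<integral>x. f (x\<^sup>2) * JL x \<partial>?L))"
  proof -
    have "(\<integral>j. f ((root j)\<^sup>2) * (2 * pi / root j * phir (root j / b)) \<partial>?P)
      = (\<integral>j. f ((root j)\<^sup>2) * JP (root j) - f ((root j)\<^sup>2) * JL (root j) \<partial>?P)"
    proof (intro Bochner_Integration.integral_cong refl)
      fix j
      show "f ((root j)\<^sup>2) * (2 * pi / root j * phir (root j / b)) = f ((root j)\<^sup>2) * JP (root j) - f ((root j)\<^sup>2) * JL (root j)"
      proof (cases "root j = 0")
        case True then show ?thesis using f0 by simp
      next
        case False
        then have "root j > 0" using root_cases by blast
        then show ?thesis by (simp only: J[symmetric] right_diff_distrib)
      qed
    qed
    moreover have "(\<integral>x. f (x\<^sup>2) * (2 * pi / x * phir (x / b)) \<partial>?L) = (\<integral>x. f (x\<^sup>2) * JP x - f (x\<^sup>2) * JL x \<partial>?L)"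
      using J by (intro Bochner_Integration.integral_cong refl) (simp flip: right_diff_distrib)
    ultimately show ?thesis
      unfolding signed_integral_def using PP(1) PL(1) LP(1) LL(1) unfolding fold by simp
  qed
  have W2: "signed_integral (\<lambda>y. f (b\<^sup>2 * y\<^sup>2) * (2 * pi / y * phir (b * y))) =
    ((\<integral>j. f (b\<^sup>2 * (root j)\<^sup>2) * KP (root j) \<partial>?P) - (\<integral>j. f (b\<^sup>2 * (root j)\<^sup>2) * KL (root j) \<partial>?P))
    - ((\<integral>y. f (b\<^sup>2 * y\<^sup>2) * KP y \<partial>?L) - (\<integral>y. f (b\<^sup>2 * y\<^sup>2) * KL y \<partial>?L))"
  proof -
    have "(\<integral>j. f (b\<^sup>2 * (root j)\<^sup>2) * (2 * pi / root j * phir (b * root j)) \<partial>?P)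
      = (\<integral>j. f (b\<^sup>2 * (root j)\<^sup>2) * KP (root j) - f (b\<^sup>2 * (root j)\<^sup>2) * KL (root j) \<partial>?P)"
    proof (intro Bochner_Integration.integral_cong refl)
      fix j
      show "f (b\<^sup>2 * (root j)\<^sup>2) * (2 * pi / root j * phir (b * root j)) = f (b\<^sup>2 * (root j)\<^sup>2) * KP (root j) - f (b\<^sup>2 * (root j)\<^sup>2) * KL (root j)"
      proof (cases "root j = 0")
        case True then show ?thesis using f0 by simp
      next
        case False
        then have "root j > 0" using root_cases by blast
        then show ?thesis by (simp only: K[symmetric] right_diff_distrib)
      qed
    qed
    moreover have "(\<integral>y. f (b\<^sup>2 * y\<^sup>2) * (2 * pi / y * phir (b * y)) \<partial>?L) = (\<integral>y. f (b\<^sup>2 * y\<^sup>2) * KP y - f (b\<^sup>2 * y\<^sup>2) * KL y \<partial>?L)"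
      using K by (intro Bochner_Integration.integral_cong refl) (simp flip: right_diff_distrib)
    ultimately show ?thesis
      unfolding signed_integral_def using PP(2) PL(2) LP(2) LL(2) unfolding fold by simp
  qed
  \<comment> \<open>Only the roots measure charges the origin, so the correction with \<delta>
    survives in the pair PP alone and carries the square of the mass.\<close>
  have ZP: "(\<integral>j. (of_bool (root j = 0) :: complex) \<partial>?P) = of_real (mass 0)"
  proof -
    have e: "(of_bool (root j = 0) :: complex) = (if j = 0 then 1 else 0)" for j by (cases j) auto
    have "(\<lambda>j. mass j *\<^sub>R (if j = 0 then 1 else 0 :: complex)) sums (mass 0 *\<^sub>R 1)"
      using sums_single[of 0 "\<lambda>j. mass j *\<^sub>R (1::complex)"] by (simp add: if_distrib cong: if_cong)
    moreover have "summable (\<lambda>j. mass j * norm (if j = 0 then 1 else 0 :: complex))"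
      by (rule summable_finite[of "{0}"]) auto
    ultimately show ?thesis unfolding e
      using has_bochner_integral_roots[of "\<lambda>j. if j = 0 then 1 else 0 :: complex"]
      by (simp add: has_bochner_integral_iff sums_iff scaleR_conv_of_real)
  qed
  have ZL: "(\<integral>y. (of_bool (y = 0) :: complex) \<partial>?L) = 0"
    by (rule integral_eq_zero_AE) (auto intro!: AE_I2)
  have alg: "(\<Sum>\<tau>\<in>T. d \<tau> * ((u1 \<tau> - u2 \<tau>) * (v1 \<tau> - v2 \<tau>))) =
    (\<Sum>\<tau>\<in>T. d \<tau> * (u1 \<tau> * v1 \<tau>)) - (\<Sum>\<tau>\<in>T. d \<tau> * (u1 \<tau> * v2 \<tau>)) - (\<Sum>\<tau>\<in>T. d \<tau> * (u2 \<tau> * v1 \<tau>)) + (\<Sum>\<tau>\<in>T. d \<tau> * (u2 \<tau> * v2 \<tau>))"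
    for u1 u2 v1 v2 :: "complex \<Rightarrow> complex"
    by (simp add: algebra_simps sum.distrib sum_subtractf)
  have comb: "complex_of_real (((aPP - aPL) - (aLP - aLL)) - e * ((cPP - cLP) - (cPL - cLL))) = - B * (SPP - SPL - SLP + SLL) - D"
    if "complex_of_real (aPP - e * cPP) = - B * SPP - D" "complex_of_real (aPL - e * cPL) = - B * SPL"
      "complex_of_real (aLP - e * cLP) = - B * SLP" "complex_of_real (aLL - e * cLL) = - B * SLL"
    for aPP aPL aLP aLL cPP cPL cLP cLL :: real and B SPP SPL SLP SLL D :: complex
  proof -
    have "complex_of_real (((aPP - aPL) - (aLP - aLL)) - e * ((cPP - cLP) - (cPL - cLL))) =
      of_real (aPP - e * cPP) - of_real (aPL - e * cPL) - of_real (aLP - e * cLP) + of_real (aLL - e * cLL)"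
      by (simp add: algebra_simps)
    also have "\<dots> = - B * (SPP - SPL - SLP + SLL) - D" unfolding that by (simp add: algebra_simps)
    finally show ?thesis .
  qed
  have D: "complex_of_real (2 * b * \<delta>) * complex_of_real (mass 0) * complex_of_real (mass 0) = of_real (2 * b * \<delta> * (mass 0)\<^sup>2)"
    by (simp add: power2_eq_square)
  show ?thesis
    unfolding W1 W2 U_def[symmetric] V_def[symmetric] signed_integral_def alg
    by (rule comb; (rule PP(3)[unfolded fold ZP D] PL(3)[unfolded fold ZL mult_zero_right diff_zero]
          LP(3)[unfolded fold ZL mult_zero_left mult_zero_right diff_zero] LL(3)[unfolded fold ZL mult_zero_right diff_zero]))
qed

end

text \<open>The regularised powers tend to \<open>X ^ n\<close> as \<open>u\<close> grows, but decay like \<open>1 / X\<^sup>2\<close> at infinity and have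
  the parity of \<open>X ^ n\<close>. Their poles \<open>\<plusminus> \<i> u l\<close> are simple and not real.\<close>

definition regularised_power :: "nat \<Rightarrow> real \<Rightarrow> real \<Rightarrow> real" where
  "regularised_power n u X = (fact (Suc n))\<^sup>2 * X ^ n / (\<Prod>l=1..Suc n. (X / u)\<^sup>2 + (real l)\<^sup>2)"

text \<open>The denominator of \<open>regularised_power\<close> tends to this product as u grows,
  which explains its normalising factor.\<close>

lemma prod_squares: "(\<Prod>l=1..N. (real l)\<^sup>2) = (fact N)\<^sup>2"
  by (induction N) (simp_all add: power_mult_distrib mult.commute)

text \<open>The first bound makes X^n a majorant that is uniform in u; the second provides the decay
  at infinity for fixed u.\<close>

lemma regularised_prod_ge:
  "(\<Prod>l=1..N. (X / u)\<^sup>2 + (real l)\<^sup>2) \<ge> (fact N)\<^sup>2"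
  "(\<Prod>l=1..N. (X / u)\<^sup>2 + (real l)\<^sup>2) \<ge> ((X / u)\<^sup>2 + 1) ^ N"
proof -
  have "(\<Prod>l=1..N. (real l)\<^sup>2) \<le> (\<Prod>l=1..N. (X / u)\<^sup>2 + (real l)\<^sup>2)" by (intro prod_mono) auto
  then show "(\<Prod>l=1..N. (X / u)\<^sup>2 + (real l)\<^sup>2) \<ge> (fact N)\<^sup>2" unfolding prod_squares .
  have "(\<Prod>l=1..N. (X / u)\<^sup>2 + 1) \<le> (\<Prod>l=1..N. (X / u)\<^sup>2 + (real l)\<^sup>2)"
    by (intro prod_mono) (auto simp: one_le_power intro!: add_nonneg_nonneg)
  then show "(\<Prod>l=1..N. (X / u)\<^sup>2 + (real l)\<^sup>2) \<ge> ((X / u)\<^sup>2 + 1) ^ N" by simp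
qed

lemma regularised_prod_pos: "(\<Prod>l=1..N. (X / u)\<^sup>2 + (real l)\<^sup>2) > 0"
  using regularised_prod_ge(1)[where N=N] by (rule less_le_trans[rotated]) simp

lemma borel_measurable_regularised [measurable]: "regularised_power n u \<in> borel_measurable borel"
  unfolding regularised_power_def [abs_def] by measurable

lemma regularised_power_minus: "regularised_power n u (- X) = (- 1) ^ n * regularised_power n u X"
  by (simp add: regularised_power_def power_minus[of X])

lemma regularised_power_le: "X \<ge> 0 \<Longrightarrow> regularised_power n u X \<le> X ^ n" "X \<ge> 0 \<Longrightarrow> regularised_power n u X \<ge> 0"
proof -
  assume X: "X \<ge> 0"
  show "regularised_power n u X \<ge> 0"
    unfolding regularised_power_def using X regularised_prod_pos[of X u "Suc n"] by (intro divide_nonneg_pos mult_nonneg_nonneg) auto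
  have "(fact (Suc n))\<^sup>2 * X ^ n \<le> (\<Prod>l=1..Suc n. (X / u)\<^sup>2 + (real l)\<^sup>2) * X ^ n"
    using X by (intro mult_right_mono regularised_prod_ge) auto
  then show "regularised_power n u X \<le> X ^ n"
    unfolding regularised_power_def using regularised_prod_pos[of X u "Suc n"]
    by (simp only: pos_divide_le_eq mult.commute)
qed

lemma regularised_power_tendsto: "(\<lambda>k. regularised_power n (real (Suc k)) X) \<longlonglongrightarrow> X ^ n"
proof -
  have 1: "(\<lambda>k. X / real (Suc k)) \<longlonglongrightarrow> 0"
    by (rule LIMSEQ_Suc[OF lim_const_over_n])
  have "(\<lambda>k. regularised_power n (real (Suc k)) X) \<longlonglongrightarrow> (fact (Suc n))\<^sup>2 * X ^ n / (\<Prod>l=1..Suc n. 0\<^sup>2 + (real l)\<^sup>2)"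
    unfolding regularised_power_def
    by (intro tendsto_intros 1) (simp del: prod.cl_ivl_Suc)
  also have "(\<Prod>l=1..Suc n. 0\<^sup>2 + (real l)\<^sup>2) = (fact (Suc n))\<^sup>2"
    using prod_squares[of "Suc n"] by simp
  finally show ?thesis by simp
qed

text \<open>The growth condition of the exchange formula. The factor X at the origin is where n >= 1
  enters. The constant may depend on u, because the exchange is carried out for each u
  separately.\<close>

lemma regularised_power_bound:
  assumes n: "n \<ge> 1" and u: "u \<ge> 1" and X: "X \<ge> 0"
  shows "\<bar>regularised_power n u X\<bar> \<le> ((fact (Suc n))\<^sup>2 * (u\<^sup>2) ^ Suc n) * (X / (1 + X\<^sup>2))"
proof -
  define D where "D = (\<Prod>l=1..Suc n. (X / u)\<^sup>2 + (real l)\<^sup>2)"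
  have D: "D > 0" unfolding D_def by (rule regularised_prod_pos)
  have p: "1 + X\<^sup>2 > 0" by (rule add_pos_nonneg) auto
  have "(1 + X\<^sup>2) / u\<^sup>2 \<le> (X / u)\<^sup>2 + 1"
    using u by (simp add: power_divide add_divide_distrib one_le_power)
  then have "((1 + X\<^sup>2) / u\<^sup>2) ^ Suc n \<le> ((X / u)\<^sup>2 + 1) ^ Suc n"
    by (intro power_mono) (auto intro: divide_nonneg_nonneg)
  also have "\<dots> \<le> D" unfolding D_def by (rule regularised_prod_ge)
  finally have D1: "(1 + X\<^sup>2) ^ Suc n \<le> (u\<^sup>2) ^ Suc n * D"
    using u by (simp only: power_divide) (simp add: pos_divide_le_eq mult.commute)
  have "X \<le> 1 + X\<^sup>2"
  proof -
    have "0 \<le> (X - 1/2)\<^sup>2" by simp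
    then show ?thesis by (simp add: power2_eq_square algebra_simps)
  qed
  then have "X ^ (n - 1) \<le> (1 + X\<^sup>2) ^ (n - 1)" using X by (intro power_mono) auto
  also have "\<dots> \<le> (1 + X\<^sup>2) ^ n" by (intro power_increasing) auto
  finally have "X * X ^ (n - 1) \<le> X * (1 + X\<^sup>2) ^ n" using X by (intro mult_left_mono)
  then have "X ^ n \<le> X * (1 + X\<^sup>2) ^ n" using n by (simp add: power_eq_if)
  then have "X ^ n * (1 + X\<^sup>2) \<le> X * (1 + X\<^sup>2) ^ n * (1 + X\<^sup>2)" using p by (intro mult_right_mono) auto
  also have "\<dots> = X * (1 + X\<^sup>2) ^ Suc n" by simp
  also have "\<dots> \<le> X * ((u\<^sup>2) ^ Suc n * D)" using D1 X by (intro mult_left_mono)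
  finally have "X ^ n / D \<le> (u\<^sup>2) ^ Suc n * (X / (1 + X\<^sup>2))"
    using D p by (simp add: field_simps)
  then have "(fact (Suc n))\<^sup>2 * (X ^ n / D) \<le> (fact (Suc n))\<^sup>2 * ((u\<^sup>2) ^ Suc n * (X / (1 + X\<^sup>2)))"
    by (intro mult_left_mono) auto
  moreover have "\<bar>regularised_power n u X\<bar> = (fact (Suc n))\<^sup>2 * (X ^ n / D)"
    unfolding abs_of_nonneg[OF regularised_power_le(2)[OF X, of n u]]
    by (simp only: regularised_power_def D_def times_divide_eq_right)
  ultimately show ?thesis by (simp only: mult.assoc)
qed

text \<open>The decomposition is made once in X / u, so the poles r = +-i l and the coefficients c
  do not depend on u, and scaling back costs u^(n+1). The last sum is minus the derivative at 0 of
  the function with u = 1, which is 1 for n = 1 and 0 otherwise; 0^(n-1) encodes this.\<close>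

lemma regularised_power_partial_fractions:
  assumes n: "n \<ge> 1"
  obtains A :: "complex set" and c :: "complex \<Rightarrow> complex"
  where "finite A" "\<And>r. r \<in> A \<Longrightarrow> Re r = 0 \<and> r \<noteq> 0"
    "\<And>u X. u > 0 \<Longrightarrow> of_real (regularised_power n u X) = (\<Sum>r\<in>A. of_real u ^ Suc n * c r / (of_real X - of_real u * r))"
    "(\<Sum>r\<in>A. c r / r\<^sup>2) = - (0 ^ (n - 1))"
proof -
  define N where "N = Suc n"
  define A1 A2 where "A1 = (\<lambda>l. \<i> * of_nat l) ` {1..N}" and "A2 = (\<lambda>l. - (\<i> * of_nat l)) ` {1..N}"
  define A where "A = A1 \<union> A2"
  have fin: "finite A1" "finite A2" "finite A" by (auto simp: A_def A1_def A2_def)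
  have dj: "A1 \<inter> A2 = {}" by (auto simp: A1_def A2_def complex_eq_iff)
  have inj: "inj_on (\<lambda>l. \<i> * of_nat l) {1..N}" "inj_on (\<lambda>l. - (\<i> * of_nat l)) {1..N}"
    by (auto simp: inj_on_def)
  have im: "Re r = 0 \<and> r \<noteq> 0" if "r \<in> A" for r using that by (auto simp: A_def A1_def A2_def)
  have card: "card A = N + N"
    unfolding A_def using dj fin inj by (subst card_Un_disjoint) (auto simp: A1_def A2_def card_image)
  have prod: "(\<Prod>r\<in>A. (x - r)) = (\<Prod>l=1..N. x\<^sup>2 + (of_nat l)\<^sup>2)" for x :: complex
  proof -
    have "(\<Prod>r\<in>A. (x - r)) = (\<Prod>l=1..N. (x - \<i> * of_nat l)) * (\<Prod>l=1..N. (x - - (\<i> * of_nat l)))"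
      unfolding A_def using dj fin inj
      by (subst prod.union_disjoint) (simp_all add: A1_def A2_def prod.reindex del: diff_minus_eq_add)
    also have "\<dots> = (\<Prod>l=1..N. x\<^sup>2 + (of_nat l)\<^sup>2)"
      unfolding prod.distrib[symmetric] by (intro prod.cong refl) (simp add: power2_eq_square algebra_simps)
    finally show ?thesis .
  qed
  have "A \<noteq> {}" "n < card A" using card by (auto simp: N_def A_def A1_def)
  from partial_fraction_distinct[OF fin(3) this] obtain c0
    where c0: "\<And>x. x \<notin> A \<Longrightarrow> x ^ n / (\<Prod>r\<in>A. (x - r)) = (\<Sum>r\<in>A. c0 r / (x - r))" by blast
  define F :: complex where "F = (fact N)\<^sup>2"
  define c where "c r = F * c0 r" for r
  show ?thesis
  proof (rule that[of A c])
    fix u X :: real assume u: "u > 0"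
    define x where "x = complex_of_real (X / u)"
    have xA: "x \<notin> A"
    proof
      assume "x \<in> A"
      then have "Re x = 0" "x \<noteq> 0" using im by auto
      then show False by (simp add: x_def complex_eq_iff)
    qed
    have "complex_of_real (regularised_power n u X) = F * of_real X ^ n / (\<Prod>r\<in>A. (x - r))"
      unfolding prod regularised_power_def x_def F_def N_def by simp
    also have "of_real X ^ n = of_real u ^ n * x ^ n" using u by (simp add: x_def power_divide)
    also have "F * (of_real u ^ n * x ^ n) / (\<Prod>r\<in>A. (x - r)) = of_real u ^ n * (F * (x ^ n / (\<Prod>r\<in>A. (x - r))))"
      by simp
    also have "\<dots> = (\<Sum>r\<in>A. of_real u ^ n * (c r / (x - r)))"
      unfolding c0[OF xA] by (simp add: sum_distrib_left c_def)
    also have "\<dots> = (\<Sum>r\<in>A. of_real u ^ Suc n * c r / (of_real X - of_real u * r))"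
    proof (intro sum.cong refl)
      fix r assume "r \<in> A"
      have "of_real X - of_real u * r = of_real u * (x - r)" using u by (simp add: x_def right_diff_distrib)
      then show "of_real u ^ n * (c r / (x - r)) = of_real u ^ Suc n * c r / (of_real X - of_real u * r)"
        using u by simp
    qed
    finally show "complex_of_real (regularised_power n u X) = \<dots>" .
  next
    \<comment> \<open>The fraction is x h(x), so its derivative at 0 is h(0); differentiating the
      partial fractions termwise gives the other expression for it.\<close>
    define h where "h x = x ^ (n - 1) / (\<Prod>r\<in>A. (x - r))" for x
    have A0: "0 \<notin> A" using im by auto
    have p0: "(\<Prod>r\<in>A. (0 - r)) \<noteq> 0" using A0 fin by (auto simp: prod_zero_iff)
    have "h field_differentiable (at 0)"
      unfolding h_def using p0 fin
      by (intro field_differentiable_divide field_differentiable_power field_differentiable_ident holomorphic_on_imp_differentiable_at[of _ UNIV] holomorphic_intros) auto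
    then obtain h' where h': "(h has_field_derivative h') (at 0)" by (auto simp: field_differentiable_def)
    have "((\<lambda>x. x * h x) has_field_derivative (0 * h' + 1 * h 0)) (at 0)"
      by (rule DERIV_mult'[OF DERIV_ident h'])
    then have d1: "((\<lambda>x. x * h x) has_field_derivative h 0) (at 0)" by simp
    have "((\<lambda>x. \<Sum>r\<in>A. c0 r / (x - r)) has_field_derivative (\<Sum>r\<in>A. - c0 r / (0 - r)\<^sup>2)) (at 0)"
      using A0 by (auto intro!: derivative_eq_intros sum.cong simp: power2_eq_square)
    moreover have "open (- A)" using fin by (simp add: finite_imp_closed open_Compl)
    moreover have "(\<Sum>r\<in>A. c0 r / (x - r)) = x * h x" if "x \<in> - A" for x
      using c0[of x] that n unfolding h_def by (simp add: power_eq_if)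
    ultimately have "((\<lambda>x. x * h x) has_field_derivative (\<Sum>r\<in>A. - c0 r / (0 - r)\<^sup>2)) (at 0)"
      using A0 by (auto intro: has_field_derivative_transform_within_open[of _ _ _ "- A"])
    from DERIV_unique[OF this d1] have "h 0 = - (\<Sum>r\<in>A. c0 r / r\<^sup>2)" by (simp add: sum_negf)
    moreover have "(\<Prod>r\<in>A. (0 - r)) = F"
    proof -
      have "(\<Prod>r\<in>A. (0 - r)) = of_real (\<Prod>l=1..N. (real l)\<^sup>2)" unfolding prod by simp
      then show ?thesis unfolding prod_squares F_def by simp
    qed
    then have "F * h 0 = 0 ^ (n - 1)" using p0 by (simp add: h_def)
    moreover have "(\<Sum>r\<in>A. c r / r\<^sup>2) = F * (\<Sum>r\<in>A. c0 r / r\<^sup>2)" by (simp add: c_def sum_distrib_left)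
    ultimately show "(\<Sum>r\<in>A. c r / r\<^sup>2) = - (0 ^ (n - 1))" by (metis minus_minus mult_minus_right)
  qed (use fin im in auto)
qed

text \<open>The inequality t <= exp(t) at t = a x / m, raised to the power m.\<close>

lemma power_le_exp:
  fixes x a :: real
  assumes "x \<ge> 0" "a > 0"
  shows "x ^ m \<le> (real m / a) ^ m * exp (a * x)"
proof (cases "m = 0")
  case True
  then show ?thesis using assms by simp
next
  case False
  have "a * x / real m \<le> exp (a * x / real m)" using exp_ge_add_one_self[of "a * x / real m"] by linarith
  then have "(a * x / real m) ^ m \<le> exp (a * x / real m) ^ m" using assms by (intro power_mono) auto
  also have "\<dots> = exp (a * x)" using False by (simp flip: exp_of_nat_mult)
  finally have "(real m / a) ^ m * (a * x / real m) ^ m \<le> (real m / a) ^ m * exp (a * x)"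
    using assms by (intro mult_left_mono) auto
  then show ?thesis using False assms by (simp flip: power_mult_distrib)
qed

lemma integral_half_line_scale:
  fixes h :: "real \<Rightarrow> real"
  assumes "c > 0" shows "(\<integral>y. h (c * y) \<partial>half_line) = (\<integral>y. h y \<partial>half_line) / c"
proof -
  have "(\<integral>y. indicator {0<..} y *\<^sub>R h y \<partial>lborel) = \<bar>c\<bar> *\<^sub>R (\<integral>y. indicator {0<..} (0 + c * y) *\<^sub>R h (0 + c * y) \<partial>lborel)"
    using assms by (intro lborel_integral_real_affine) auto
  also have "(\<lambda>y. indicator {0<..} (0 + c * y) *\<^sub>R h (0 + c * y)) = (\<lambda>y. indicator {0<..} y *\<^sub>R h (c * y))"
    using assms by (auto simp: indicator_def zero_less_mult_iff)
  finally show ?thesis using assms by (simp add: integral_restrict_space)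
qed

section \<open>Removal of the regularisation\<close>

context koshliakov begin

text \<open>The majorant for the limit of large u. For n >= 1 the power outweighs both 1 / x and the
  pole of \<open>phir\<close> at 0.\<close>

lemma kernel_power_bound:
  assumes n: "n \<ge> 1" and a: "a > 0"
  shows "\<exists>K. \<forall>x\<ge>0. \<bar>x ^ (2 * n) * (2 * pi / x * phir (a * x))\<bar> \<le> K * (1 / (1 + x\<^sup>2))"
proof -
  \<comment> \<open>Multiplication by 1 + x^2 leaves the powers 2 n - 2 and 2 n against exp(-a x).
    The prefactor joins 2 pi / x with the bound exp(-a x) / (a x) for \<open>phir\<close>.\<close>
  define K where "K = 2 * pi / a * ((real (2 * n - 2) / a) ^ (2 * n - 2) + (real (2 * n) / a) ^ (2 * n))"
  have K0: "K \<ge> 0" using a by (auto simp: K_def)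
  have "\<bar>x ^ (2 * n) * (2 * pi / x * phir (a * x))\<bar> \<le> K * (1 / (1 + x\<^sup>2))" if x: "x \<ge> 0" for x
  proof (cases "x = 0")
    case True then show ?thesis using K0 n by simp
  next
    case False
    then have x0: "x > 0" using x by simp
    have p: "1 + x\<^sup>2 > 0" by (rule add_pos_nonneg) auto
    have x2: "x ^ (2 * n) = x ^ (2 * n - 2) * x\<^sup>2"
    proof -
      have "2 * n = (2 * n - 2) + 2" using n by simp
      then show ?thesis by (metis power_add)
    qed
    have "\<bar>x ^ (2 * n) * (2 * pi / x * phir (a * x))\<bar> = x ^ (2 * n) * (2 * pi / x) * \<bar>phir (a * x)\<bar>"
      using x0 by (simp add: abs_mult)
    also have "\<dots> \<le> x ^ (2 * n) * (2 * pi / x) * (exp (- (a * x)) / (a * x))"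
      using x0 a by (intro mult_left_mono abs_phir_le_exp) auto
    also have "\<dots> = 2 * pi / a * (x ^ (2 * n - 2) * exp (- (a * x)))"
      unfolding x2 using x0 a by (simp add: power2_eq_square)
    finally have 1: "\<bar>x ^ (2 * n) * (2 * pi / x * phir (a * x))\<bar> \<le> 2 * pi / a * (x ^ (2 * n - 2) * exp (- (a * x)))" .
    have "x ^ (2 * n - 2) * (1 + x\<^sup>2) = x ^ (2 * n - 2) + x ^ (2 * n)" unfolding x2 by (simp add: algebra_simps)
    also have "\<dots> \<le> (real (2 * n - 2) / a) ^ (2 * n - 2) * exp (a * x) + (real (2 * n) / a) ^ (2 * n) * exp (a * x)"
      by (intro add_mono power_le_exp x a)
    finally have "x ^ (2 * n - 2) * (1 + x\<^sup>2) * exp (- (a * x)) \<le> ((real (2 * n - 2) / a) ^ (2 * n - 2) * exp (a * x) + (real (2 * n) / a) ^ (2 * n) * exp (a * x)) * exp (- (a * x))"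
      by (intro mult_right_mono) auto
    also have "\<dots> = (real (2 * n - 2) / a) ^ (2 * n - 2) + (real (2 * n) / a) ^ (2 * n)"
      by (simp add: distrib_right mult.assoc flip: exp_add)
    finally have "2 * pi / a * (x ^ (2 * n - 2) * (1 + x\<^sup>2) * exp (- (a * x))) \<le> K"
      unfolding K_def using a by (intro mult_left_mono) auto
    then have "2 * pi / a * (x ^ (2 * n - 2) * exp (- (a * x))) * (1 + x\<^sup>2) \<le> K" by (simp add: mult_ac)
    then have "2 * pi / a * (x ^ (2 * n - 2) * exp (- (a * x))) \<le> K / (1 + x\<^sup>2)" using p by (simp only: pos_le_divide_eq)
    then show ?thesis using 1 by simp
  qed
  then show ?thesis by blast
qed

lemma root_nonneg: "root j \<ge> 0"
  by (cases j) (auto simp: less_imp_le)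

lemma signed_integral_integrable:
  fixes g :: "real \<Rightarrow> real"
  assumes "g \<in> borel_measurable borel" "\<And>x. x \<ge> 0 \<Longrightarrow> \<bar>g x\<bar> \<le> K * (1 / (1 + x\<^sup>2))"
  shows "integrable roots_measure (\<lambda>j. g (root j))" "integrable half_line g"
proof -
  show "integrable roots_measure (\<lambda>j. g (root j))"
    by (rule Bochner_Integration.integrable_bound[OF integrable_mult_right[OF integrable_roots, of K]])
       (unfold real_norm_def, measurable, intro AE_I2 order.trans[OF assms(2) abs_ge_self] root_nonneg)
  show "integrable half_line g"
  proof (rule Bochner_Integration.integrable_bound[OF integrable_mult_right[OF integrable_half_line_kernel, of K]])
    show "AE x in half_line. norm (g x) \<le> norm (K * (1 / (1 + x\<^sup>2)))"
      unfolding real_norm_def by (intro AE_I2 order.trans[OF assms(2) abs_ge_self]) auto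
  qed (auto intro!: measurable_restrict_space1 assms(1))
qed

lemma signed_integral_tendsto:
  fixes g :: "nat \<Rightarrow> real \<Rightarrow> real"
  assumes m: "\<And>k. g k \<in> borel_measurable borel" "h \<in> borel_measurable borel"
    and b: "\<And>k x. x \<ge> 0 \<Longrightarrow> \<bar>g k x\<bar> \<le> K * (1 / (1 + x\<^sup>2))"
    and lim: "\<And>x. x \<ge> 0 \<Longrightarrow> (\<lambda>k. g k x) \<longlonglongrightarrow> h x"
  shows "(\<lambda>k. signed_integral (g k)) \<longlonglongrightarrow> signed_integral h"
  unfolding signed_integral_def
proof (intro tendsto_diff)
  show "(\<lambda>k. \<integral>j. g k (root j) \<partial>roots_measure) \<longlonglongrightarrow> (\<integral>j. h (root j) \<partial>roots_measure)"
    by (rule integral_dominated_convergence[where w="\<lambda>j. K * (1 / (1 + (root j)\<^sup>2))"])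
       (auto intro!: lim root_nonneg b integrable_mult_right integrable_roots AE_I2 simp del: times_divide_eq_right)
  show "(\<lambda>k. \<integral>y. g k y \<partial>half_line) \<longlonglongrightarrow> (\<integral>y. h y \<partial>half_line)"
    by (rule integral_dominated_convergence[where w="\<lambda>y. K * (1 / (1 + y\<^sup>2))"])
       (auto intro!: lim b integrable_mult_right integrable_half_line_kernel AE_I2 measurable_restrict_space1 m simp del: times_divide_eq_right)
qed

text \<open>For purely imaginary \<tau> the principal root of -\<tau> has argument +-pi/4, hence
  real part sqrt(|\<tau>| / 2).\<close>

lemma signed_integral_kernel_bound:
  assumes \<tau>: "Re \<tau> = 0" "\<tau> \<noteq> 0"
  defines "\<rho> \<equiv> sqrt (cmod \<tau> / 2)"
  shows "cmod (signed_integral (\<lambda>x. 1 / (of_real (x\<^sup>2) - \<tau>))) \<le> pi / \<rho> * (1 / (exp (2 * pi * \<rho>) - 1))"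
proof -
  define z where "z = csqrt (- \<tau>)"
  have Re: "Re z = \<rho>" using \<tau> by (simp add: z_def \<rho>_def)
  have \<rho>: "\<rho> > 0" using \<tau> by (simp add: \<rho>_def)
  have "- \<tau> = z\<^sup>2" by (simp add: z_def)
  then have e: "complex_of_real (x\<^sup>2) - \<tau> = (of_real x)\<^sup>2 + z\<^sup>2" for x by (metis of_real_power diff_conv_add_uminus)
  have "cmod (signed_integral (\<lambda>x. 1 / (of_real (x\<^sup>2) - \<tau>))) = cmod (pi / z * phi z)"
    unfolding e by (subst signed_integral_kernel) (use Re \<rho> in auto)
  also have "\<dots> = pi / cmod z * cmod (phi z)" by (simp add: norm_mult norm_divide)
  also have "\<dots> \<le> pi / \<rho> * (1 / (exp (2 * pi * \<rho>) - 1))"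
  proof (intro mult_mono divide_left_mono)
    show "cmod (phi z) \<le> 1 / (exp (2 * pi * \<rho>) - 1)" using cmod_phi_le[of z] Re \<rho> by simp
    show "\<rho> \<le> cmod z" using complex_Re_le_cmod[of z] Re by simp
    then show "0 < cmod z * \<rho>" using \<rho> by (intro mult_pos_pos) auto
  qed (use \<rho> in auto)
  finally show ?thesis .
qed

lemma signed_integral_scaled_kernel:
  assumes b: "b > 0"
  shows "signed_integral (\<lambda>y. 1 / (- \<tau> - complex_of_real (b\<^sup>2 * y\<^sup>2))) =
    - (1 / of_real (b\<^sup>2)) * signed_integral (\<lambda>y. 1 / (complex_of_real (y\<^sup>2) - (- \<tau> / of_real (b\<^sup>2))))"
proof -
  have "1 / (- \<tau> - complex_of_real (b\<^sup>2 * y\<^sup>2)) = - (1 / of_real (b\<^sup>2)) * (1 / (complex_of_real (y\<^sup>2) - (- \<tau> / of_real (b\<^sup>2))))" for y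
  proof -
    have "- \<tau> - complex_of_real (b\<^sup>2 * y\<^sup>2) = - (of_real (b\<^sup>2) * (complex_of_real (y\<^sup>2) - (- \<tau> / of_real (b\<^sup>2))))"
      using b by (simp add: distrib_left)
    then show ?thesis by simp
  qed
  then show ?thesis
    unfolding signed_integral_def by (simp only: integral_mult_right_zero right_diff_distrib)
qed

text \<open>The coefficient grows like u^(n+1), but each signed kernel integral is bounded by a term
  of order exp(-c sqrt(u)), since its pole has modulus proportional to u.\<close>

lemma error_term_tendsto_0:
  assumes r: "Re r = 0" "r \<noteq> 0" and b: "b > 0"
  shows "(\<lambda>k. of_real (real (Suc k)) ^ Suc n * c * (signed_integral (\<lambda>x. 1 / (of_real (x\<^sup>2) - of_real (real (Suc k)) * r)) *
     signed_integral (\<lambda>y. 1 / (- (of_real (real (Suc k)) * r) - complex_of_real (b\<^sup>2 * y\<^sup>2))))) \<longlonglongrightarrow> 0"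
proof -
  define t where "t = sqrt (cmod r / 2)"
  have t: "t > 0" using r by (simp add: t_def)
  define B where "B u = u powr real (Suc n) * (pi / (t * sqrt u) * (1 / (exp (2 * pi * (t * sqrt u)) - 1)) *
    (1 / b\<^sup>2 * (pi / (t / b * sqrt u) * (1 / (exp (2 * pi * (t / b * sqrt u)) - 1)))))" for u
  have decay: "((\<lambda>u. u powr a * (pi / (t * sqrt u) * (1 / (exp (2 * pi * (t * sqrt u)) - 1)) *
      (pi / (s * sqrt u) * (1 / (exp (2 * pi * (s * sqrt u)) - 1))))) \<longlongrightarrow> 0) at_top"
    if "s > 0" for a s :: real
  proof -
    define c1 c2 where "c1 = 2 * pi * t" and "c2 = 2 * pi * s"
    have c: "c1 > 0" "c2 > 0" using t that by (auto simp: c1_def c2_def)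
    have "((\<lambda>u. (u powr a * (1 / (exp (c1 * sqrt u) - 1))) * (1 / (exp (c2 * sqrt u) - 1)) * ((pi / (t * sqrt u)) * (pi / (s * sqrt u)))) \<longlongrightarrow> 0 * 0 * (0 * 0)) at_top"
    proof (intro tendsto_mult)
      show "((\<lambda>u. u powr a * (1 / (exp (c1 * sqrt u) - 1))) \<longlongrightarrow> 0) at_top" using c by real_asymp
      show "((\<lambda>u. 1 / (exp (c2 * sqrt u) - 1)) \<longlongrightarrow> 0) at_top" using c by real_asymp
      show "((\<lambda>u. pi / (t * sqrt u)) \<longlongrightarrow> 0) at_top" using t by real_asymp
      show "((\<lambda>u. pi / (s * sqrt u)) \<longlongrightarrow> 0) at_top" using that by real_asymp
    qed
    then show ?thesis by (simp only: c1_def c2_def mult_ac mult_zero_left)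
  qed
  have "((\<lambda>u. 1 / b\<^sup>2 * (u powr real (Suc n) * (pi / (t * sqrt u) * (1 / (exp (2 * pi * (t * sqrt u)) - 1)) *
      (pi / (t / b * sqrt u) * (1 / (exp (2 * pi * (t / b * sqrt u)) - 1)))))) \<longlongrightarrow> 1 / b\<^sup>2 * 0) at_top"
    using t b by (intro tendsto_mult tendsto_const decay) simp
  then have "((\<lambda>u. B u) \<longlongrightarrow> 0) at_top" unfolding B_def by (simp add: mult_ac)
  then have "(\<lambda>k. B (real (Suc k))) \<longlonglongrightarrow> 0"
    by (rule filterlim_compose) (rule filterlim_compose[OF filterlim_real_sequentially filterlim_Suc])
  then have "(\<lambda>k. cmod c * B (real (Suc k))) \<longlonglongrightarrow> cmod c * 0" by (intro tendsto_intros)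
  then have lim: "(\<lambda>k. cmod c * B (real (Suc k))) \<longlonglongrightarrow> 0" by simp
  show ?thesis
  proof (rule Lim_null_comparison[OF always_eventually lim], rule allI)
    fix k
    define u where "u = real (Suc k)"
    have u: "u > 0" by (simp add: u_def)
    define \<tau> where "\<tau> = of_real u * r"
    have \<tau>: "Re \<tau> = 0" "\<tau> \<noteq> 0" using r u by (auto simp: \<tau>_def)
    have n\<tau>: "cmod \<tau> = u * cmod r" using u by (simp add: \<tau>_def norm_mult)
    have s1: "sqrt (cmod \<tau> / 2) = t * sqrt u" unfolding n\<tau> t_def by (simp add: real_sqrt_mult real_sqrt_divide)
    have s2: "sqrt (cmod (- \<tau> / of_real (b\<^sup>2)) / 2) = t / b * sqrt u"
      unfolding t_def using b by (simp add: norm_divide n\<tau> real_sqrt_mult real_sqrt_divide norm_power mult.commute)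
    have 1: "cmod (signed_integral (\<lambda>x. 1 / (of_real (x\<^sup>2) - \<tau>))) \<le> pi / (t * sqrt u) * (1 / (exp (2 * pi * (t * sqrt u)) - 1))"
      using signed_integral_kernel_bound[OF \<tau>] unfolding s1 .
    have "Re (- \<tau> / of_real (b\<^sup>2)) = 0" "- \<tau> / of_real (b\<^sup>2) \<noteq> 0" using \<tau> b by (simp_all add: Re_divide_of_real del: of_real_power)
    note bound = signed_integral_kernel_bound[OF this, unfolded s2]
    have nb: "cmod (- (1 / of_real (b\<^sup>2))) = 1 / b\<^sup>2" by (simp add: norm_divide norm_power)
    have 2: "cmod (signed_integral (\<lambda>y. 1 / (- \<tau> - complex_of_real (b\<^sup>2 * y\<^sup>2)))) \<le> 1 / b\<^sup>2 * (pi / (t / b * sqrt u) * (1 / (exp (2 * pi * (t / b * sqrt u)) - 1)))"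
      unfolding signed_integral_scaled_kernel[OF b] norm_mult nb by (rule mult_left_mono[OF bound]) simp
    have pw: "u powr real (Suc n) = u ^ Suc n" using u by (rule powr_realpow)
    have "cmod (of_real u ^ Suc n * c * (signed_integral (\<lambda>x. 1 / (of_real (x\<^sup>2) - \<tau>)) * signed_integral (\<lambda>y. 1 / (- \<tau> - complex_of_real (b\<^sup>2 * y\<^sup>2)))))
      = cmod c * (u ^ Suc n * (cmod (signed_integral (\<lambda>x. 1 / (of_real (x\<^sup>2) - \<tau>))) * cmod (signed_integral (\<lambda>y. 1 / (- \<tau> - complex_of_real (b\<^sup>2 * y\<^sup>2))))))"
      using u by (simp add: norm_mult norm_power)
    also have "\<dots> \<le> cmod c * B u"
      unfolding B_def pw using 1 2 u by (intro mult_left_mono mult_mono order.trans[OF norm_ge_zero 1]) auto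
    finally show "norm (of_real (real (Suc k)) ^ Suc n * c * (signed_integral (\<lambda>x. 1 / (of_real (x\<^sup>2) - of_real (real (Suc k)) * r)) *
     signed_integral (\<lambda>y. 1 / (- (of_real (real (Suc k)) * r) - complex_of_real (b\<^sup>2 * y\<^sup>2))))) \<le> cmod c * B (real (Suc k))"
      unfolding \<tau>_def u_def .
  qed
qed

text \<open>The exchange formula for the regularised power at u = k + 1, followed by k to infinity:
  the left side converges by domination, the pole terms vanish, and the contribution of the atom at
  the origin is independent of u.\<close>

lemma signed_integral_identity:
  assumes n: "n \<ge> 1" and b: "b > 0"
  shows "signed_integral (\<lambda>x. x ^ (2 * n) * (2 * pi / x * phir (x / b)))
      - (- 1) ^ n * (b ^ (2 * n) * signed_integral (\<lambda>y. y ^ (2 * n) * (2 * pi / y * phir (b * y))))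
    = - (2 * b * 0 ^ (n - 1) * (mass 0)\<^sup>2)"
proof -
  obtain A :: "complex set" and c :: "complex \<Rightarrow> complex" where A: "finite A" "\<And>r. r \<in> A \<Longrightarrow> Re r = 0 \<and> r \<noteq> 0"
    and pf: "\<And>u X. u > 0 \<Longrightarrow> of_real (regularised_power n u X) = (\<Sum>r\<in>A. of_real u ^ Suc n * c r / (of_real X - of_real u * r))"
    and cr: "(\<Sum>r\<in>A. c r / r\<^sup>2) = - (0 ^ (n - 1))"
    by (rule regularised_power_partial_fractions[OF n]) blast
  define L1 where "L1 u = signed_integral (\<lambda>x. regularised_power n u (x\<^sup>2) * (2 * pi / x * phir (x / b)))" for u
  define L2 where "L2 u = signed_integral (\<lambda>y. regularised_power n u (b\<^sup>2 * y\<^sup>2) * (2 * pi / y * phir (b * y)))" for u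
  define Er where "Er u r = of_real u ^ Suc n * c r * (signed_integral (\<lambda>x. 1 / (of_real (x\<^sup>2) - of_real u * r)) *
     signed_integral (\<lambda>y. 1 / (- (of_real u * r) - complex_of_real (b\<^sup>2 * y\<^sup>2))))" for u r
  have id: "complex_of_real (L1 u - (- 1) ^ n * L2 u) = - of_real (2 * b) * (\<Sum>r\<in>A. Er u r) - of_real (2 * b * 0 ^ (n - 1) * (mass 0)\<^sup>2)"
    if u: "u \<ge> 1" for u
  proof -
    define T where "T = (\<lambda>r. of_real u * r) ` A"
    define d where "d \<tau> = of_real u ^ Suc n * c (\<tau> / of_real u)" for \<tau>
    have u0: "complex_of_real u \<noteq> 0" "u > 0" using u by auto
    have inj: "inj_on (\<lambda>r. of_real u * r) A" using u0 by (auto simp: inj_on_def)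
    have sumT: "(\<Sum>\<tau>\<in>T. d \<tau> * g \<tau>) = (\<Sum>r\<in>A. of_real u ^ Suc n * c r * g (of_real u * r))" for g
      unfolding T_def using inj u0 by (subst sum.reindex) (simp_all add: d_def)
    have "complex_of_real (L1 u - (- 1) ^ n * L2 u) = - of_real (2 * b) * (\<Sum>\<tau>\<in>T. d \<tau> * (signed_integral (\<lambda>x. 1 / (of_real (x\<^sup>2) - \<tau>)) *
          signed_integral (\<lambda>y. 1 / (- \<tau> - of_real (b\<^sup>2 * y\<^sup>2))))) - of_real (2 * b * 0 ^ (n - 1) * (mass 0)\<^sup>2)"
      unfolding L1_def L2_def
    proof (rule exchange_signed[OF borel_measurable_regularised])
      show "finite T" using A by (simp add: T_def)
      show "Im \<tau> \<noteq> 0" if "\<tau> \<in> T" for \<tau>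
        using that A(2) u0 by (auto simp: T_def complex_eq_iff)
      show "of_real (regularised_power n u X) = (\<Sum>\<tau>\<in>T. d \<tau> / (of_real X - \<tau>))" for X
        using sumT[of "\<lambda>\<tau>. 1 / (of_real X - \<tau>)"] pf[OF u0(2), of X] by simp
      show "(\<Sum>\<tau>\<in>T. d \<tau> / \<tau>\<^sup>2) = - of_real (0 ^ (n - 1))"
      proof -
        have "(\<Sum>\<tau>\<in>T. d \<tau> / \<tau>\<^sup>2) = (\<Sum>r\<in>A. of_real u ^ (n - 1) * (c r / r\<^sup>2))"
          using sumT[of "\<lambda>\<tau>. 1 / \<tau>\<^sup>2"] n u0 by (simp add: power_mult_distrib power2_eq_square power_eq_if)
        also have "\<dots> = - (of_real u ^ (n - 1) * 0 ^ (n - 1))" unfolding sum_distrib_left[symmetric] cr by simp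
        \<comment> \<open>For n = 1 the power of u is trivial; for n > 1 both sides are 0.\<close>
        also have "of_real u ^ (n - 1) * 0 ^ (n - 1) = (0 ^ (n - 1) :: complex)" by (cases "n - 1") auto
        finally show ?thesis by simp
      qed
      show "regularised_power n u (- X) = (- 1) ^ n * regularised_power n u X" for X by (rule regularised_power_minus)
      show "X \<ge> 0 \<Longrightarrow> \<bar>regularised_power n u X\<bar> \<le> ((fact (Suc n))\<^sup>2 * (u\<^sup>2) ^ Suc n) * (X / (1 + X\<^sup>2))" for X
        by (rule regularised_power_bound[OF n u])
    qed (rule b)
    then show ?thesis unfolding sumT Er_def .
  qed
  have "(\<lambda>k. complex_of_real (L1 (real (Suc k)) - (- 1) ^ n * L2 (real (Suc k)))) \<longlonglongrightarrow>
     - of_real (2 * b) * (\<Sum>r\<in>A. 0) - of_real (2 * b * 0 ^ (n - 1) * (mass 0)\<^sup>2)"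
  proof (subst id)
    show "(\<lambda>k. - of_real (2 * b) * (\<Sum>r\<in>A. Er (real (Suc k)) r) - of_real (2 * b * 0 ^ (n - 1) * (mass 0)\<^sup>2)) \<longlonglongrightarrow>
     - of_real (2 * b) * (\<Sum>r\<in>A. 0) - complex_of_real (2 * b * 0 ^ (n - 1) * (mass 0)\<^sup>2)"
      using A(2) b unfolding Er_def by (intro tendsto_intros error_term_tendsto_0) auto
  qed simp
  then have "(\<lambda>k. complex_of_real (L1 (real (Suc k)) - (- 1) ^ n * L2 (real (Suc k)))) \<longlonglongrightarrow> of_real (- (2 * b * 0 ^ (n - 1) * (mass 0)\<^sup>2))"
    by simp
  then have lim1: "(\<lambda>k. L1 (real (Suc k)) - (- 1) ^ n * L2 (real (Suc k))) \<longlonglongrightarrow> - (2 * b * 0 ^ (n - 1) * (mass 0)\<^sup>2)"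
    unfolding tendsto_of_real_iff .
  have mono: "\<bar>regularised_power n u X * t\<bar> \<le> \<bar>X ^ n * t\<bar>" if "X \<ge> 0" for u X t
    using regularised_power_le[OF that] that by (auto simp: abs_mult intro!: mult_right_mono)
  obtain K1 where K1: "\<And>x. x \<ge> 0 \<Longrightarrow> \<bar>x ^ (2 * n) * (2 * pi / x * phir (1 / b * x))\<bar> \<le> K1 * (1 / (1 + x\<^sup>2))"
    using kernel_power_bound[OF n, of "1 / b"] b by auto
  obtain K2 where K2: "\<And>x. x \<ge> 0 \<Longrightarrow> \<bar>x ^ (2 * n) * (2 * pi / x * phir (b * x))\<bar> \<le> K2 * (1 / (1 + x\<^sup>2))"
    using kernel_power_bound[OF n b] by blast
  have pw1: "(x\<^sup>2) ^ n = x ^ (2 * n)" and pw2: "(b\<^sup>2 * x\<^sup>2) ^ n = b ^ (2 * n) * x ^ (2 * n)" for x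
    by (simp_all add: power_mult power_mult_distrib)
  have "(\<lambda>k. L1 (real (Suc k))) \<longlonglongrightarrow> signed_integral (\<lambda>x. x ^ (2 * n) * (2 * pi / x * phir (x / b)))"
    unfolding L1_def
  proof (rule signed_integral_tendsto[where K=K1])
    show "\<bar>regularised_power n (real (Suc k)) (x\<^sup>2) * (2 * pi / x * phir (x / b))\<bar> \<le> K1 * (1 / (1 + x\<^sup>2))" if "x \<ge> 0" for k x
      using K1[OF that] by (intro order.trans[OF mono]) (simp_all add: pw1)
    show "(\<lambda>k. regularised_power n (real (Suc k)) (x\<^sup>2) * (2 * pi / x * phir (x / b))) \<longlonglongrightarrow> x ^ (2 * n) * (2 * pi / x * phir (x / b))" for x
      unfolding pw1[symmetric] by (intro tendsto_intros regularised_power_tendsto)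
  qed measurable
  moreover have "(\<lambda>k. L2 (real (Suc k))) \<longlonglongrightarrow> signed_integral (\<lambda>y. b ^ (2 * n) * (y ^ (2 * n) * (2 * pi / y * phir (b * y))))"
    unfolding L2_def
  proof (rule signed_integral_tendsto[where K="b ^ (2 * n) * K2"])
    show "\<bar>regularised_power n (real (Suc k)) (b\<^sup>2 * x\<^sup>2) * (2 * pi / x * phir (b * x))\<bar> \<le> b ^ (2 * n) * K2 * (1 / (1 + x\<^sup>2))" if "x \<ge> 0" for k x
    proof -
      have "\<bar>regularised_power n (real (Suc k)) (b\<^sup>2 * x\<^sup>2) * (2 * pi / x * phir (b * x))\<bar> \<le> \<bar>(b\<^sup>2 * x\<^sup>2) ^ n * (2 * pi / x * phir (b * x))\<bar>"
        by (rule mono) simp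
      also have "\<dots> = b ^ (2 * n) * \<bar>x ^ (2 * n) * (2 * pi / x * phir (b * x))\<bar>"
        unfolding pw2 using b by (simp add: abs_mult)
      also have "\<dots> \<le> b ^ (2 * n) * (K2 * (1 / (1 + x\<^sup>2)))" using K2[OF that] b by (intro mult_left_mono) auto
      finally show ?thesis by simp
    qed
    show "(\<lambda>k. regularised_power n (real (Suc k)) (b\<^sup>2 * x\<^sup>2) * (2 * pi / x * phir (b * x))) \<longlonglongrightarrow> b ^ (2 * n) * (x ^ (2 * n) * (2 * pi / x * phir (b * x)))" for x
      unfolding mult.assoc[symmetric, of "b ^ (2 * n)"] pw2[symmetric] by (intro tendsto_intros regularised_power_tendsto)
  qed measurable
  ultimately have "(\<lambda>k. L1 (real (Suc k)) - (- 1) ^ n * L2 (real (Suc k))) \<longlonglongrightarrow>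
    signed_integral (\<lambda>x. x ^ (2 * n) * (2 * pi / x * phir (x / b))) - (- 1) ^ n * signed_integral (\<lambda>y. b ^ (2 * n) * (y ^ (2 * n) * (2 * pi / y * phir (b * y))))"
    by (intro tendsto_intros)
  from LIMSEQ_unique[OF this lim1]
  have eq: "signed_integral (\<lambda>x. x ^ (2 * n) * (2 * pi / x * phir (x / b))) - (- 1) ^ n * signed_integral (\<lambda>y. b ^ (2 * n) * (y ^ (2 * n) * (2 * pi / y * phir (b * y))))
    = - (2 * b * 0 ^ (n - 1) * (mass 0)\<^sup>2)" .
  have scale: "signed_integral (\<lambda>y. b ^ (2 * n) * (y ^ (2 * n) * (2 * pi / y * phir (b * y)))) =
      b ^ (2 * n) * signed_integral (\<lambda>y. y ^ (2 * n) * (2 * pi / y * phir (b * y)))"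
    by (simp only: signed_integral_def integral_mult_right_zero right_diff_distrib)
  show ?thesis using eq unfolding scale .
qed

text \<open>The atom contributes nothing, because x^(2n-1) vanishes at 0. Rescaling the Lebesgue
  part by a produces the factor 1 / a^(2n) and the integral that represents zeta at 1 - 2 n.\<close>

lemma signed_integral_power_phir:
  assumes n: "n \<ge> 1" and a: "a > 0"
  shows "signed_integral (\<lambda>x. x ^ (2 * n) * (2 * pi / x * phir (a * x))) =
    2 * pi * ((\<Sum>j. wt (Suc j) * (root (Suc j) ^ (2 * n - 1) * phir (a * root (Suc j))))
      - (\<integral>y. y ^ (2 * n - 1) * phir y \<partial>half_line) / a ^ (2 * n))"
proof -
  define g where "g x = x ^ (2 * n) * (2 * pi / x * phir (a * x))" for x
  have g: "g x = 2 * pi * (x ^ (2 * n - 1) * phir (a * x))" for x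
  proof (cases "x = 0")
    case False
    have "x ^ (2 * n) = x ^ (2 * n - 1) * x" using n by (simp flip: power_Suc2)
    then show ?thesis using False by (simp add: g_def)
  qed (use n in \<open>simp add: g_def\<close>)
  obtain K where "\<And>x. x \<ge> 0 \<Longrightarrow> \<bar>x ^ (2 * n) * (2 * pi / x * phir (a * x))\<bar> \<le> K * (1 / (1 + x\<^sup>2))"
    using kernel_power_bound[OF n a] by blast
  then have K: "\<And>x. x \<ge> 0 \<Longrightarrow> \<bar>g x\<bar> \<le> K * (1 / (1 + x\<^sup>2))" unfolding g_def .
  have gm: "g \<in> borel_measurable borel" unfolding g_def [abs_def] by measurable
  have ints: "integrable roots_measure (\<lambda>j. g (root j))" "integrable half_line g"
    using signed_integral_integrable[of g K] gm K by auto
  define t where "t j = wt (Suc j) * (root (Suc j) ^ (2 * n - 1) * phir (a * root (Suc j)))" for j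
  have gt: "mass (Suc j) * g (root (Suc j)) = 2 * pi * t j" for j by (simp add: g mass_def t_def)
  have "summable (\<lambda>j. mass j * \<bar>g (root j)\<bar>)" using integral_roots(1)[OF ints(1)] by simp
  then have sm: "summable (\<lambda>j. mass j * g (root j))"
    by (rule summable_rabs_cancel[OF back_subst[of summable]])
       (simp add: abs_mult abs_of_nonneg[OF less_imp_le[OF mass_pos]] fun_eq_iff)
  then have "summable (\<lambda>j. mass (Suc j) * g (root (Suc j)))" by (subst summable_Suc_iff)
  then have t: "summable t" unfolding gt by (rule summable_mult_D) simp
  have "g (root 0) = 0" using n by (simp add: g)
  then have "(\<integral>j. g (root j) \<partial>roots_measure) = (\<Sum>j. mass (Suc j) * g (root (Suc j)))"
    using integral_roots(2)[OF ints(1)] suminf_split_head[OF sm] by simp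
  also have "\<dots> = 2 * pi * (\<Sum>j. t j)"
    unfolding gt by (rule suminf_mult[OF t])
  also have "(\<Sum>j. t j) = (\<Sum>j. wt (Suc j) * (root (Suc j) ^ (2 * n - 1) * phir (a * root (Suc j))))"
    by (simp only: t_def)
  finally have 1: "(\<integral>j. g (root j) \<partial>roots_measure) = 2 * pi * (\<Sum>j. wt (Suc j) * (root (Suc j) ^ (2 * n - 1) * phir (a * root (Suc j))))" .
  have "(\<integral>y. g y \<partial>half_line) = (\<integral>y. 2 * pi / a ^ (2 * n - 1) * ((a * y) ^ (2 * n - 1) * phir (a * y)) \<partial>half_line)"
    using a by (simp add: g power_mult_distrib)
  also have "\<dots> = 2 * pi / a ^ (2 * n - 1) * ((\<integral>y. y ^ (2 * n - 1) * phir y \<partial>half_line) / a)"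
    unfolding integral_mult_right_zero integral_half_line_scale[OF a, of "\<lambda>y. y ^ (2 * n - 1) * phir y"] ..
  also have "\<dots> = 2 * pi * ((\<integral>y. y ^ (2 * n - 1) * phir y \<partial>half_line) / a ^ (2 * n))"
  proof -
    have "a ^ (2 * n) = a ^ (2 * n - 1) * a" using n by (simp flip: power_Suc2)
    then show ?thesis by simp
  qed
  finally have 2: "(\<integral>y. g y \<partial>half_line) = 2 * pi * ((\<integral>y. y ^ (2 * n - 1) * phir y \<partial>half_line) / a ^ (2 * n))" .
  show ?thesis unfolding g_def[symmetric] signed_integral_def 1 2 by (simp add: right_diff_distrib)
qed

text \<open>The case \<open>m = - n < 0\<close> of the theorem in terms of \<open>a = \<alpha> / \<pi>\<close> and \<open>b = \<beta> / \<pi>\<close>.\<close>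

lemma transformation_negative:
  assumes n: "n \<ge> 1" and ab: "a > 0" "b > 0" "a * b = 1"
  defines "S \<equiv> \<lambda>a. \<Sum>j. wt (Suc j) * (root (Suc j) ^ (2 * n - 1) * phir (a * root (Suc j)))"
    and "Z \<equiv> 2 * (- 1) ^ n * (\<integral>y. y ^ (2 * n - 1) * phir y \<partial>half_line)"
  shows "a ^ n * (Z / 2 + S a) = (- b) ^ n * (Z / 2 + S b) - 0 ^ (n - 1) * (wt 0)\<^sup>2 / (4 * pi)"
proof -
  define I where "I = (\<integral>y. y ^ (2 * n - 1) * phir y \<partial>half_line)"
  have a: "a = 1 / b" using ab by (simp add: field_simps)
  have "2 * pi * (S a - I / a ^ (2 * n)) - (- 1) ^ n * (b ^ (2 * n) * (2 * pi * (S b - I / b ^ (2 * n))))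
     = - (2 * b * 0 ^ (n - 1) * (mass 0)\<^sup>2)"
    using signed_integral_identity[OF n ab(2)] signed_integral_power_phir[OF n ab(1)] signed_integral_power_phir[OF n ab(2)]
    unfolding S_def I_def by (simp add: a)
  also have "\<dots> = - (b * 0 ^ (n - 1) * (wt 0)\<^sup>2 / 2)" by (simp add: mass_def power_divide)
  finally have 0: "2 * pi * (S a - I / a ^ (2 * n)) - (- 1) ^ n * (b ^ (2 * n) * (2 * pi * (S b - I / b ^ (2 * n))))
     = - (b * 0 ^ (n - 1) * (wt 0)\<^sup>2 / 2)" .
  have "I / a ^ (2 * n) = b ^ (2 * n) * I" using ab by (simp add: a power_divide)
  moreover have "b ^ (2 * n) * (S b - I / b ^ (2 * n)) = b ^ (2 * n) * S b - I" using ab by (simp add: right_diff_distrib)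
  moreover have "2 * pi * (x - y * (z * w)) = 2 * pi * x - y * (z * (2 * pi * w))" for x y z w :: real
    by (simp add: algebra_simps)
  ultimately have "2 * pi * (S a - b ^ (2 * n) * I - (- 1) ^ n * (b ^ (2 * n) * S b - I)) = - (b * 0 ^ (n - 1) * (wt 0)\<^sup>2 / 2)"
    using 0 by metis
  then have "S a - b ^ (2 * n) * I - (- 1) ^ n * (b ^ (2 * n) * S b - I) = - (b * 0 ^ (n - 1) * (wt 0)\<^sup>2 / (4 * pi))"
    by (simp add: field_simps)
  then have D: "a ^ n * (S a - b ^ (2 * n) * I - (- 1) ^ n * (b ^ (2 * n) * S b - I)) = a ^ n * - (b * 0 ^ (n - 1) * (wt 0)\<^sup>2 / (4 * pi))"
    by (rule arg_cong)
  have AB: "a ^ n * b ^ (2 * n) = b ^ n"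
  proof -
    have "a ^ n * b ^ (2 * n) = (a * b) ^ n * b ^ n" by (simp add: power_mult_distrib mult_2 power_add)
    then show ?thesis by (simp add: ab)
  qed
  have o: "a ^ n * (b * 0 ^ (n - 1)) = 0 ^ (n - 1)" using n ab by (cases "n = 1") auto
  have s: "(- 1) ^ n * (- 1) ^ n = (1 :: real)" by (simp flip: power_mult_distrib)
  have Z: "Z / 2 = (- 1) ^ n * I" by (simp add: Z_def I_def)
  have "a ^ n * (Z / 2 + S a) = a ^ n * (S a - b ^ (2 * n) * I - (- 1) ^ n * (b ^ (2 * n) * S b - I))
      + (a ^ n * b ^ (2 * n)) * I + (- 1) ^ n * ((a ^ n * b ^ (2 * n)) * S b)"
    unfolding Z by (simp add: algebra_simps)
  also have "\<dots> = b ^ n * I + (- 1) ^ n * (b ^ n * S b) - (a ^ n * (b * 0 ^ (n - 1))) * (wt 0)\<^sup>2 / (4 * pi)"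
    unfolding D AB by simp
  also have "b ^ n * I = ((- 1) ^ n * (- 1) ^ n) * (b ^ n * I)" unfolding s by simp
  also have "((- 1) ^ n * (- 1) ^ n) * (b ^ n * I) + (- 1) ^ n * (b ^ n * S b) = (- b) ^ n * (Z / 2 + S b)"
    unfolding Z power_minus[of b] by (simp only: distrib_left mult_ac)
  finally show ?thesis unfolding o .
qed

end

section \<open>Positive exponents\<close>

lemma has_bochner_integral_half_line_iff:
  fixes f :: "real \<Rightarrow> real"
  shows "has_bochner_integral half_line f I \<longleftrightarrow> has_bochner_integral lborel (\<lambda>x. indicator {0<..} x *\<^sub>R f x) I"
  by (simp add: has_bochner_integral_iff integrable_restrict_space integral_restrict_space)

lemma has_bochner_integral_power_exp:
  fixes c :: real
  assumes c: "c > 0"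
  shows "has_bochner_integral half_line (\<lambda>y. y ^ m * exp (- (c * y))) (fact m / c ^ Suc m)"
proof -
  have M: "has_bochner_integral half_line (\<lambda>t. t powr real m * exp (- t)) (fact m)"
    using has_bochner_integral_Gamma[of "real m"] by (simp add: Gamma_fact add.commute[of _ 1])
  have e: "t powr real m * exp (- t) = t ^ m * exp (- t)" if "t \<in> space half_line" for t
    using that by (simp add: powr_realpow)
  have "has_bochner_integral half_line (\<lambda>t. t ^ m * exp (- t)) (fact m)"
    by (rule has_bochner_integral_cong[THEN iffD1, OF refl e refl M])
  then have "has_bochner_integral lborel (\<lambda>t :: real. indicator {0<..} t *\<^sub>R (t ^ m * exp (- t))) (fact m)"
    unfolding has_bochner_integral_half_line_iff .
  then have "has_bochner_integral lborel (\<lambda>y. indicator {0<..} (0 + c * y) *\<^sub>R ((0 + c * y) ^ m * exp (- (0 + c * y)))) (fact m /\<^sub>R \<bar>c\<bar>)"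
    using c by (intro lborel_has_bochner_integral_real_affine_iff[THEN iffD1]) auto
  also have "(\<lambda>y. indicator {0<..} (0 + c * y) *\<^sub>R ((0 + c * y) ^ m * exp (- (0 + c * y)))) =
    (\<lambda>y. indicator {0<..} y *\<^sub>R (c ^ m * (y ^ m * exp (- (c * y)))))"
    using c by (auto simp: indicator_def zero_less_mult_iff power_mult_distrib)
  finally have "has_bochner_integral half_line (\<lambda>y. c ^ m * (y ^ m * exp (- (c * y)))) (fact m / c)"
    unfolding has_bochner_integral_half_line_iff using c by (simp add: divide_inverse mult.commute)
  from has_bochner_integral_mult_right[OF this, of "1 / c ^ m"] show ?thesis using c by (simp add: mult.commute)
qed

text \<open>A geometric sum of ratio -X / Y. Each of its terms separates X from Y, which is what
  lets the double series factor.\<close>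

lemma alternating_geometric_sum:
  fixes X Y :: real
  assumes "X > 0" "Y > 0"
  shows "1 / X ^ m / (X + Y) - (- 1) ^ m / Y ^ m / (X + Y) = (\<Sum>i<m. (- 1) ^ i / (X ^ (m - i) * Y ^ (i + 1)))"
proof (induction m)
  case (Suc m)
  have "(\<Sum>i<Suc m. (- 1) ^ i / (X ^ (Suc m - i) * Y ^ (i + 1)))
    = 1 / X * (\<Sum>i<m. (- 1) ^ i / (X ^ (m - i) * Y ^ (i + 1))) + (- 1) ^ m / (X * Y ^ (m + 1))"
    by (simp add: sum_distrib_left Suc_diff_le mult_ac)
  also have "\<dots> = 1 / X * (1 / X ^ m / (X + Y) - (- 1) ^ m / Y ^ m / (X + Y)) + (- 1) ^ m / (X * Y ^ (m + 1))"
    unfolding Suc.IH ..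
  also have "\<dots> = 1 / X ^ Suc m / (X + Y) + (- 1) ^ m * (1 / (X * Y ^ (m + 1)) - 1 / X / Y ^ m / (X + Y))"
    by (simp add: right_diff_distrib)
  also have "1 / (X * Y ^ (m + 1)) - 1 / X / Y ^ m / (X + Y) = 1 / Y ^ Suc m / (X + Y)"
  proof -
    have "1 / (X * Y ^ (m + 1)) = (X + Y) / (X + Y) / (X * Y ^ (m + 1))" using assms by simp
    also have "\<dots> = X / (X + Y) / (X * Y ^ (m + 1)) + Y / (X + Y) / (X * Y ^ (m + 1))"
      by (simp only: add_divide_distrib)
    also have "\<dots> = 1 / Y ^ Suc m / (X + Y) + 1 / X / Y ^ m / (X + Y)" using assms by (simp add: mult.commute)
    finally show ?thesis by simp
  qed
  finally show ?case by simp
qed simp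

section \<open>Bernoulli numbers as zeta values and reciprocity of the double series\<close>

context koshliakov begin

definition zeta_nat :: "nat \<Rightarrow> real" where "zeta_nat k = (\<Sum>j. wt (Suc j) / root (Suc j) ^ k)"

lemma exp_root_le:
  assumes "a > 0" shows "exp (- (a * root (Suc j))) \<le> (2 / a)\<^sup>2 / (root (Suc j))\<^sup>2"
proof -
  have "(root (Suc j))\<^sup>2 \<le> (2 / a)\<^sup>2 * exp (a * root (Suc j))"
    using power_le_exp[of "root (Suc j)" a 2] assms by (simp add: less_imp_le)
  then have "exp (- (a * root (Suc j))) * (root (Suc j))\<^sup>2 \<le> exp (- (a * root (Suc j))) * ((2 / a)\<^sup>2 * exp (a * root (Suc j)))"
    by (intro mult_left_mono) auto
  also have "\<dots> = (2 / a)\<^sup>2" by (simp add: exp_minus)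
  finally show ?thesis by (simp only: pos_le_divide_eq zero_less_power root_pos)
qed

lemma summable_sigma:
  assumes "a > 0" shows "summable (\<lambda>j. wt (Suc j) * exp (- (a * root (Suc j))))"
proof (rule summable_comparison_test'[OF summable_mult[OF summable_weight_power[of 2], of "(2 / a)\<^sup>2"], where N=0])
  fix j
  have "wt (Suc j) * exp (- (a * root (Suc j))) \<le> wt (Suc j) * ((2 / a)\<^sup>2 / (root (Suc j))\<^sup>2)"
    using exp_root_le[OF assms] weight_pos by (intro mult_left_mono) (auto intro: less_imp_le)
  then show "norm (wt (Suc j) * exp (- (a * root (Suc j)))) \<le> (2 / a)\<^sup>2 * (wt (Suc j) / (root (Suc j))\<^sup>2)"
    using weight_pos[of "Suc j"] by (simp add: abs_mult mult.commute)
qed simp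

text \<open>This is B_2k / (2k)!, the form in which the numbers enter the theorem. For k >= 1 it is
  the analogue of Euler's formula for zeta at even integers.\<close>

definition reduced_bernoulli :: "nat \<Rightarrow> real" where
  "reduced_bernoulli k = (if k = 0 then wt 0 else (- 1) ^ (k + 1) * 2 * zeta_nat (2 * k) / (2 * pi) ^ (2 * k))"

text \<open>Termwise integration of the sigma series: x^(2k-1) exp(-2 pi r x) has integral (2k-1)! /
  (2 pi r)^(2k), and 4 k (2k-1)! = 2 (2k)!. For k = 0 the prescribed value is
  \<open>wt 0\<close>.\<close>

lemma koshliakov_bernoulli_eq: "koshliakov_bernoulli p k = of_real (fact (2 * k) * reduced_bernoulli k)"
proof (cases "k = 0")
  case True
  have "1 / (1 + 1 / (pi * p)) = wt 0"
    unfolding weight_0 using p_pos by (simp add: field_simps)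
  then show ?thesis using True by (simp add: koshliakov_bernoulli_def reduced_bernoulli_def)
next
  case False
  define m where "m = 2 * k - 1"
  have m: "Suc m = 2 * k" using False by (simp add: m_def)
  define f where "f j x = wt (Suc j) * (x ^ m * exp (- (2 * pi * root (Suc j) * x)))" for j and x :: real
  have hf: "has_bochner_integral half_line (f j) (wt (Suc j) * (fact m / (2 * pi * root (Suc j)) ^ Suc m))" for j
    unfolding f_def by (intro has_bochner_integral_mult_right has_bochner_integral_power_exp) simp
  then have int: "integrable half_line (f j)"
    and val: "(\<integral>x. f j x \<partial>half_line) = wt (Suc j) * (fact m / (2 * pi * root (Suc j)) ^ Suc m)" for j
    by (auto simp: has_bochner_integral_iff)
  have nf: "norm (f j x) = f j x" if "x > 0" for j x
    using that weight_pos[of "Suc j"] by (simp add: f_def)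
  have sf: "(\<lambda>j. f j x) sums (x ^ m * (\<Sum>j. wt (Suc j) * exp (- (2 * pi * x * root (Suc j)))))" if "x > 0" for x
    using sums_mult[OF summable_sums[OF summable_sigma[of "2 * pi * x"]], of "x ^ m"] that
    unfolding f_def by (simp add: mult_ac)
  have val': "wt (Suc j) * (fact m / (2 * pi * root (Suc j)) ^ Suc m) = fact m / (2 * pi) ^ (2 * k) * (wt (Suc j) / root (Suc j) ^ (2 * k))" for j
    unfolding m power_mult_distrib by simp
  have AE: "AE x in half_line. summable (\<lambda>j. norm (f j x))"
    using sf nf by (intro AE_I2) (auto simp: sums_iff)
  have ne: "(\<integral>x. norm (f j x) \<partial>half_line) = (\<integral>x. f j x \<partial>half_line)" for j
    using nf by (intro Bochner_Integration.integral_cong refl) auto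
  have sn: "summable (\<lambda>j. \<integral>x. norm (f j x) \<partial>half_line)"
    unfolding ne val val' using False by (intro summable_mult) (simp add: summable_weight_power)
  have "(\<integral>x. (\<Sum>j. f j x) \<partial>half_line) = (\<Sum>j. fact m / (2 * pi) ^ (2 * k) * (wt (Suc j) / root (Suc j) ^ (2 * k)))"
    using integral_suminf[OF int AE sn] unfolding val val' .
  also have "\<dots> = fact m / (2 * pi) ^ (2 * k) * zeta_nat (2 * k)"
    unfolding zeta_nat_def using False by (intro suminf_mult summable_weight_power) simp
  finally have I: "(\<integral>x. (\<Sum>j. f j x) \<partial>half_line) = fact m / (2 * pi) ^ (2 * k) * zeta_nat (2 * k)" .
  have "(LBINT x:{0<..}. of_real (x ^ m) * koshliakov_sigma_series p (of_real (2 * pi * x)))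
    = (\<integral>x. of_real (x ^ m) * koshliakov_sigma_series p (of_real (2 * pi * x)) \<partial>half_line)"
    by (simp add: set_lebesgue_integral_def integral_restrict_space)
  also have "\<dots> = (\<integral>x. complex_of_real (\<Sum>j. f j x) \<partial>half_line)"
  proof (intro Bochner_Integration.integral_cong refl)
    fix x assume "x \<in> space half_line"
    then have x: "x > 0" by simp
    have "koshliakov_sigma_series p (of_real (2 * pi * x)) = (\<Sum>j. complex_of_real (wt (Suc j) * exp (- (2 * pi * x * root (Suc j)))))"
      unfolding koshliakov_sigma_series_def by (simp add: mult_ac flip: exp_of_real)
    also have "\<dots> = of_real (\<Sum>j. wt (Suc j) * exp (- (2 * pi * x * root (Suc j))))"
      by (rule suminf_of_real[OF summable_sigma, symmetric]) (use x in simp)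
    finally show "of_real (x ^ m) * koshliakov_sigma_series p (of_real (2 * pi * x)) = complex_of_real (\<Sum>j. f j x)"
      using sums_unique[OF sf[OF x]] by (simp flip: of_real_power of_real_mult)
  qed
  also have "\<dots> = of_real (fact m / (2 * pi) ^ (2 * k) * zeta_nat (2 * k))" unfolding integral_complex_of_real I ..
  finally have "koshliakov_bernoulli p k = (- 1) ^ (k + 1) * 4 * of_nat k * of_real (fact m / (2 * pi) ^ (2 * k) * zeta_nat (2 * k))"
    using False by (simp add: koshliakov_bernoulli_def m_def)
  also have "\<dots> = of_real ((- 1) ^ (k + 1) * 4 * real k * (fact m / (2 * pi) ^ (2 * k) * zeta_nat (2 * k)))" by simp
  also have "(- 1) ^ (k + 1) * 4 * real k * (fact m / (2 * pi) ^ (2 * k) * zeta_nat (2 * k)) = fact (2 * k) * reduced_bernoulli k"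
  proof -
    have "fact (2 * k) = real (2 * k) * fact m" using m fact_Suc[of m, where ?'a=real] by simp
    then show ?thesis using False by (simp add: reduced_bernoulli_def)
  qed
  finally show ?thesis .
qed

definition series_positive :: "nat \<Rightarrow> real \<Rightarrow> real" where
  "series_positive m a = (\<Sum>j. wt (Suc j) * (1 / root (Suc j) ^ (2 * m + 1) * phir (a * root (Suc j))))"

definition double_series :: "nat \<Rightarrow> real \<Rightarrow> real" where
  "double_series m a = (\<Sum>j. wt (Suc j) / root (Suc j) ^ (2 * m) * q (a * root (Suc j)))"

lemma summable_double_series:
  assumes "m \<ge> 1"
  shows "summable (\<lambda>j. wt (Suc j) / root (Suc j) ^ (2 * m) * q (a * root (Suc j)))"
proof (rule summable_comparison_test'[OF summable_mult2[OF summable_weight_power[of "2 * m"], of "q 0"], where N=0])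
  fix j
  show "norm (wt (Suc j) / root (Suc j) ^ (2 * m) * q (a * root (Suc j))) \<le> wt (Suc j) / root (Suc j) ^ (2 * m) * q 0"
    using weight_pos[of "Suc j"] q_nonneg[of "a * root (Suc j)"] q_le[of "a * root (Suc j)"]
    by (simp add: abs_mult divide_right_mono mult_left_mono)
qed (use assms in simp)

text \<open>Half the zeta value completes \<open>phir\<close> to 1/2 + \<open>phir\<close>, which is
  what the expansion of \<open>q\<close> expresses. The pole of that expression at 0 yields the
  separate zeta value at 2 m + 2.\<close>

lemma series_positive_eq:
  assumes m: "m \<ge> 1" and a: "a > 0"
  shows "zeta_nat (2 * m + 1) / 2 + series_positive m a = a / pi * double_series m a + wt 0 / (2 * pi * a) * zeta_nat (2 * m + 2)"
proof -
  have phi_q: "1 / 2 + phir y = y / pi * q y + wt 0 / (2 * pi * y)" if "y > 0" for y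
    unfolding q_eq[OF that] using that by (simp add: field_simps power2_eq_square)
  define A where "A j = wt (Suc j) / root (Suc j) ^ (2 * m + 1)" for j
  define B where "B j = a / pi * (wt (Suc j) / root (Suc j) ^ (2 * m) * q (a * root (Suc j)))" for j
  define C where "C j = wt 0 / (2 * pi * a) * (wt (Suc j) / root (Suc j) ^ (2 * m + 2))" for j
  have trm: "wt (Suc j) * (1 / root (Suc j) ^ (2 * m + 1) * phir (a * root (Suc j))) = B j + C j - A j / 2" for j
  proof -
    define r where "r = root (Suc j)"
    have r: "r > 0" by (simp add: r_def)
    have e: "phir (a * r) = a * r / pi * q (a * r) + wt 0 / (2 * pi * (a * r)) - 1 / 2"
      using phi_q[of "a * r"] a r by simp
    show ?thesis unfolding A_def B_def C_def r_def[symmetric] e using r a by (simp add: field_simps)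
  qed
  have "A sums zeta_nat (2 * m + 1)" unfolding A_def zeta_nat_def by (intro summable_sums summable_weight_power) (use m in simp)
  moreover have "B sums (a / pi * double_series m a)"
    unfolding B_def double_series_def by (intro sums_mult summable_sums summable_double_series m)
  moreover have "C sums (wt 0 / (2 * pi * a) * zeta_nat (2 * m + 2))"
    unfolding C_def zeta_nat_def by (intro sums_mult summable_sums summable_weight_power) simp
  ultimately have "(\<lambda>j. B j + C j - A j / 2) sums (a / pi * double_series m a + wt 0 / (2 * pi * a) * zeta_nat (2 * m + 2) - zeta_nat (2 * m + 1) / 2)"
    by (intro sums_diff sums_add sums_divide)
  then show ?thesis unfolding series_positive_def trm by (simp add: sums_iff)
qed

text \<open>Both double series are integrals over pairs of roots against counting measure. Their
  combination is, pair by pair, a finite geometric sum whose terms are products, and Fubini turns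
  these into products of zeta values.\<close>

lemma double_series_reciprocity:
  assumes m: "m \<ge> 1" and ab: "a > 0" "b > 0" "a * b = 1"
  shows "double_series m a - (- 1) ^ m * a ^ (2 * m) * b\<^sup>2 * double_series m b =
    (\<Sum>i<m. (- 1) ^ i * a ^ (2 * i) * (zeta_nat (2 * m - 2 * i) * zeta_nat (2 * i + 2)))"
proof -
  let ?C = "count_space (UNIV :: nat set)"
  interpret C: sigma_finite_measure ?C by (rule sigma_finite_measure_count_space)
  interpret pair_sigma_finite ?C ?C ..
  define w where "w k j = wt (Suc j) / root (Suc j) ^ k" for k j
  have w: "integrable ?C (w k)" "(\<integral>j. w k j \<partial>?C) = zeta_nat k" if "k > 1" for k
  proof -
    have "summable (\<lambda>j. norm (w k j))"
      using summable_weight_power[OF that] weight_pos by (simp add: w_def abs_of_pos less_imp_le)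
    then show "integrable ?C (w k)" by (simp add: integrable_count_space_nat_iff)
    then have "(\<integral>j. w k j \<partial>?C) = (\<Sum>j. w k j)" by (rule integral_count_space_nat)
    then show "(\<integral>j. w k j \<partial>?C) = zeta_nat k" unfolding zeta_nat_def w_def[symmetric] .
  qed
  define G1 where "G1 j k = w (2 * m) j * (wt (Suc k) / ((root (Suc k))\<^sup>2 + (a * root (Suc j))\<^sup>2))" for j k
  \<comment> \<open>The outer index of the second double series is k, so that \<open>G1\<close> and
    \<open>G2\<close> refer to the same pair of roots.\<close>
  define G2 where "G2 j k = w (2 * m) k * (wt (Suc j) / ((root (Suc j))\<^sup>2 + (b * root (Suc k))\<^sup>2))" for j k
  have wn: "w k j \<ge> 0" for k j using weight_pos[of "Suc j"] by (simp add: w_def less_imp_le)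
  have m2: "2 * m > 1" using m by simp
  have bnd: "wt (Suc k) / ((root (Suc k))\<^sup>2 + t\<^sup>2) \<le> w 2 k" for k t
    using q_term_bounds(2)[of k t] by (simp add: w_def)
  have int1: "integrable (?C \<Otimes>\<^sub>M ?C) (\<lambda>(j, k). G1 j k)"
  proof (rule Bochner_Integration.integrable_bound[OF integrable_product(1)[OF w(1)[OF m2] w(1)[of 2]]])
    show "AE z in ?C \<Otimes>\<^sub>M ?C. norm (case z of (j, k) \<Rightarrow> G1 j k) \<le> norm (case z of (j, k) \<Rightarrow> w (2 * m) j * w 2 k)"
    proof (intro AE_I2, clarsimp)
      fix j k
      have "\<bar>G1 j k\<bar> \<le> w (2 * m) j * w 2 k"
        using mult_left_mono[OF bnd wn] mult_nonneg_nonneg[OF wn q_term_bounds(1)] unfolding G1_def by (simp only: abs_of_nonneg)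
      then show "\<bar>G1 j k\<bar> \<le> \<bar>w (2 * m) j * w 2 k\<bar>" by linarith
    qed
  qed (simp_all add: pair_measure_countable)
  have int2: "integrable (?C \<Otimes>\<^sub>M ?C) (\<lambda>(j, k). G2 j k)"
  proof (rule Bochner_Integration.integrable_bound[OF integrable_product(1)[OF w(1)[of 2] w(1)[OF m2]]])
    show "AE z in ?C \<Otimes>\<^sub>M ?C. norm (case z of (j, k) \<Rightarrow> G2 j k) \<le> norm (case z of (j, k) \<Rightarrow> w 2 j * w (2 * m) k)"
    proof (intro AE_I2, clarsimp)
      fix j k
      have "\<bar>G2 j k\<bar> \<le> w (2 * m) k * w 2 j"
        using mult_left_mono[OF bnd wn] mult_nonneg_nonneg[OF wn q_term_bounds(1)] unfolding G2_def by (simp only: abs_of_nonneg)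
      then show "\<bar>G2 j k\<bar> \<le> \<bar>w 2 j * w (2 * m) k\<bar>" by (simp add: mult.commute)
    qed
  qed (simp_all add: pair_measure_countable)
  have qs: "(\<integral>k. wt (Suc k) / ((root (Suc k))\<^sup>2 + t\<^sup>2) \<partial>?C) = q t" for t
  proof -
    have "integrable ?C (\<lambda>k. wt (Suc k) / ((root (Suc k))\<^sup>2 + t\<^sup>2))"
      using summable_q[of t] unfolding integrable_count_space_nat_iff real_norm_def abs_of_nonneg[OF q_term_bounds(1)] .
    from integral_count_space_nat[OF this] show ?thesis by (simp only: q_def)
  qed
  have ds: "(\<integral>j. w (2 * m) j * q (t * root (Suc j)) \<partial>?C) = double_series m t" for t
  proof -
    have "norm (w (2 * m) j * q (t * root (Suc j))) = w (2 * m) j * q (t * root (Suc j))" for j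
      using wn q_nonneg by simp
    then have "integrable ?C (\<lambda>j. w (2 * m) j * q (t * root (Suc j)))"
      using summable_double_series[OF m, of t] unfolding integrable_count_space_nat_iff by (simp only: w_def)
    from integral_count_space_nat[OF this] show ?thesis by (simp only: double_series_def w_def)
  qed
  have v1: "(\<integral>z. (case z of (j, k) \<Rightarrow> G1 j k) \<partial>(?C \<Otimes>\<^sub>M ?C)) = double_series m a"
    using integral_fst'[OF int1] unfolding G1_def by (simp only: prod.case integral_mult_right_zero qs ds)
  have v2: "(\<integral>z. (case z of (j, k) \<Rightarrow> G2 j k) \<partial>(?C \<Otimes>\<^sub>M ?C)) = double_series m b"
    using integral_snd[OF int2] unfolding G2_def by (simp only: prod.case integral_mult_right_zero qs ds)
  have pt: "G1 j k - (- 1) ^ m * a ^ (2 * m) * b\<^sup>2 * G2 j k = (\<Sum>i<m. (- 1) ^ i * a ^ (2 * i) * (w (2 * m - 2 * i) j * w (2 * i + 2) k))" for j k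
  proof -
    define r s where "r = root (Suc j)" and "s = root (Suc k)"
    \<comment> \<open>Since b = 1 / a, one has r^2 + (b s)^2 = b^2 (X + Y): up to the factor b^2
      both terms share the denominator X + Y.\<close>
    define X Y where "X = (a * r)\<^sup>2" and "Y = s\<^sup>2"
    have rs: "r > 0" "s > 0" by (auto simp: r_def s_def)
    have XY: "X > 0" "Y > 0" using rs ab by (auto simp: X_def Y_def)
    define W where "W = wt (Suc j) * wt (Suc k)"
    have "r\<^sup>2 + (b * s)\<^sup>2 = b\<^sup>2 * (X + Y)"
    proof -
      have "r = b * (a * r)" using ab by (simp add: mult.assoc[symmetric] mult.commute[of b a])
      then have "r\<^sup>2 = b\<^sup>2 * X" unfolding X_def by (metis power_mult_distrib)
      then show ?thesis by (simp add: Y_def power_mult_distrib distrib_left)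
    qed
    moreover have "s ^ (2 * m) = Y ^ m" "a ^ (2 * m) * r ^ (2 * m) = X ^ m"
      unfolding X_def Y_def by (simp_all add: power_mult power_mult_distrib)
    ultimately have "G1 j k - (- 1) ^ m * a ^ (2 * m) * b\<^sup>2 * G2 j k = W * a ^ (2 * m) * (1 / X ^ m / (X + Y) - (- 1) ^ m / Y ^ m / (X + Y))"
    proof -
      assume h: "r\<^sup>2 + (b * s)\<^sup>2 = b\<^sup>2 * (X + Y)" "s ^ (2 * m) = Y ^ m" "a ^ (2 * m) * r ^ (2 * m) = X ^ m"
      have "G1 j k = W / r ^ (2 * m) / (Y + X)"
        unfolding G1_def w_def W_def r_def[symmetric] s_def[symmetric] by (simp add: X_def Y_def)
      also have "1 / r ^ (2 * m) = a ^ (2 * m) / X ^ m" using h(3) ab rs XY by (simp add: field_simps)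
      then have "W / r ^ (2 * m) = W * a ^ (2 * m) / X ^ m" by (metis divide_inverse inverse_eq_divide mult.assoc)
      finally have g1: "G1 j k = W * a ^ (2 * m) / X ^ m / (X + Y)" by (simp add: add.commute)
      have "G2 j k = W / Y ^ m / (b\<^sup>2 * (X + Y))"
        unfolding G2_def w_def W_def r_def[symmetric] s_def[symmetric] h by simp
      then have g2: "b\<^sup>2 * G2 j k = W / Y ^ m / (X + Y)" using ab by simp
      have "(- 1) ^ m * a ^ (2 * m) * b\<^sup>2 * G2 j k = (- 1) ^ m * a ^ (2 * m) * (W / Y ^ m / (X + Y))"
        using g2 by (simp only: mult.assoc)
      then show ?thesis unfolding g1 by (simp add: right_diff_distrib mult_ac)
    qed
    also have "\<dots> = (\<Sum>i<m. W * a ^ (2 * m) * ((- 1) ^ i / (X ^ (m - i) * Y ^ (i + 1))))"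
      unfolding alternating_geometric_sum[OF XY] sum_distrib_left ..
    also have "\<dots> = (\<Sum>i<m. (- 1) ^ i * a ^ (2 * i) * (w (2 * m - 2 * i) j * w (2 * i + 2) k))"
    proof (intro sum.cong refl)
      fix i assume "i \<in> {..<m}"
      then have i: "i < m" by simp
      have "2 * m = 2 * i + (2 * m - 2 * i)" using i by simp
      then have 1: "a ^ (2 * m) = a ^ (2 * i) * a ^ (2 * m - 2 * i)" by (metis power_add)
      have "X ^ (m - i) = (a * r) ^ (2 * (m - i))" unfolding X_def by (simp only: power_mult)
      also have "2 * (m - i) = 2 * m - 2 * i" by (rule diff_mult_distrib2)
      finally have 2: "X ^ (m - i) = a ^ (2 * m - 2 * i) * r ^ (2 * m - 2 * i)" by (simp only: power_mult_distrib)
      have 3: "Y ^ (i + 1) = s ^ (2 * i + 2)" proof -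
        have "2 * i + 2 = 2 * (i + 1)" by simp
        then show ?thesis by (simp only: Y_def power_mult)
      qed
      show "W * a ^ (2 * m) * ((- 1) ^ i / (X ^ (m - i) * Y ^ (i + 1))) = (- 1) ^ i * a ^ (2 * i) * (w (2 * m - 2 * i) j * w (2 * i + 2) k)"
        unfolding 1 2 3 w_def W_def r_def[symmetric] s_def[symmetric] using ab rs by (simp del: power_Suc)
    qed
    finally show ?thesis .
  qed
  have "double_series m a - (- 1) ^ m * a ^ (2 * m) * b\<^sup>2 * double_series m b
    = (\<integral>z. (case z of (j, k) \<Rightarrow> G1 j k) - (- 1) ^ m * a ^ (2 * m) * b\<^sup>2 * (case z of (j, k) \<Rightarrow> G2 j k) \<partial>(?C \<Otimes>\<^sub>M ?C))"
    unfolding v1[symmetric] v2[symmetric] using int1 int2 by simp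
  also have "\<dots> = (\<integral>z. (\<Sum>i<m. (- 1) ^ i * a ^ (2 * i) * (case z of (j, k) \<Rightarrow> w (2 * m - 2 * i) j * w (2 * i + 2) k)) \<partial>(?C \<Otimes>\<^sub>M ?C))"
    by (intro Bochner_Integration.integral_cong refl) (auto simp: pt)
  also have "\<dots> = (\<Sum>i<m. (- 1) ^ i * a ^ (2 * i) * (zeta_nat (2 * m - 2 * i) * zeta_nat (2 * i + 2)))"
  proof (rule has_bochner_integral_integral_eq, intro has_bochner_integral_sum has_bochner_integral_mult_right)
    fix i assume "i \<in> {..<m}"
    then have "2 * m - 2 * i > 1" "2 * i + 2 > (1::nat)" by auto
    from w[OF this(1)] w[OF this(2)]
    show "has_bochner_integral (?C \<Otimes>\<^sub>M ?C) (\<lambda>z. case z of (j, k) \<Rightarrow> w (2 * m - 2 * i) j * w (2 * i + 2) k) (zeta_nat (2 * m - 2 * i) * zeta_nat (2 * i + 2))"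
      using integrable_product[of "w (2 * m - 2 * i)" "w (2 * i + 2)"] by (simp only: has_bochner_integral_iff)
  qed
  finally show ?thesis .
qed

text \<open>The case \<open>m > 0\<close> of the theorem in terms of \<open>a = \<alpha> / \<pi>\<close> and \<open>b = \<beta> / \<pi>\<close>.\<close>

lemma transformation_positive:
  assumes m: "m \<ge> 1" and ab: "a > 0" "b > 0" "a * b = 1"
  shows "b ^ m * (zeta_nat (2 * m + 1) / 2 + series_positive m a) - (- 1) ^ m * a ^ m * (zeta_nat (2 * m + 1) / 2 + series_positive m b) =
    - (2 ^ (2 * m) * pi ^ (2 * m + 1) * (\<Sum>j\<le>Suc m. (- 1) ^ j * reduced_bernoulli j * reduced_bernoulli (Suc m - j) * (a ^ (Suc m - j) * b ^ j)))"
proof -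
  define t where "t j = (- 1) ^ j * reduced_bernoulli j * reduced_bernoulli (Suc m - j) * (a ^ (Suc m - j) * b ^ j)" for j
  \<comment> \<open>The powers of 2 pi in the denominators of the two reduced Bernoulli numbers
    multiply to D, whatever the summation index.\<close>
  define D where "D = (2 * pi) ^ (2 * m + 2)"
  have D: "2 ^ (2 * m) * pi ^ (2 * m + 1) = D / (4 * pi)"
    unfolding D_def by (simp add: power_mult_distrib)
  have D0: "D > 0" by (simp add: D_def)
  have "b ^ m * (zeta_nat (2 * m + 1) / 2 + series_positive m a) - (- 1) ^ m * a ^ m * (zeta_nat (2 * m + 1) / 2 + series_positive m b)
    = 1 / pi * (b ^ m * a * double_series m a - (- 1) ^ m * a ^ m * b * double_series m b)
      + wt 0 * zeta_nat (2 * m + 2) / (2 * pi) * (b ^ Suc m - (- 1) ^ m * a ^ Suc m)"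
  proof -
    have "wt 0 / (2 * pi * a) = b * wt 0 / (2 * pi)" "wt 0 / (2 * pi * b) = a * wt 0 / (2 * pi)"
      using ab by (simp_all add: field_simps)
    then show ?thesis
      unfolding series_positive_eq[OF m ab(1)] series_positive_eq[OF m ab(2)]
      by (simp add: algebra_simps diff_divide_distrib)
  qed
  also have "b ^ m * a * double_series m a - (- 1) ^ m * a ^ m * b * double_series m b
    = b ^ m * a * (double_series m a - (- 1) ^ m * a ^ (2 * m) * b\<^sup>2 * double_series m b)"
  proof -
    have "b ^ m * a * (a ^ (2 * m) * b\<^sup>2) = (a * b) ^ m * (a * b) * (a ^ m * b)"
      by (simp add: power_mult_distrib mult_2 power_add power2_eq_square)
    then have "b ^ m * a * (a ^ (2 * m) * b\<^sup>2) = a ^ m * b" by (simp add: ab)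
    moreover have "x * (y - s * u * v * z) = x * y - s * (x * (u * v)) * z" for x y s u v z :: real by (simp add: algebra_simps)
    ultimately show ?thesis by (simp add: mult.assoc)
  qed
  also have "double_series m a - (- 1) ^ m * a ^ (2 * m) * b\<^sup>2 * double_series m b =
    (\<Sum>i<m. (- 1) ^ i * a ^ (2 * i) * (zeta_nat (2 * m - 2 * i) * zeta_nat (2 * i + 2)))"
    by (rule double_series_reciprocity[OF m ab])
  \<comment> \<open>The i-th product has Bernoulli indices m - i and i + 1, so it is the term j = m
    - i of the final sum; the order of summation is reversed afterwards.\<close>
  also have "b ^ m * a * \<dots> = (\<Sum>i<m. - (D / 4) * t (Suc (m - Suc i)))"
    unfolding sum_distrib_left
  proof (intro sum.cong refl)
    fix i assume "i \<in> {..<m}"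
    then have i: "i < m" by simp
    define l where "l = m - Suc i"
    have l: "m = i + l + 1" using i by (simp add: l_def)
    have "b ^ m * a * a ^ (2 * i) = (a * b) ^ i * (a ^ (i + 1) * b ^ (l + 1))"
      unfolding l by (simp add: power_add power_mult_distrib mult_2)
    then have 1: "b ^ m * a * a ^ (2 * i) = a ^ (i + 1) * b ^ (l + 1)" by (simp add: ab)
    have sl: "Suc m - Suc l = i + 1" using l by simp
    have z: "2 * m - 2 * i = 2 * Suc l" using l by simp
    have sgn: "(- 1) ^ Suc l * ((- 1) ^ (Suc l + 1) * (- 1) ^ (i + 1 + 1)) = - ((- 1) ^ i :: real)"
      by (simp add: power_add)
    have DD: "D = (2 * pi) ^ (2 * Suc l) * (2 * pi) ^ (2 * (i + 1))"
    proof -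
      have "2 * m + 2 = 2 * Suc l + 2 * (i + 1)" using l by simp
      then show ?thesis unfolding D_def by (metis power_add)
    qed
    have "t (Suc l) = ((- 1) ^ Suc l * ((- 1) ^ (Suc l + 1) * (- 1) ^ (i + 1 + 1))) * 4 * (zeta_nat (2 * Suc l) * zeta_nat (2 * (i + 1))) / D * (a ^ (i + 1) * b ^ Suc l)"
      unfolding t_def sl reduced_bernoulli_def DD by (simp del: power_Suc)
    also have "\<dots> = - (4 / D) * ((- 1) ^ i * (zeta_nat (2 * Suc l) * zeta_nat (2 * i + 2)) * (a ^ (i + 1) * b ^ Suc l))"
      unfolding sgn by simp
    finally have "- (D / 4) * t (Suc l) = (- 1) ^ i * (zeta_nat (2 * Suc l) * zeta_nat (2 * i + 2)) * (a ^ (i + 1) * b ^ Suc l)"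
      using D0 by simp
    moreover have "b ^ m * a * ((- 1) ^ i * a ^ (2 * i) * (zeta_nat (2 * m - 2 * i) * zeta_nat (2 * i + 2))) =
      (- 1) ^ i * (zeta_nat (2 * Suc l) * zeta_nat (2 * i + 2)) * (b ^ m * a * a ^ (2 * i))"
      unfolding z by (simp only: mult_ac)
    ultimately show "b ^ m * a * ((- 1) ^ i * a ^ (2 * i) * (zeta_nat (2 * m - 2 * i) * zeta_nat (2 * i + 2))) = - (D / 4) * t (Suc (m - Suc i))"
      unfolding l_def[symmetric] 1 by simp
  qed
  also have "\<dots> = - (D / 4) * (\<Sum>i<m. t (Suc i))"
    unfolding sum_distrib_left[symmetric] by (subst sum.nat_diff_reindex) simp
  \<comment> \<open>The zeta value at 2 m + 2 provides the extreme terms j = 0 and j = m + 1, in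
    which the other factor is B_0 = \<open>wt 0\<close>.\<close>
  also have "wt 0 * zeta_nat (2 * m + 2) / (2 * pi) * (b ^ Suc m - (- 1) ^ m * a ^ Suc m) = 1 / pi * (- (D / 4) * (t 0 + t (Suc m)))"
  proof -
    have R: "reduced_bernoulli (Suc m) = (- 1) ^ m * 2 * zeta_nat (2 * m + 2) / D"
      unfolding reduced_bernoulli_def D_def by simp
    have "t 0 = wt 0 * reduced_bernoulli (Suc m) * a ^ Suc m" "t (Suc m) = - (wt 0 * reduced_bernoulli (Suc m) * ((- 1) ^ m * b ^ Suc m))"
      by (simp_all add: t_def reduced_bernoulli_def[of 0])
    then have "t 0 + t (Suc m) = wt 0 * reduced_bernoulli (Suc m) * (a ^ Suc m - (- 1) ^ m * b ^ Suc m)"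
      by (simp only: right_diff_distrib add_uminus_conv_diff)
    also have "\<dots> = wt 0 * ((- 1) ^ m * 2 * zeta_nat (2 * m + 2) / D) * (a ^ Suc m - (- 1) ^ m * b ^ Suc m)" unfolding R ..
    also have "\<dots> = 2 / D * (wt 0 * zeta_nat (2 * m + 2)) * ((- 1) ^ m * a ^ Suc m - ((- 1) ^ m * (- 1) ^ m) * b ^ Suc m)"
      by (simp add: algebra_simps diff_divide_distrib)
    also have "(- 1) ^ m * (- 1) ^ m = (1 :: real)" by (simp flip: power_mult_distrib)
    finally have F: "- (D / 4) * (t 0 + t (Suc m)) = - (1 / 2) * (wt 0 * zeta_nat (2 * m + 2)) * ((- 1) ^ m * a ^ Suc m - 1 * b ^ Suc m)"
      using D0 by simp
    have "x / (2 * pi) * (v - u) = 1 / pi * (- (1 / 2) * x * (u - 1 * v))" for x u v :: real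
      by (simp add: field_simps)
    then show ?thesis unfolding F .
  qed
  also have "1 / pi * (- (D / 4) * (\<Sum>i<m. t (Suc i))) + 1 / pi * (- (D / 4) * (t 0 + t (Suc m))) = - (D / (4 * pi) * (t 0 + ((\<Sum>i<m. t (Suc i)) + t (Suc m))))"
    by (simp add: algebra_simps)
  also have "t 0 + ((\<Sum>i<m. t (Suc i)) + t (Suc m)) = (\<Sum>j\<le>Suc m. t j)"
    unfolding sum.atMost_shift by simp
  finally show ?thesis unfolding D t_def .
qed

section \<open>Return to the parameters \<alpha> and \<beta>\<close>

lemma inverse_sigma_eq_phir:
  "inverse_sigma_exp_minus_one p (root (Suc j) * \<alpha> / pi) (2 * \<alpha> * root (Suc j)) = phir (\<alpha> / pi * root (Suc j))"
  by (simp add: phir_def mult_ac)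

lemma zeta_odd:
  assumes "n \<ge> 1" shows "koshliakov_zeta p (of_int (2 * int n + 1)) = of_real (zeta_nat (2 * n + 1))"
proof -
  have "koshliakov_zeta p (of_int (2 * int n + 1)) = zeta_series (of_real (real (2 * n + 1)))"
    using zeta_eq_series[of "of_int (2 * int n + 1)"] assms by (simp add: add.commute)
  also have "\<dots> = of_real (\<Sum>j. wt (Suc j) * root (Suc j) powr (- real (2 * n + 1)))"
    using assms by (intro zeta_series_of_real) simp
  also have "(\<Sum>j. wt (Suc j) * root (Suc j) powr (- real (2 * n + 1))) = zeta_nat (2 * n + 1)"
    unfolding zeta_nat_def by (simp only: powr_minus powr_realpow[OF root_pos] divide_inverse)
  finally show ?thesis .
qed

lemma transformation_formula_positive:
  assumes n: "n \<ge> 1" and ab: "\<alpha> > 0" "\<beta> > 0" "\<alpha> * \<beta> = pi\<^sup>2"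
  shows "1 / \<alpha> ^ n * (zeta_nat (2 * n + 1) / 2 + series_positive n (\<alpha> / pi)) =
    1 / (- \<beta>) ^ n * (zeta_nat (2 * n + 1) / 2 + series_positive n (\<beta> / pi))
    - 2 ^ (2 * n) * (\<Sum>j\<le>Suc n. (- 1) ^ j * reduced_bernoulli j * reduced_bernoulli (Suc n - j) * (\<alpha> ^ (Suc n - j) * \<beta> ^ j))"
proof -
  define a b where "a = \<alpha> / pi" and "b = \<beta> / pi"
  have ab': "a > 0" "b > 0" "a * b = 1" using ab by (simp_all add: a_def b_def power2_eq_square)
  define U V where "U = zeta_nat (2 * n + 1) / 2 + series_positive n a" and "V = zeta_nat (2 * n + 1) / 2 + series_positive n b"
  define t where "t j = (- 1) ^ j * reduced_bernoulli j * reduced_bernoulli (Suc n - j)" for j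
  have \<alpha>: "\<alpha> = pi * a" "\<beta> = pi * b" by (simp_all add: a_def b_def)
  have id: "b ^ n * U - (- 1) ^ n * a ^ n * V = - (2 ^ (2 * n) * pi ^ (2 * n + 1) * (\<Sum>j\<le>Suc n. t j * (a ^ (Suc n - j) * b ^ j)))"
    using transformation_positive[OF n ab'] unfolding U_def V_def t_def .
  have 1: "1 / \<alpha> ^ n = 1 / pi ^ n * b ^ n"
  proof -
    have "\<alpha> ^ n * b ^ n = pi ^ n * (a * b) ^ n" unfolding \<alpha> by (simp add: power_mult_distrib)
    then show ?thesis using ab ab' by (simp add: field_simps)
  qed
  have 2: "1 / (- \<beta>) ^ n = 1 / pi ^ n * ((- 1) ^ n * a ^ n)"
  proof -
    have "(- \<beta>) * (- 1 * a) = pi * (a * b)" unfolding \<alpha> by simp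
    then have "(- \<beta>) * (- 1 * a) = pi" by (simp add: ab')
    then have "((- \<beta>) * (- 1 * a)) ^ n = pi ^ n" by simp
    then have "(- \<beta>) ^ n * ((- 1) ^ n * a ^ n) = pi ^ n" by (simp only: power_mult_distrib)
    moreover have "(- \<beta>) ^ n \<noteq> 0" using ab by simp
    moreover have "1 / x = 1 / c * y" if "x * y = c" "x \<noteq> 0" "c \<noteq> 0" for x y c :: real
      using that by auto
    ultimately show ?thesis by (metis pi_neq_zero power_not_zero)
  qed
  have 3: "(\<Sum>j\<le>Suc n. t j * (\<alpha> ^ (Suc n - j) * \<beta> ^ j)) = pi ^ Suc n * (\<Sum>j\<le>Suc n. t j * (a ^ (Suc n - j) * b ^ j))"
    unfolding sum_distrib_left
  proof (intro sum.cong refl)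
    fix j assume "j \<in> {..Suc n}"
    then have "pi ^ Suc n = pi ^ (Suc n - j) * pi ^ j" by (simp flip: power_add)
    then show "t j * (\<alpha> ^ (Suc n - j) * \<beta> ^ j) = pi ^ Suc n * (t j * (a ^ (Suc n - j) * b ^ j))"
      unfolding \<alpha> power_mult_distrib by (simp only: mult_ac)
  qed
  have "1 / \<alpha> ^ n * U - 1 / (- \<beta>) ^ n * V = 1 / pi ^ n * (b ^ n * U - (- 1) ^ n * a ^ n * V)"
    unfolding 1 2 by (simp only: right_diff_distrib mult.assoc)
  also have "\<dots> = - (2 ^ (2 * n) * (pi ^ (2 * n + 1) / pi ^ n) * (\<Sum>j\<le>Suc n. t j * (a ^ (Suc n - j) * b ^ j)))"
    unfolding id by simp
  also have "pi ^ (2 * n + 1) / pi ^ n = pi ^ Suc n" by (simp add: power_add mult_2)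
  finally have "1 / \<alpha> ^ n * U - 1 / (- \<beta>) ^ n * V = - (2 ^ (2 * n) * (\<Sum>j\<le>Suc n. t j * (\<alpha> ^ (Suc n - j) * \<beta> ^ j)))"
    unfolding 3 by (simp only: mult.assoc)
  then show ?thesis unfolding U_def V_def t_def a_def b_def by linarith
qed

lemma transformation_formula_negative:
  assumes n: "n \<ge> 1" and ab: "\<alpha> > 0" "\<beta> > 0" "\<alpha> * \<beta> = pi\<^sup>2"
  defines "S \<equiv> \<lambda>\<alpha>. \<Sum>j. wt (Suc j) * (root (Suc j) ^ (2 * n - 1) * phir (\<alpha> / pi * root (Suc j)))"
    and "Z' \<equiv> 2 * (- 1) ^ n * (\<integral>y. y ^ (2 * n - 1) * phir y \<partial>half_line)"
  shows "\<alpha> ^ n * (Z' / 2 + S \<alpha>) = (- \<beta>) ^ n * (Z' / 2 + S \<beta>) - 1 / 2 ^ (2 * n) * (0 ^ (n - 1) * (wt 0)\<^sup>2)"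
proof -
  define a b where "a = \<alpha> / pi" and "b = \<beta> / pi"
  have ab': "a > 0" "b > 0" "a * b = 1" using ab by (simp_all add: a_def b_def power2_eq_square)
  have \<alpha>: "\<alpha> = pi * a" "- \<beta> = pi * (- b)" by (simp_all add: a_def b_def)
  have id: "a ^ n * (Z' / 2 + S \<alpha>) = (- b) ^ n * (Z' / 2 + S \<beta>) - 0 ^ (n - 1) * (wt 0)\<^sup>2 / (4 * pi)"
    using transformation_negative[OF n ab'] unfolding S_def Z'_def a_def b_def .
  have "\<alpha> ^ n * (Z' / 2 + S \<alpha>) = pi ^ n * (a ^ n * (Z' / 2 + S \<alpha>))"
    by (simp only: \<alpha>(1)[THEN arg_cong[of _ _ "\<lambda>x. x ^ n"]] power_mult_distrib mult.assoc)
  also have "\<dots> = pi ^ n * (- b) ^ n * (Z' / 2 + S \<beta>) - pi ^ n * (0 ^ (n - 1) * (wt 0)\<^sup>2 / (4 * pi))"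
    unfolding id by (simp only: right_diff_distrib mult.assoc)
  also have "pi ^ n * (- b) ^ n = (- \<beta>) ^ n" unfolding \<alpha> power_mult_distrib ..
  \<comment> \<open>For n = 1 this is pi / (4 pi) = 2^(-2); for larger n both sides are 0.\<close>
  also have "pi ^ n * (0 ^ (n - 1) * (wt 0)\<^sup>2 / (4 * pi)) = 1 / 2 ^ (2 * n) * (0 ^ (n - 1) * (wt 0)\<^sup>2)"
    using n by (cases "n = 1") (auto simp: power2_eq_square power_0_left)
  finally show ?thesis .
qed

end

theorem theorem4p1:
  fixes p \<alpha> \<beta> :: real and m :: int
  assumes "p > 0" and "m \<noteq> 0" and "\<alpha> > 0" and "\<beta> > 0" and "\<alpha> * \<beta> = pi\<^sup>2"
  shows
    "of_real (\<alpha> powi (- m)) *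
       (1 / 2 * koshliakov_zeta p (of_int (2 * m + 1)) +
        of_real (\<Sum>j. koshliakov_weight p (Suc j) *
          (koshliakov_root p (Suc j) powi (- 2 * m - 1) *
           inverse_sigma_exp_minus_one p (koshliakov_root p (Suc j) * \<alpha> / pi)
             (2 * \<alpha> * koshliakov_root p (Suc j)))))
     = of_real ((- \<beta>) powi (- m)) *
       (1 / 2 * koshliakov_zeta p (of_int (2 * m + 1)) +
        of_real (\<Sum>j. koshliakov_weight p (Suc j) *
          (koshliakov_root p (Suc j) powi (- 2 * m - 1) *
           inverse_sigma_exp_minus_one p (koshliakov_root p (Suc j) * \<beta> / pi)
             (2 * \<beta> * koshliakov_root p (Suc j)))))
       - of_real (2 powi (2 * m)) *
         (\<Sum>j\<in>{j :: nat. int j \<le> m + 1}.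
            (- 1) ^ j * koshliakov_bernoulli p j * koshliakov_bernoulli p (nat (m - int j + 1)) /
              (fact (2 * j) * fact (nat (2 * m - 2 * int j + 2))) *
            of_real (\<alpha> powi (m - int j + 1) * \<beta> ^ j))"
proof -
  interpret koshliakov p by standard (rule assms(1))
  note ab = assms(3-5)
  show ?thesis
  proof (cases "m > 0")
    case True
    define n where "n = nat m"
    have m: "m = int n" and n: "n \<ge> 1" using True by (simp_all add: n_def)
    have e: "- 2 * m - 1 = - int (2 * n + 1)" by (simp add: m)
    have r: "root (Suc j) powi (- 2 * m - 1) = 1 / root (Suc j) ^ (2 * n + 1)" for j
      unfolding e power_int_minus power_int_of_nat by (rule inverse_eq_divide)
    have pw: "x powi (- m) = 1 / x ^ n" for x :: real
      unfolding m power_int_minus power_int_of_nat by (rule inverse_eq_divide)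
    have two: "(2::real) powi (2 * m) = 2 ^ (2 * n)"
    proof -
      have "2 * m = int (2 * n)" by (simp add: m)
      then show ?thesis by (simp only: power_int_of_nat)
    qed
    have set: "{j :: nat. int j \<le> m + 1} = {..Suc n}" by (auto simp: m)
    have sum: "(\<Sum>j\<in>{j :: nat. int j \<le> m + 1}.
            (- 1) ^ j * koshliakov_bernoulli p j * koshliakov_bernoulli p (nat (m - int j + 1)) /
              (fact (2 * j) * fact (nat (2 * m - 2 * int j + 2))) *
            of_real (\<alpha> powi (m - int j + 1) * \<beta> ^ j)) =
       complex_of_real (\<Sum>j\<le>Suc n. (- 1) ^ j * reduced_bernoulli j * reduced_bernoulli (Suc n - j) * (\<alpha> ^ (Suc n - j) * \<beta> ^ j))"
      unfolding set of_real_sum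
    proof (intro sum.cong refl)
      fix j assume "j \<in> {..Suc n}"
      then have i: "m - int j + 1 = int (Suc n - j)" "2 * m - 2 * int j + 2 = int (2 * (Suc n - j))"
        by (auto simp: m of_nat_diff)
      have f: "(fact k :: complex) = of_real (fact k)" for k by simp
      have "(- 1) ^ j * koshliakov_bernoulli p j * koshliakov_bernoulli p (nat (m - int j + 1)) /
              (fact (2 * j) * fact (nat (2 * m - 2 * int j + 2))) * of_real (\<alpha> powi (m - int j + 1) * \<beta> ^ j)
          = complex_of_real ((- 1) ^ j * (fact (2 * j) * reduced_bernoulli j) * (fact (2 * (Suc n - j)) * reduced_bernoulli (Suc n - j)) /
              (fact (2 * j) * fact (2 * (Suc n - j))) * (\<alpha> ^ (Suc n - j) * \<beta> ^ j))"
        unfolding i nat_int power_int_of_nat koshliakov_bernoulli_eq f by simp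
      also have "(- 1) ^ j * (fact (2 * j) * reduced_bernoulli j) * (fact (2 * (Suc n - j)) * reduced_bernoulli (Suc n - j)) /
              (fact (2 * j) * fact (2 * (Suc n - j))) * (\<alpha> ^ (Suc n - j) * \<beta> ^ j)
          = (- 1) ^ j * reduced_bernoulli j * reduced_bernoulli (Suc n - j) * (\<alpha> ^ (Suc n - j) * \<beta> ^ j)"
        by simp
      finally show "(- 1) ^ j * koshliakov_bernoulli p j * koshliakov_bernoulli p (nat (m - int j + 1)) /
              (fact (2 * j) * fact (nat (2 * m - 2 * int j + 2))) * of_real (\<alpha> powi (m - int j + 1) * \<beta> ^ j)
          = complex_of_real ((- 1) ^ j * reduced_bernoulli j * reduced_bernoulli (Suc n - j) * (\<alpha> ^ (Suc n - j) * \<beta> ^ j))" .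
    qed
    have zeta: "1 / 2 * koshliakov_zeta p (of_int (2 * m + 1)) = of_real (zeta_nat (2 * n + 1) / 2)"
      unfolding m zeta_odd[OF n] by simp
    show ?thesis
      unfolding inverse_sigma_eq_phir r pw two sum zeta series_positive_def[symmetric]
      using arg_cong[OF transformation_formula_positive[OF n ab], of complex_of_real]
      by (simp only: of_real_mult of_real_add of_real_diff)
  next
    case False
    define n where "n = nat (- m)"
    have m: "m = - int n" and n: "n \<ge> 1" using False assms(2) by (auto simp: n_def)
    have e: "- 2 * m - 1 = int (2 * n - 1)" using n by (simp add: m of_nat_diff)
    have r: "root (Suc j) powi (- 2 * m - 1) = root (Suc j) ^ (2 * n - 1)" for j
      unfolding e power_int_of_nat ..
    have pw: "x powi (- m) = x ^ n" for x :: real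
      unfolding m by simp
    have two: "(2::real) powi (2 * m) = 1 / 2 ^ (2 * n)"
    proof -
      have "2 * m = - int (2 * n)" by (simp add: m)
      then show ?thesis by (simp only: power_int_minus power_int_of_nat inverse_eq_divide)
    qed
    have sum: "(\<Sum>j\<in>{j :: nat. int j \<le> m + 1}.
            (- 1) ^ j * koshliakov_bernoulli p j * koshliakov_bernoulli p (nat (m - int j + 1)) /
              (fact (2 * j) * fact (nat (2 * m - 2 * int j + 2))) *
            of_real (\<alpha> powi (m - int j + 1) * \<beta> ^ j)) =
       complex_of_real (0 ^ (n - 1) * (wt 0)\<^sup>2)"
    proof (cases "n = 1")
      case True
      \<comment> \<open>For m = -1 only j = 0 remains, and the sum is the square of B_0; for m < -1
        the index set is empty.\<close>
      have "{j :: nat. int j \<le> m + 1} = {0}" by (auto simp: m True)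
      then show ?thesis using True
        by (simp add: m koshliakov_bernoulli_eq reduced_bernoulli_def power2_eq_square)
    next
      case False
      then have "{j :: nat. int j \<le> m + 1} = {}" using n by (auto simp: m)
      then show ?thesis using False n by simp
    qed
    have zeta: "1 / 2 * koshliakov_zeta p (of_int (2 * m + 1)) =
      of_real (2 * (- 1) ^ n * (\<integral>y. y ^ (2 * n - 1) * phir y \<partial>half_line) / 2)"
    proof -
      have "2 * m + 1 = 1 - 2 * int n" by (simp add: m)
      then show ?thesis using zeta_negative_odd[of n] n by simp
    qed
    show ?thesis
      unfolding inverse_sigma_eq_phir r pw two sum zeta
      using arg_cong[OF transformation_formula_negative[OF n ab], of complex_of_real]
      by (simp only: of_real_mult of_real_add of_real_diff)
  qed
qed

end
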